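(* Let $\Omega\subset\mathbb{R}^2$ be a bounded domain with $C^2$-boundary and let $\varphi\in C^2(\overline{\Omega})$. Let $\overline{W}$ be the $L^1(\Omega)$-lower semicontinuous relaxation of the Willmore functional under Dirichlet boundary conditions given by $\varphi$. Then there exists a function $u\in BV(\Omega)\cap L^\infty(\Omega)$ such that $$\forall v\in L^1(\Omega):\quad \overline{W}(u)\le\overline{W}(v).$$
   Context: For $v\in H^2(\Omega)$ the Willmore energy of its graph is $$W_0(v)=\frac14\int_\Omega\Bigl(\nabla\cdot\frac{\nabla v}{\sqrt{1+|\nabla v|^2}}\Bigr)^2\sqrt{1+|\nabla v|^2}\,dx .$$ Set $\mathcal{M}:=\{v\in H^2(\Omega): v-\varphi\in H^2_0(\Omega)\}$. The relaxation is $$\overline{W}:L^1(\Omega)\to[0,\infty],\quad \overline{W}(u):=\inf\Bigl\{\liminf_{k\to\infty}W_0(u_k):\ u_k\in\mathcal{M},\ u_k\to u\text{ in }L^1(\Omega)\Bigr\}.$$ *)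

theory Defs
  imports "HOL-Analysis.Analysis"
begin

text \<open>
  Elements of \<open>L\<^sup>p\<close>, Sobolev and \<open>BV\<close> spaces are represented by functions on the whole space whose
  values outside \<open>\<Omega>\<close> are irrelevant; the notions concerning these spaces are invariant under changes on null sets.
\<close>

subsection \<open>Continuously differentiable functions\<close>

text \<open>A multi-index is represented by the list of coordinate directions of differentiation.\<close>

definition multi_indices :: "nat \<Rightarrow> 'a::euclidean_space list set" where
  "multi_indices k = {bs. set bs \<subseteq> Basis \<and> length bs \<le> k}"

primrec partials ::
  "'a::euclidean_space list \<Rightarrow> ('a \<Rightarrow> 'b::real_normed_vector) \<Rightarrow> 'a \<Rightarrow> 'b" where
  "partials [] f = f"
| "partials (b # bs) f = (\<lambda>x. frechet_derivative (partials bs f) (at x) b)"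

text \<open>\<open>C\<^sup>k(S)\<close>, for open \<open>S\<close>.\<close>

definition Ck_on :: "nat \<Rightarrow> 'a::euclidean_space set \<Rightarrow> ('a \<Rightarrow> 'b::real_normed_vector) set" where
  "Ck_on k S = {f.
     (\<forall>bs \<in> multi_indices k. length bs < k \<longrightarrow> (\<forall>x\<in>S. partials bs f differentiable (at x))) \<and>
     (\<forall>bs \<in> multi_indices k. continuous_on S (partials bs f))}"

text \<open>\<open>C\<^sup>k\<close> up to the boundary: all derivatives up to order \<open>k\<close> extend continuously to the closure.\<close>

definition Ck_closure :: "nat \<Rightarrow> 'a::euclidean_space set \<Rightarrow> ('a \<Rightarrow> real) set" where
  "Ck_closure k \<Omega> = {f \<in> Ck_on k \<Omega>. continuous_on (closure \<Omega>) f \<and>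
     (\<forall>bs \<in> multi_indices k. \<exists>g. continuous_on (closure \<Omega>) g \<and> (\<forall>x\<in>\<Omega>. g x = partials bs f x))}"

definition compactly_supported_in :: "'a::euclidean_space set \<Rightarrow> ('a \<Rightarrow> 'b::real_normed_vector) set" where
  "compactly_supported_in \<Omega> = {f. compact (closure {x. f x \<noteq> 0}) \<and> closure {x. f x \<noteq> 0} \<subseteq> \<Omega>}"

definition test_functions :: "'a::euclidean_space set \<Rightarrow> ('a \<Rightarrow> real) set" where
  "test_functions \<Omega> = (\<Inter>k. Ck_on k UNIV) \<inter> compactly_supported_in \<Omega>"

text \<open>
  In suitable Cartesian coordinates around each boundary point, the set is locally the part of
  the plane strictly above the graph of a \<open>C\<^sup>k\<close> function.
\<close>

definition Ck_boundary :: "nat \<Rightarrow> (real^2) set \<Rightarrow> bool" where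
  "Ck_boundary k \<Omega> \<longleftrightarrow> (\<forall>p \<in> frontier \<Omega>. \<exists>r>0. \<exists>T :: real^2 \<Rightarrow> real^2. \<exists>\<gamma> \<in> Ck_on k (UNIV :: real set).
     orthogonal_transformation T \<and>
     \<Omega> \<inter> ball p r = {x \<in> ball p r. T x $ 2 > \<gamma> (T x $ 1)})"

subsection \<open>Lebesgue and Sobolev spaces\<close>

definition L1 :: "'a::euclidean_space set \<Rightarrow> ('a \<Rightarrow> real) set" where
  "L1 \<Omega> = {f. integrable (lebesgue_on \<Omega>) f}"

definition L2 :: "'a::euclidean_space set \<Rightarrow> ('a \<Rightarrow> real) set" where
  "L2 \<Omega> = {f \<in> borel_measurable (lebesgue_on \<Omega>). integrable (lebesgue_on \<Omega>) (\<lambda>x. (f x)\<^sup>2)}"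

definition Linfty :: "'a::euclidean_space set \<Rightarrow> ('a \<Rightarrow> real) set" where
  "Linfty \<Omega> = {f \<in> borel_measurable (lebesgue_on \<Omega>). \<exists>C. AE x in lebesgue_on \<Omega>. \<bar>f x\<bar> \<le> C}"

definition L1_loc :: "'a::euclidean_space set \<Rightarrow> ('a \<Rightarrow> real) set" where
  "L1_loc \<Omega> = {f. \<forall>K. compact K \<and> K \<subseteq> \<Omega> \<longrightarrow> integrable (lebesgue_on K) f}"

definition is_weak_deriv ::
  "'a::euclidean_space set \<Rightarrow> 'a list \<Rightarrow> ('a \<Rightarrow> real) \<Rightarrow> ('a \<Rightarrow> real) \<Rightarrow> bool" where
  "is_weak_deriv \<Omega> bs f g \<longleftrightarrow> f \<in> L1_loc \<Omega> \<and> g \<in> L1_loc \<Omega> \<and>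
     (\<forall>\<zeta> \<in> test_functions \<Omega>.
        (\<integral>x. f x * partials bs \<zeta> x \<partial>lebesgue_on \<Omega>)
        = (-1) ^ length bs * (\<integral>x. g x * \<zeta> x \<partial>lebesgue_on \<Omega>))"

text \<open>A representative of the weak derivative, which is unique up to null sets if it exists.\<close>

definition weak_deriv :: "'a::euclidean_space set \<Rightarrow> 'a list \<Rightarrow> ('a \<Rightarrow> real) \<Rightarrow> 'a \<Rightarrow> real" where
  "weak_deriv \<Omega> bs f = (SOME g. is_weak_deriv \<Omega> bs f g)"

definition sobolev_H :: "nat \<Rightarrow> 'a::euclidean_space set \<Rightarrow> ('a \<Rightarrow> real) set" where
  "sobolev_H k \<Omega> = {f \<in> L2 \<Omega>. \<forall>bs \<in> multi_indices k. \<exists>g \<in> L2 \<Omega>. is_weak_deriv \<Omega> bs f g}"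

definition sobolev_norm :: "nat \<Rightarrow> 'a::euclidean_space set \<Rightarrow> ('a \<Rightarrow> real) \<Rightarrow> real" where
  "sobolev_norm k \<Omega> f =
     sqrt (\<Sum>bs \<in> multi_indices k. \<integral>x. (weak_deriv \<Omega> bs f x)\<^sup>2 \<partial>lebesgue_on \<Omega>)"

text \<open>The closure of the test functions in \<open>H\<^sup>k(\<Omega>)\<close>.\<close>

definition sobolev_H0 :: "nat \<Rightarrow> 'a::euclidean_space set \<Rightarrow> ('a \<Rightarrow> real) set" where
  "sobolev_H0 k \<Omega> = {f \<in> sobolev_H k \<Omega>. \<exists>\<zeta> :: nat \<Rightarrow> 'a \<Rightarrow> real.
     (\<forall>n. \<zeta> n \<in> test_functions \<Omega>) \<and>
     (\<lambda>n. sobolev_norm k \<Omega> (\<lambda>x. f x - \<zeta> n x)) \<longlonglongrightarrow> 0}"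

subsection \<open>Functions of bounded variation\<close>

definition total_variation :: "'a::euclidean_space set \<Rightarrow> ('a \<Rightarrow> real) \<Rightarrow> ereal" where
  "total_variation \<Omega> u =
     (SUP \<zeta> \<in> {\<zeta> :: 'a \<Rightarrow> 'a. \<zeta> \<in> Ck_on 1 UNIV \<inter> compactly_supported_in \<Omega> \<and> (\<forall>x. norm (\<zeta> x) \<le> 1)}.
        ereal (\<integral>x. u x * (\<Sum>b\<in>Basis. partials [b] \<zeta> x \<bullet> b) \<partial>lebesgue_on \<Omega>))"

definition BV :: "'a::euclidean_space set \<Rightarrow> ('a \<Rightarrow> real) set" where
  "BV \<Omega> = {u \<in> L1 \<Omega>. total_variation \<Omega> u < \<infinity>}"

subsection \<open>The Willmore energy of graphs and its relaxation\<close>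

definition weak_grad :: "'a::euclidean_space set \<Rightarrow> ('a \<Rightarrow> real) \<Rightarrow> 'a \<Rightarrow> 'a" where
  "weak_grad \<Omega> v x = (\<Sum>b\<in>Basis. weak_deriv \<Omega> [b] v x *\<^sub>R b)"

definition weak_div :: "'a::euclidean_space set \<Rightarrow> ('a \<Rightarrow> 'a) \<Rightarrow> 'a \<Rightarrow> real" where
  "weak_div \<Omega> V x = (\<Sum>b\<in>Basis. weak_deriv \<Omega> [b] (\<lambda>y. V y \<bullet> b) x)"

definition area_element :: "'a::euclidean_space set \<Rightarrow> ('a \<Rightarrow> real) \<Rightarrow> 'a \<Rightarrow> real" where
  "area_element \<Omega> v x = sqrt (1 + (norm (weak_grad \<Omega> v x))\<^sup>2)"

definition willmore :: "(real^2) set \<Rightarrow> (real^2 \<Rightarrow> real) \<Rightarrow> ennreal" where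
  "willmore \<Omega> v = 1 / 4 *
     (\<integral>\<^sup>+x. ennreal ((weak_div \<Omega> (\<lambda>y. weak_grad \<Omega> v y /\<^sub>R area_element \<Omega> v y) x)\<^sup>2 * area_element \<Omega> v x)
        \<partial>lebesgue_on \<Omega>)"

definition dirichlet_class :: "(real^2) set \<Rightarrow> (real^2 \<Rightarrow> real) \<Rightarrow> (real^2 \<Rightarrow> real) set" where
  "dirichlet_class \<Omega> \<phi> = {v \<in> sobolev_H 2 \<Omega>. (\<lambda>x. v x - \<phi> x) \<in> sobolev_H0 2 \<Omega>}"

definition L1_tendsto ::
  "'a::euclidean_space set \<Rightarrow> (nat \<Rightarrow> 'a \<Rightarrow> real) \<Rightarrow> ('a \<Rightarrow> real) \<Rightarrow> bool" where
  "L1_tendsto \<Omega> w u \<longleftrightarrow> (\<lambda>k. \<integral>\<^sup>+x. ennreal \<bar>w k x - u x\<bar> \<partial>lebesgue_on \<Omega>) \<longlonglongrightarrow> 0"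

text \<open>Intended for \<open>u \<in> L1 \<Omega>\<close>; the infimum of the empty set is \<open>\<infinity>\<close>.\<close>

definition relaxed_willmore ::
  "(real^2) set \<Rightarrow> (real^2 \<Rightarrow> real) \<Rightarrow> (real^2 \<Rightarrow> real) \<Rightarrow> ennreal" where
  "relaxed_willmore \<Omega> \<phi> u =
     Inf {liminf (\<lambda>k. willmore \<Omega> (w k)) |w.
            (\<forall>k. w k \<in> dirichlet_class \<Omega> \<phi>) \<and> L1_tendsto \<Omega> w u}"

end

theory Submission
  imports Defs "HOL-Complex_Analysis.Great_Picard"
begin

text \<open>
  Since test functions are dense in the space of increments allowed by the boundary condition and the
  Willmore energy is continuous in \<open>H\<^sup>2\<close>, a minimising sequence may be taken among classical graphs
  \<open>z = \<phi> + \<zeta>\<close> with \<open>\<zeta>\<close> a test function. Every boundary term in an integration by parts over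
  such a graph agrees with the one over the graph of \<open>\<phi>\<close>, so no trace theory is needed: it suffices to
  subtract the two identities. Along the horizontal field \<open>x\<close> the first variation of area bounds the
  area by a multiple of the energy plus a constant. Simon's monotonicity formula gives every unit ball
  centred on the graph, at a height well above \<open>sup \<bar>\<phi>\<bar>\<close>, a fixed amount of area plus energy. The
  graph is connected, so a large value of \<open>sup \<bar>z\<bar>\<close> would produce many disjoint balls of this kind;
  hence \<open>z\<close> is bounded uniformly. The area bound controls the total variation, a subsequence
  converges in \<open>L\<^sup>1\<close>, its limit lies in \<open>BV\<close> and is bounded, and it minimises the relaxation because it
  attains the infimum of the energy over the admissible class.
\<close>

subsection \<open>Integration by parts\<close>

text \<open>Bounded energy does not bound the Hessian in \<open>L2\<close>: at steep points
  \<open>willmore_density\<close> damps it, so compactness in \<open>H\<^sup>2\<close> is lost and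
  only area and height can survive a limit. Both are controlled by one divergence identity,
  \<open>dV_sum\<close>, with two fields. The horizontal position field has tangential divergence
  \<open>1 + 1 / Q\<^sup>2\<close>, at least 1, so Young's inequality can absorb the curvature term.
  The second field is radial, its singular factor 1 / |y|^2 regularised by \<open>e\<close> and cut
  off in the unit ball. Its divergence contains \<open>kernel\<close>, which for \<open>e\<close> to
  0 becomes a point mass 2 pi at the centre. No limit is taken: one small \<open>e\<close> and one
  explicit parallelogram already give 1 / 24, and any positive constant serves the counting of
  disjoint slabs. A further obstacle is that the energy is defined through chosen weak derivatives
  while the estimates need classical ones; \<open>dirichlet_class_approx\<close> is the bridge. The
  classical graphs serve only for estimates, and the recovery sequence for the relaxation stays the
  original one.\<close>

lemma integrable_continuous_compact_support:
  fixes f :: "'a::euclidean_space \<Rightarrow> real"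
  assumes "continuous_on UNIV f" "compact K" "\<And>x. x \<notin> K \<Longrightarrow> f x = 0"
  shows "integrable lborel f"
proof -
  have "integrable lborel (\<lambda>x. indicator K x *\<^sub>R f x)"
    using assms by (intro borel_integrable_compact) (auto intro: continuous_on_subset)
  also have "(\<lambda>x. indicator K x *\<^sub>R f x) = f"
    using assms(3) by (auto simp: indicator_def fun_eq_iff)
  finally show ?thesis .
qed

lemma integral_lborel_shift:
  fixes f :: "'a::euclidean_space \<Rightarrow> real"
  assumes [measurable]: "f \<in> borel_measurable borel"
  shows "(\<integral>x. f (c + x) \<partial>lborel) = (\<integral>x. f x \<partial>lborel)"
proof -
  have "(\<integral>x. f x \<partial>lborel) = (\<integral>x. f x \<partial>distr lborel borel ((+) c))"
    by (simp add: lborel_distr_plus)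
  also have "\<dots> = (\<integral>x. f (c + x) \<partial>lborel)"
    by (subst integral_distr) auto
  finally show ?thesis by simp
qed

lemma integrable_lborel_shift:
  fixes f :: "'a::euclidean_space \<Rightarrow> real"
  assumes "integrable lborel f"
  shows "integrable lborel (\<lambda>x. f (c + x))"
proof -
  have "integrable (distr lborel borel ((+) c)) f"
    using assms by (simp add: lborel_distr_plus)
  then show ?thesis
    by (subst (asm) integrable_distr_eq) (use assms in auto)
qed

text \<open>Translation invariance makes every difference quotient \<open>q n\<close> integrate to
  0, and \<open>q n\<close> tends to \<open>d\<close> boundedly on a common ball. The last claim is
  the translation estimate that later yields compactness in \<open>L1\<close>.\<close>

lemma integral_directional_derivative_UNIV:
  fixes F d :: "'a::euclidean_space \<Rightarrow> real"
  assumes K: "compact K" "\<And>x. x \<notin> K \<Longrightarrow> F x = 0" "\<And>x. x \<notin> K \<Longrightarrow> d x = 0"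
    and F: "\<And>x. (F has_derivative F' x) (at x)" "\<And>x. F' x b = d x"
    and d: "continuous_on UNIV d"
  shows "integrable lborel d" "(\<integral>x. d x \<partial>lborel) = 0"
    and "(\<integral>x. \<bar>F (b + x) - F x\<bar> \<partial>lborel) \<le> (\<integral>x. \<bar>d x\<bar> \<partial>lborel)"
proof -
  show intd: "integrable lborel d"
    by (rule integrable_continuous_compact_support[OF d K(1,3)])
  have contF: "continuous_on UNIV F"
    using F(1) by (auto simp: continuous_on_eq_continuous_at intro: has_derivative_continuous)
  have intF: "integrable lborel F"
    by (rule integrable_continuous_compact_support[OF contF K(1,2)])
  have [measurable]: "F \<in> borel_measurable borel" "d \<in> borel_measurable borel"
    using contF d by (auto intro: borel_measurable_continuous_onI)
  obtain B where B: "\<And>x. \<bar>d x\<bar> \<le> B"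
  proof -
    have "compact (d ` K)"
      by (intro compact_continuous_image K) (auto intro: continuous_on_subset[OF d])
    then obtain B where "\<And>x. x \<in> K \<Longrightarrow> \<bar>d x\<bar> \<le> B"
      by (metis (mono_tags, lifting) bounded_iff compact_imp_bounded image_eqI real_norm_def)
    then have "\<bar>d x\<bar> \<le> max B 0" for x
      using K(3)[of x] by (cases "x \<in> K") force+
    then show ?thesis using that by blast
  qed
  obtain R where R: "\<And>x. x \<in> K \<Longrightarrow> norm x \<le> R"
    using compact_imp_bounded[OF K(1)] by (auto simp: bounded_iff)
  define q where "q n x = real (Suc n) * (F ((1 / real (Suc n)) *\<^sub>R b + x) - F x)" for n x
  have Fline: "((\<lambda>t. F (t *\<^sub>R b + x)) has_real_derivative d (s *\<^sub>R b + x)) (at s)" for x s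
  proof -
    have "((\<lambda>t. F (t *\<^sub>R b + x)) has_derivative (\<lambda>t. F' (s *\<^sub>R b + x) (t *\<^sub>R b))) (at s)"
      by (rule has_derivative_compose[OF _ F(1), where f = "\<lambda>t. t *\<^sub>R b + x"])
         (auto intro!: derivative_eq_intros)
    moreover have "(\<lambda>t. F' (s *\<^sub>R b + x) (t *\<^sub>R b)) = (*) (d (s *\<^sub>R b + x))"
      using F(2)[of "s *\<^sub>R b + x"] linear_scale[OF has_derivative_linear[OF F(1)[of "s *\<^sub>R b + x"]]]
      by (auto simp: fun_eq_iff mult.commute)
    ultimately show ?thesis by (simp add: has_field_derivative_def)
  qed
  have q0: "(\<integral>x. q n x \<partial>lborel) = 0" for n
    unfolding q_def
    by (simp add: integral_lborel_shift integrable_lborel_shift intF)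
  have qlim: "(\<lambda>n. q n x) \<longlonglongrightarrow> d x" for x
  proof -
    have "((\<lambda>h. (F (h *\<^sub>R b + x) - F x) / h) \<longlongrightarrow> d x) (at 0)"
      using Fline[of x 0] by (simp add: has_field_derivative_iff)
    moreover have "filterlim (\<lambda>n. 1 / real (Suc n)) (at 0) sequentially"
      unfolding filterlim_at using LIMSEQ_Suc[OF lim_1_over_n] by (auto simp: eventually_sequentially)
    ultimately have "(\<lambda>n. (F ((1 / real (Suc n)) *\<^sub>R b + x) - F x) / (1 / real (Suc n))) \<longlonglongrightarrow> d x"
      by (rule filterlim_compose)
    then show ?thesis unfolding q_def by (simp add: mult.commute)
  qed
  \<comment> \<open>The mean value theorem turns a quotient into a value of \<open>d\<close>, so the
    bound \<open>B\<close> is uniform in \<open>n\<close>.\<close>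
  have qb: "\<bar>q n x\<bar> \<le> B" for n x
  proof -
    define h where "h = 1 / real (Suc n)"
    have "h > 0" by (simp add: h_def)
    then obtain s where s: "0 < s" "s < h" "F (h *\<^sub>R b + x) - F (0 *\<^sub>R b + x) = (h - 0) * d (s *\<^sub>R b + x)"
      using MVT2[of 0 h "\<lambda>t. F (t *\<^sub>R b + x)" "\<lambda>s. d (s *\<^sub>R b + x)"] Fline by blast
    then have "q n x = d (s *\<^sub>R b + x)"
      by (simp add: q_def h_def)
    then show ?thesis using B by simp
  qed
  \<comment> \<open>The shift has length at most \<open>norm b\<close>, hence the enlarged radius
    serves all \<open>n\<close>.\<close>
  have q_supp: "q n x = 0" if "norm x > R + norm b" for n x
  proof -
    have "x \<notin> K" using R[of x] that norm_ge_zero[of b] by fastforce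
    moreover have "(1 / real (Suc n)) *\<^sub>R b + x \<notin> K"
    proof
      assume "(1 / real (Suc n)) *\<^sub>R b + x \<in> K"
      then have 1: "norm ((1 / real (Suc n)) *\<^sub>R b + x) \<le> R" by (rule R)
      have "norm ((1 / real (Suc n)) *\<^sub>R b) \<le> 1 * norm b"
        unfolding norm_scaleR by (intro mult_right_mono) auto
      then show False
        using 1 that norm_triangle_ineq4[of "(1 / real (Suc n)) *\<^sub>R b + x" "(1 / real (Suc n)) *\<^sub>R b"] by simp
    qed
    ultimately show ?thesis by (simp add: q_def K(2))
  qed
  have "(\<lambda>n. \<integral>x. q n x \<partial>lborel) \<longlonglongrightarrow> (\<integral>x. d x \<partial>lborel)"
  proof (rule integral_dominated_convergence)
    show "integrable lborel (\<lambda>x. indicator (cball 0 (R + norm b)) x *\<^sub>R B)"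
      by (intro borel_integrable_compact) auto
    show "AE x in lborel. norm (q n x) \<le> indicator (cball 0 (R + norm b)) x *\<^sub>R B" for n
      using qb[of n] q_supp[of _ n] by (auto simp: indicator_def not_le)
    show "AE x in lborel. (\<lambda>n. q n x) \<longlonglongrightarrow> d x"
      using qlim by simp
    show "(\<lambda>x. q n x) \<in> borel_measurable lborel" for n
      unfolding q_def by measurable
  qed simp
  with q0 show "(\<integral>x. d x \<partial>lborel) = 0"
    by (simp add: LIMSEQ_const_iff)
  have abs_lim: "(\<lambda>n. \<integral>x. \<bar>q n x\<bar> \<partial>lborel) \<longlonglongrightarrow> (\<integral>x. \<bar>d x\<bar> \<partial>lborel)"
  proof (rule integral_dominated_convergence)
    show "integrable lborel (\<lambda>x. indicator (cball 0 (R + norm b)) x *\<^sub>R B)"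
      by (intro borel_integrable_compact) auto
    show "AE x in lborel. norm \<bar>q n x\<bar> \<le> indicator (cball 0 (R + norm b)) x *\<^sub>R B" for n
      using qb[of n] q_supp[of _ n] by (auto simp: indicator_def not_le)
    show "AE x in lborel. (\<lambda>n. \<bar>q n x\<bar>) \<longlonglongrightarrow> \<bar>d x\<bar>"
      using qlim by (intro AE_I2 tendsto_rabs)
    show "(\<lambda>x. \<bar>q n x\<bar>) \<in> borel_measurable lborel" for n
      unfolding q_def by measurable
  qed simp
  \<comment> \<open>A shift by \<open>b\<close> splits into \<open>Suc n\<close> equal small shifts.
    Translation invariance gives all of them the same integral, and together they amount to the
    integral of \<open>|q n|\<close>; letting \<open>n\<close> grow replaces the quotient by
    \<open>d\<close>.\<close>
  have "(\<integral>x. \<bar>F (b + x) - F x\<bar> \<partial>lborel) \<le> (\<integral>x. \<bar>q n x\<bar> \<partial>lborel)" for n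
  proof -
    define h where "h = (1 / real (Suc n)) *\<^sub>R b"
    define D where "D j x = \<bar>F (h + (real j *\<^sub>R h + x)) - F (real j *\<^sub>R h + x)\<bar>" for j x
    have int0: "integrable lborel (\<lambda>x. \<bar>F (h + x) - F x\<bar>)"
      by (intro integrable_abs Bochner_Integration.integrable_diff integrable_lborel_shift intF)
    have intD: "integrable lborel (D j)" for j
      unfolding D_def by (rule integrable_lborel_shift[OF int0])
    have "\<bar>F (b + x) - F x\<bar> \<le> (\<Sum>j<Suc n. D j x)" for x
    proof -
      have "F (real k *\<^sub>R h + x) - F x = (\<Sum>j<k. F (h + (real j *\<^sub>R h + x)) - F (real j *\<^sub>R h + x))" for k
        by (induction k) (auto simp: algebra_simps)
      from this[of "Suc n"] have "F (b + x) - F x = (\<Sum>j<Suc n. F (h + (real j *\<^sub>R h + x)) - F (real j *\<^sub>R h + x))"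
        by (simp add: h_def del: sum.lessThan_Suc of_nat_Suc)
      then show ?thesis unfolding D_def by (simp only: sum_abs)
    qed
    then have "(\<integral>x. \<bar>F (b + x) - F x\<bar> \<partial>lborel) \<le> (\<integral>x. (\<Sum>j<Suc n. D j x) \<partial>lborel)"
      by (intro integral_mono Bochner_Integration.integrable_sum intD integrable_abs Bochner_Integration.integrable_diff
          integrable_lborel_shift intF)
    also have "\<dots> = (\<Sum>j<Suc n. \<integral>x. D j x \<partial>lborel)"
      by (rule Bochner_Integration.integral_sum) (rule intD)
    also have "\<dots> = (\<Sum>j<Suc n. \<integral>x. \<bar>F (h + x) - F x\<bar> \<partial>lborel)"
    proof (rule sum.cong[OF refl])
      fix j
      have "(\<lambda>x. \<bar>F (h + x) - F x\<bar>) \<in> borel_measurable borel" by measurable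
      from integral_lborel_shift[OF this, of "real j *\<^sub>R h"]
      show "(\<integral>x. D j x \<partial>lborel) = (\<integral>x. \<bar>F (h + x) - F x\<bar> \<partial>lborel)"
        unfolding D_def .
    qed
    also have "\<dots> = real (Suc n) * (\<integral>x. \<bar>F (h + x) - F x\<bar> \<partial>lborel)" by (simp only: sum_constant card_lessThan)
    also have "\<dots> = (\<integral>x. \<bar>q n x\<bar> \<partial>lborel)"
      by (simp add: q_def h_def abs_mult)
    finally show ?thesis .
  qed
  then show "(\<integral>x. \<bar>F (b + x) - F x\<bar> \<partial>lborel) \<le> (\<integral>x. \<bar>d x\<bar> \<partial>lborel)"
    by (intro LIMSEQ_le_const[OF abs_lim]) blast
qed

lemma continuous_on_extend_zero:
  fixes f :: "'a::topological_space \<Rightarrow> 'b::real_normed_vector"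
  assumes "open \<Omega>" "closed K" "K \<subseteq> \<Omega>" "continuous_on \<Omega> f" "\<And>x. x \<in> \<Omega> - K \<Longrightarrow> f x = 0"
  shows "continuous_on UNIV (\<lambda>x. if x \<in> \<Omega> then f x else 0)"
proof -
  have "continuous_on (\<Omega> \<union> - K) (\<lambda>x. if x \<in> \<Omega> then f x else 0)"
  proof (rule continuous_on_open_Un)
    show "continuous_on \<Omega> (\<lambda>x. if x \<in> \<Omega> then f x else 0)"
      using assms(4) by (rule continuous_on_eq) auto
    show "continuous_on (- K) (\<lambda>x. if x \<in> \<Omega> then f x else 0)"
      by (rule continuous_on_eq[OF continuous_on_const[of _ 0]]) (use assms(5) in auto)
  qed (use assms in auto)
  moreover have "\<Omega> \<union> - K = UNIV" using assms(3) by auto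
  ultimately show ?thesis by simp
qed

text \<open>\<open>F\<close> extended by 0 is differentiable everywhere, since the open sets
  \<open>\<Omega>\<close> and the complement of \<open>K\<close> cover the space; this reduces the
  claim to the whole space.\<close>

lemma integral_directional_derivative_eq_0:
  fixes F d :: "'a::euclidean_space \<Rightarrow> real"
  assumes \<Omega>: "open \<Omega>" and K: "compact K" "K \<subseteq> \<Omega>" "\<And>x. x \<in> \<Omega> - K \<Longrightarrow> F x = 0"
    and F: "\<And>x. x \<in> \<Omega> \<Longrightarrow> (F has_derivative F' x) (at x)" "\<And>x. x \<in> \<Omega> \<Longrightarrow> F' x b = d x"
    and d: "continuous_on \<Omega> d"
  shows "integrable (lebesgue_on \<Omega>) d" "(\<integral>x. d x \<partial>lebesgue_on \<Omega>) = 0"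
proof -
  define F0 d0 where "F0 = (\<lambda>x. if x \<in> \<Omega> then F x else 0)" and "d0 = (\<lambda>x. if x \<in> \<Omega> then d x else 0)"
  define F0' where "F0' x = (if x \<in> \<Omega> then F' x else (\<lambda>_. 0))" for x
  have opK: "open (- K)" using K(1) by (simp add: compact_imp_closed open_Compl)
  have zero: "(F0 has_derivative (\<lambda>_. 0)) (at x)" if "x \<notin> K" for x
    by (rule has_derivative_transform_within_open[OF has_derivative_const[of 0] opK])
       (use that K in \<open>auto simp: F0_def\<close>)
  have D: "(F0 has_derivative F0' x) (at x)" for x
  proof (cases "x \<in> \<Omega>")
    case True
    then show ?thesis
      using has_derivative_transform_within_open[OF F(1)[OF True] \<Omega> True, of F0]
      by (simp add: F0_def F0'_def)
  next
    case False
    then show ?thesis using zero[of x] K(2) by (auto simp: F0'_def)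
  qed
  have d0: "F0' x b = d0 x" for x
    by (auto simp: F0'_def d0_def F(2))
  \<comment> \<open>Uniqueness of the derivative transfers the support of \<open>F\<close> to
    \<open>d\<close>.\<close>
  have dK: "d0 x = 0" if "x \<notin> K" for x
    using has_derivative_unique[OF D zero[OF that]] d0[of x] by simp
  have dK': "d x = 0" if "x \<in> \<Omega> - K" for x
    using dK[of x] that by (simp add: d0_def)
  have cont: "continuous_on UNIV d0"
    unfolding d0_def
    by (intro continuous_on_extend_zero[OF \<Omega> _ K(2) d] dK') (auto simp: K(1) compact_imp_closed)
  have F0: "F0 x = 0" if "x \<notin> K" for x
    using that K(3) by (auto simp: F0_def)
  note * = integral_directional_derivative_UNIV[OF K(1) F0 dK D d0 cont]
  have [measurable]: "d0 \<in> borel_measurable borel"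
    by (rule borel_measurable_continuous_onI[OF cont])
  have \<Omega>m: "\<Omega> \<in> sets lebesgue" using \<Omega> by auto
  show "integrable (lebesgue_on \<Omega>) d"
    using *(1) Lebesgue_Measure.integrable_restrict_UNIV[OF \<Omega>m, of d] unfolding d0_def[symmetric]
    by (simp add: integrable_completion)
  show "(\<integral>x. d x \<partial>lebesgue_on \<Omega>) = 0"
    using *(2) Lebesgue_Measure.integral_restrict_UNIV[OF \<Omega>m, of d] unfolding d0_def[symmetric]
    by (simp add: integral_completion)
qed

text \<open>Both mixed derivatives are limits of the same double difference quotient.\<close>

lemma mixed_partials_eq:
  fixes f :: "'a::real_normed_vector \<Rightarrow> real"
  assumes S: "open S" "x \<in> S"
    and f: "\<And>y. y \<in> S \<Longrightarrow> (f has_derivative f' y) (at y)"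
    and fb: "\<And>y. y \<in> S \<Longrightarrow> ((\<lambda>y. f' y b) has_derivative fb' y) (at y)"
    and cont: "continuous_on S (\<lambda>y. fb' y c)"
    and fc: "\<And>y. y \<in> S \<Longrightarrow> ((\<lambda>y. f' y c) has_derivative fc' y) (at y)"
    and cont': "continuous_on S (\<lambda>y. fc' y b)"
  shows "fb' x c = fc' x b"
proof (rule ccontr)
  \<comment> \<open>Mean value theorem twice, first along \<open>b\<close> and then along
    \<open>c\<close>. With the roles of the two directions exchanged it evaluates the same double
    difference.\<close>
  have key: "\<exists>y\<in>S. dist y x < \<epsilon> \<and> f (x + h *\<^sub>R b + h *\<^sub>R c) - f (x + h *\<^sub>R b) - f (x + h *\<^sub>R c) + f x = h * h * gb' y c"
    if h: "h > 0" "h * (norm b + norm c + 1) < \<epsilon>" and ball: "ball x \<epsilon> \<subseteq> S"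
      and gb: "\<And>y. y \<in> S \<Longrightarrow> ((\<lambda>y. f' y b) has_derivative gb' y) (at y)" for h \<epsilon> b c gb'
  proof -
    have inS: "x + s *\<^sub>R b + t *\<^sub>R c \<in> ball x \<epsilon>" if "0 \<le> s" "s \<le> h" "0 \<le> t" "t \<le> h" for s t
    proof -
      have "norm (s *\<^sub>R b + t *\<^sub>R c) \<le> s * norm b + t * norm c"
        using that by (intro order_trans[OF norm_triangle_ineq]) simp
      also have "\<dots> \<le> h * norm b + h * norm c"
        using that by (intro add_mono mult_right_mono) auto
      also have "\<dots> < \<epsilon>" using h by (simp add: algebra_simps)
      finally have "dist (x + s *\<^sub>R b + t *\<^sub>R c) x < \<epsilon>" by (simp add: dist_norm add.assoc)
      then show ?thesis by (simp add: dist_commute)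
    qed
    define \<psi> where "\<psi> s = f (x + s *\<^sub>R b + h *\<^sub>R c) - f (x + s *\<^sub>R b + 0 *\<^sub>R c)" for s
    have line: "((\<lambda>s. f (x + s *\<^sub>R b + t *\<^sub>R c)) has_real_derivative f' (x + s *\<^sub>R b + t *\<^sub>R c) b) (at s)"
      if "0 \<le> s" "s \<le> h" "0 \<le> t" "t \<le> h" for s t
    proof -
      have y: "x + s *\<^sub>R b + t *\<^sub>R c \<in> S" using inS[OF that] ball by blast
      have "((\<lambda>s. x + s *\<^sub>R b + t *\<^sub>R c) has_derivative (\<lambda>s. s *\<^sub>R b)) (at s)"
        by (auto intro!: derivative_eq_intros)
      from has_derivative_compose[OF this f[OF y]] show ?thesis
        using linear_scale[OF has_derivative_linear[OF f[OF y]]]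
        by (simp add: has_field_derivative_def mult_commute_abs)
    qed
    have line': "((\<lambda>t. f' (x + s *\<^sub>R b + t *\<^sub>R c) b) has_real_derivative gb' (x + s *\<^sub>R b + t *\<^sub>R c) c) (at t)"
      if "0 \<le> s" "s \<le> h" "0 \<le> t" "t \<le> h" for s t
    proof -
      have y: "x + s *\<^sub>R b + t *\<^sub>R c \<in> S" using inS[OF that] ball by blast
      have "((\<lambda>t. x + s *\<^sub>R b + t *\<^sub>R c) has_derivative (\<lambda>t. t *\<^sub>R c)) (at t)"
        by (auto intro!: derivative_eq_intros)
      from has_derivative_compose[OF this gb[OF y]] show ?thesis
        using linear_scale[OF has_derivative_linear[OF gb[OF y]]]
        by (simp add: has_field_derivative_def mult_commute_abs)
    qed
    have d\<psi>: "(\<psi> has_real_derivative (f' (x + s *\<^sub>R b + h *\<^sub>R c) b - f' (x + s *\<^sub>R b + 0 *\<^sub>R c) b)) (at s)"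
      if "0 \<le> s" "s \<le> h" for s
      unfolding \<psi>_def using line[OF that, of h] line[OF that, of 0] h(1) by (intro DERIV_diff) auto
    obtain s where s: "0 < s" "s < h"
        "\<psi> h - \<psi> 0 = (h - 0) * (f' (x + s *\<^sub>R b + h *\<^sub>R c) b - f' (x + s *\<^sub>R b + 0 *\<^sub>R c) b)"
      using MVT2[OF h(1) d\<psi>] by blast
    obtain t where t: "0 < t" "t < h"
        "f' (x + s *\<^sub>R b + h *\<^sub>R c) b - f' (x + s *\<^sub>R b + 0 *\<^sub>R c) b = (h - 0) * gb' (x + s *\<^sub>R b + t *\<^sub>R c) c"
      using MVT2[OF h(1) line'[OF less_imp_le[OF s(1)] less_imp_le[OF s(2)]]] by blast
    have "\<psi> h - \<psi> 0 = h * h * gb' (x + s *\<^sub>R b + t *\<^sub>R c) c" using s t by simp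
    moreover have "x + s *\<^sub>R b + t *\<^sub>R c \<in> ball x \<epsilon>" using inS s t by auto
    ultimately show ?thesis
      using ball by (intro bexI[of _ "x + s *\<^sub>R b + t *\<^sub>R c"]) (auto simp: \<psi>_def dist_commute)
  qed
  define \<delta> where "\<delta> = \<bar>fb' x c - fc' x b\<bar> / 2"
  assume "fb' x c \<noteq> fc' x b"
  then have \<delta>: "\<delta> > 0" by (simp add: \<delta>_def)
  obtain e1 where e1: "e1 > 0" "\<And>y. dist y x < e1 \<Longrightarrow> dist (fb' y c) (fb' x c) < \<delta>"
    using cont S \<delta> unfolding continuous_on_eq_continuous_at[OF S(1)] continuous_at_eps_delta by metis
  obtain e2 where e2: "e2 > 0" "\<And>y. dist y x < e2 \<Longrightarrow> dist (fc' y b) (fc' x b) < \<delta>"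
    using cont' S \<delta> unfolding continuous_on_eq_continuous_at[OF S(1)] continuous_at_eps_delta by metis
  obtain e3 where e3: "e3 > 0" "ball x e3 \<subseteq> S" using S by (meson open_contains_ball)
  define \<epsilon> where "\<epsilon> = Min {e1, e2, e3}"
  have \<epsilon>: "\<epsilon> > 0" "\<epsilon> \<le> e1" "\<epsilon> \<le> e2" "ball x \<epsilon> \<subseteq> S"
    using e1 e2 e3 by (auto simp: \<epsilon>_def)
  \<comment> \<open>Half of the largest admissible step, so that the parallelogram spanned by
    \<open>h *\<^sub>R b\<close> and \<open>h *\<^sub>R c\<close> stays inside the
    \<open>\<epsilon>\<close>-ball; the added 1 keeps the denominator positive.\<close>
  define h where "h = \<epsilon> / (2 * (norm b + norm c + 1))"
  have pos: "norm b + norm c + 1 > 0" by (simp add: add_nonneg_pos)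
  have "\<epsilon> / (2 * n) * n = \<epsilon> / 2" if "n > 0" for n using that by simp
  from this[OF pos] have "h * (norm b + norm c + 1) = \<epsilon> / 2" unfolding h_def .
  then have h: "h > 0" "h * (norm b + norm c + 1) < \<epsilon>" "h * (norm c + norm b + 1) < \<epsilon>"
    using pos \<epsilon>(1) by (auto simp: h_def add.commute[of "norm c"])
  obtain y1 where y1: "dist y1 x < \<epsilon>" "f (x + h *\<^sub>R b + h *\<^sub>R c) - f (x + h *\<^sub>R b) - f (x + h *\<^sub>R c) + f x = h * h * fb' y1 c"
    using key[OF h(1,2) \<epsilon>(4) fb] by blast
  obtain y2 where y2: "dist y2 x < \<epsilon>" "f (x + h *\<^sub>R c + h *\<^sub>R b) - f (x + h *\<^sub>R c) - f (x + h *\<^sub>R b) + f x = h * h * fc' y2 b"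
    using key[OF h(1,3) \<epsilon>(4) fc] by blast
  have "h * h * fb' y1 c = h * h * fc' y2 b"
    using y1(2) y2(2) by (simp add: algebra_simps)
  then have "fb' y1 c = fc' y2 b" using h(1) by simp
  moreover have "dist (fb' y1 c) (fb' x c) < \<delta>" "dist (fc' y2 b) (fc' x b) < \<delta>"
    using e1 e2 y1 y2 \<epsilon> by auto
  ultimately have "dist (fb' x c) (fc' x b) < \<delta> + \<delta>"
    using dist_triangle_less_add[of "fb' x c" "fb' y1 c" \<delta> "fc' x b" \<delta>] by (simp add: dist_commute)
  then show False by (simp add: dist_real_def \<delta>_def)
qed

subsection \<open>First variation of area on classical graphs\<close>

text \<open>\<open>p12\<close> serves as both mixed derivatives, so the symmetry of the Hessian is
  part of the locale; \<open>Ck_on_2_partials_commute\<close> supplies it for classical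
  functions.\<close>

locale C2_graph =
  fixes \<Omega> :: "(real^2) set" and z p1 p2 p11 p12 p22 :: "real^2 \<Rightarrow> real"
  assumes open_domain: "open \<Omega>"
    and deriv_z: "x \<in> \<Omega> \<Longrightarrow> (z has_derivative (\<lambda>h. p1 x * h$1 + p2 x * h$2)) (at x)"
    and deriv_p1: "x \<in> \<Omega> \<Longrightarrow> (p1 has_derivative (\<lambda>h. p11 x * h$1 + p12 x * h$2)) (at x)"
    and deriv_p2: "x \<in> \<Omega> \<Longrightarrow> (p2 has_derivative (\<lambda>h. p12 x * h$1 + p22 x * h$2)) (at x)"
    and cont_p11: "continuous_on \<Omega> p11"
    and cont_p12: "continuous_on \<Omega> p12"
    and cont_p22: "continuous_on \<Omega> p22"
begin

definition Q :: "real^2 \<Rightarrow> real" where "Q x = sqrt (1 + (p1 x)\<^sup>2 + (p2 x)\<^sup>2)"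

text \<open>The divergence of the normalised gradient, expanded. It is the sum of the principal
  curvatures of the graph, so the energy is a quarter of the integral of
  \<open>(H x)\<^sup>2 * Q x\<close>.\<close>

definition H :: "real^2 \<Rightarrow> real" where
  "H x = (p11 x + p22 x) / Q x
     - ((p1 x)\<^sup>2 * p11 x + 2 * p1 x * p2 x * p12 x + (p2 x)\<^sup>2 * p22 x) / (Q x)^3"

lemma cont_z: "continuous_on \<Omega> z"
  and cont_p1: "continuous_on \<Omega> p1"
  and cont_p2: "continuous_on \<Omega> p2"
  using deriv_z deriv_p1 deriv_p2
  by (auto intro!: continuous_at_imp_continuous_on has_derivative_continuous)

lemma Q_ge_1: "Q x \<ge> 1"
  by (simp add: Q_def)

lemma Q_pos: "Q x > 0" and Q_neq_0: "Q x \<noteq> 0"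
  using Q_ge_1[of x] by auto

lemma Q_sq: "(Q x)\<^sup>2 = 1 + (p1 x)\<^sup>2 + (p2 x)\<^sup>2"
  by (simp add: Q_def)

lemma cont_Q: "continuous_on \<Omega> Q"
  unfolding Q_def[abs_def] by (intro continuous_intros cont_p1 cont_p2)

lemma cont_H: "continuous_on \<Omega> H"
  unfolding H_def[abs_def]
  by (intro continuous_intros cont_p1 cont_p2 cont_Q cont_p11 cont_p12 cont_p22) (auto simp: Q_neq_0)

lemma deriv_Q:
  assumes "x \<in> \<Omega>"
  shows "(Q has_derivative (\<lambda>h. ((p1 x * p11 x + p2 x * p12 x) * h$1
      + (p1 x * p12 x + p2 x * p22 x) * h$2) / Q x)) (at x)"
proof -
  have pos: "1 + (p1 x)\<^sup>2 + (p2 x)\<^sup>2 > 0"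
    by (smt (verit) zero_le_power2)
  have "((\<lambda>x. 1 + (p1 x)\<^sup>2 + (p2 x)\<^sup>2) has_derivative
      (\<lambda>h. 2 * p1 x * (p11 x * h$1 + p12 x * h$2) + 2 * p2 x * (p12 x * h$1 + p22 x * h$2))) (at x)"
    by (auto intro!: derivative_eq_intros deriv_p1 deriv_p2 assms simp: algebra_simps fun_eq_iff)
  from has_derivative_real_sqrt[OF pos this]
  show ?thesis
    unfolding Q_def[abs_def] by (rule has_derivative_eq_rhs) (simp add: fun_eq_iff divide_simps, simp add: algebra_simps)
qed

text \<open>
  The graph of \<open>z\<close> is varied along the vector field \<open>(X1, X2, X3)\<close>, given on the graph as a function of the
  base point; \<open>a ij\<close> is the derivative of \<open>X i\<close> in direction \<open>j\<close> along the graph. The planar field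
  \<open>(X1, X2) Q + N (p1, p2) / Q\<close> with \<open>N = X3 - X1 p1 - X2 p2\<close> is the one whose divergence is the
  integrand of the first variation of area.
\<close>

definition dV1 where
  "dV1 X1 X2 X3 a11 a21 a31 x = a11 x * Q x + X1 x * (p1 x * p11 x + p2 x * p12 x) / Q x
    + ((a31 x - a11 x * p1 x - X1 x * p11 x - a21 x * p2 x - X2 x * p12 x) * p1 x
       + (X3 x - X1 x * p1 x - X2 x * p2 x) * p11 x) / Q x
    - (X3 x - X1 x * p1 x - X2 x * p2 x) * p1 x * (p1 x * p11 x + p2 x * p12 x) / (Q x)^3"

definition dV2 where
  "dV2 X1 X2 X3 a12 a22 a32 x = a22 x * Q x + X2 x * (p1 x * p12 x + p2 x * p22 x) / Q x
    + ((a32 x - a12 x * p1 x - X1 x * p12 x - a22 x * p2 x - X2 x * p22 x) * p2 x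
       + (X3 x - X1 x * p1 x - X2 x * p2 x) * p22 x) / Q x
    - (X3 x - X1 x * p1 x - X2 x * p2 x) * p2 x * (p1 x * p12 x + p2 x * p22 x) / (Q x)^3"

text \<open>With the upward unit normal \<open>(- p1, - p2, 1) / Q\<close>, the first two summands
  are \<open>Q\<close> times the tangential divergence of the field, and the last is its normal
  component times \<open>Q * H\<close>. Integrated, this is the first variation of area.\<close>

lemma dV_sum:
  "dV1 X1 X2 X3 a11 a21 a31 x + dV2 X1 X2 X3 a12 a22 a32 x =
     Q x * (a11 x + a22 x) + (p1 x * a31 x + p2 x * a32 x
       - p1 x * (p1 x * a11 x + p2 x * a21 x) - p2 x * (p1 x * a12 x + p2 x * a22 x)) / Q x
     + (X3 x - X1 x * p1 x - X2 x * p2 x) * H x"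
  using Q_neq_0[of x]
  unfolding dV1_def dV2_def H_def
  by (simp add: divide_simps) (simp add: algebra_simps power2_eq_square power3_eq_cube)

text \<open>Only one directional value of the derivative is recorded, because the divergence needs
  just the first coordinate direction here and the second in \<open>deriv_V2\<close>. The derivative
  itself stays existential to avoid its long closed form.\<close>

lemma deriv_V1:
  assumes x: "x \<in> \<Omega>"
    and X1: "(X1 has_derivative (\<lambda>h. a11 x * h$1 + a12 x * h$2)) (at x)"
    and X2: "(X2 has_derivative (\<lambda>h. a21 x * h$1 + a22 x * h$2)) (at x)"
    and X3: "(X3 has_derivative (\<lambda>h. a31 x * h$1 + a32 x * h$2)) (at x)"
  shows "\<exists>F'. ((\<lambda>x. X1 x * Q x + (X3 x - X1 x * p1 x - X2 x * p2 x) * p1 x / Q x)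
           has_derivative F') (at x) \<and> F' (axis 1 1) = dV1 X1 X2 X3 a11 a21 a31 x"
  apply (rule exI, rule conjI)
   apply (rule derivative_eq_intros X1 X2 X3 deriv_p1 deriv_p2 deriv_Q x Q_neq_0 refl)+
  using Q_neq_0[of x]
  apply (simp add: axis_def dV1_def divide_simps)
  apply (simp add: algebra_simps power2_eq_square power3_eq_cube)
  done

lemma deriv_V2:
  assumes x: "x \<in> \<Omega>"
    and X1: "(X1 has_derivative (\<lambda>h. a11 x * h$1 + a12 x * h$2)) (at x)"
    and X2: "(X2 has_derivative (\<lambda>h. a21 x * h$1 + a22 x * h$2)) (at x)"
    and X3: "(X3 has_derivative (\<lambda>h. a31 x * h$1 + a32 x * h$2)) (at x)"
  shows "\<exists>F'. ((\<lambda>x. X2 x * Q x + (X3 x - X1 x * p1 x - X2 x * p2 x) * p2 x / Q x)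
           has_derivative F') (at x) \<and> F' (axis 2 1) = dV2 X1 X2 X3 a12 a22 a32 x"
  apply (rule exI, rule conjI)
   apply (rule derivative_eq_intros X1 X2 X3 deriv_p1 deriv_p2 deriv_Q x Q_neq_0 refl)+
  using Q_neq_0[of x]
  apply (simp add: axis_def dV2_def divide_simps)
  apply (simp add: algebra_simps power2_eq_square power3_eq_cube)
  done

lemma cont_dV1:
  assumes "continuous_on \<Omega> X1" "continuous_on \<Omega> X2" "continuous_on \<Omega> X3"
    "continuous_on \<Omega> a11" "continuous_on \<Omega> a21" "continuous_on \<Omega> a31"
  shows "continuous_on \<Omega> (dV1 X1 X2 X3 a11 a21 a31)"
  unfolding dV1_def[abs_def]
  by (intro continuous_intros cont_p1 cont_p2 cont_Q cont_p11 cont_p12 cont_p22 assms ballI)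
     (simp_all add: Q_neq_0)

lemma cont_dV2:
  assumes "continuous_on \<Omega> X1" "continuous_on \<Omega> X2" "continuous_on \<Omega> X3"
    "continuous_on \<Omega> a12" "continuous_on \<Omega> a22" "continuous_on \<Omega> a32"
  shows "continuous_on \<Omega> (dV2 X1 X2 X3 a12 a22 a32)"
  unfolding dV2_def[abs_def]
  by (intro continuous_intros cont_p1 cont_p2 cont_Q cont_p11 cont_p12 cont_p22 assms ballI)
     (simp_all add: Q_neq_0)

end

section \<open>Classical graphs with the boundary data of a fixed graph\<close>

lemma integrable_continuous_bounded:
  fixes f :: "'a::euclidean_space \<Rightarrow> real"
  assumes "open \<Omega>" "bounded \<Omega>" "continuous_on \<Omega> f" "\<And>x. x \<in> \<Omega> \<Longrightarrow> \<bar>f x\<bar> \<le> B"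
  shows "integrable (lebesgue_on \<Omega>) f"
proof -
  have "\<Omega> \<in> lmeasurable" using assms(1,2) by (simp add: lmeasurable_open)
  then interpret finite_measure "lebesgue_on \<Omega>" by (rule finite_measure_lebesgue_on)
  have "f \<in> borel_measurable (lebesgue_on \<Omega>)"
    using assms(1,3) by (intro continuous_imp_measurable_on_sets_lebesgue) auto
  then show ?thesis
    using assms(4) by (intro integrable_const_bound[where B=B]) (auto intro!: AE_I2)
qed

lemma integral_partial_eq_0:
  fixes F d :: "'a::euclidean_space \<Rightarrow> real"
  assumes "open \<Omega>" "compact K" "K \<subseteq> \<Omega>" "\<And>x. x \<in> \<Omega> - K \<Longrightarrow> F x = 0"
    and F: "\<And>x. x \<in> \<Omega> \<Longrightarrow> \<exists>F'. (F has_derivative F') (at x) \<and> F' b = d x"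
    and "continuous_on \<Omega> d"
  shows "integrable (lebesgue_on \<Omega>) d" "(\<integral>x. d x \<partial>lebesgue_on \<Omega>) = 0"
proof -
  have 1: "(F has_derivative frechet_derivative F (at x)) (at x)" if "x \<in> \<Omega>" for x
    using F[OF that] by (auto simp: frechet_derivative_works[symmetric] differentiable_def)
  have 2: "frechet_derivative F (at x) b = d x" if "x \<in> \<Omega>" for x
    using F[OF that] frechet_derivative_at by metis
  show "integrable (lebesgue_on \<Omega>) d" "(\<integral>x. d x \<partial>lebesgue_on \<Omega>) = 0"
    using integral_directional_derivative_eq_0[OF assms(1-4) 1 2 assms(6)] by auto
qed

lemma has_derivative_diff_value:
  assumes "\<exists>F'. (f has_derivative F') (at x) \<and> F' b = c" "\<exists>G'. (g has_derivative G') (at x) \<and> G' b = d"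
  shows "\<exists>F'. ((\<lambda>x. f x - g x) has_derivative F') (at x) \<and> F' b = (c - d :: real)"
  using assms has_derivative_diff by fast

text \<open>\<open>K\<close> is where the graph may differ from the datum. The bound
  \<open>B\<close> controls the geometry off \<open>K\<close>, compactness controls it on
  \<open>K\<close>, and together they make area element and curvature bounded.\<close>

locale C2_graph_pair = C2_graph \<Omega> z p1 p2 p11 p12 p22 + bd: C2_graph \<Omega> \<phi> q1 q2 q11 q12 q22
  for \<Omega> z p1 p2 p11 p12 p22 \<phi> q1 q2 q11 q12 q22 +
  fixes K :: "(real^2) set" and B :: real
  assumes bounded_domain: "bounded \<Omega>"
    and compact_K: "compact K" and K_subset: "K \<subseteq> \<Omega>"
    and z_eq: "x \<in> \<Omega> - K \<Longrightarrow> z x = \<phi> x"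
    and bound: "x \<in> \<Omega> \<Longrightarrow> \<bar>\<phi> x\<bar> \<le> B \<and> \<bar>q1 x\<bar> \<le> B \<and> \<bar>q2 x\<bar> \<le> B
      \<and> \<bar>q11 x\<bar> \<le> B \<and> \<bar>q12 x\<bar> \<le> B \<and> \<bar>q22 x\<bar> \<le> B"
begin

lemma open_off_K: "open (\<Omega> - K)"
  using open_domain compact_K by (simp add: compact_imp_closed open_Diff)

text \<open>Openness of \<open>\<Omega> - K\<close> is the point: functions that agree there have
  equal derivatives there. Applied first to \<open>z\<close> and then to its slopes, this matches
  gradients and Hessians.\<close>

lemma deriv_eq_off_K:
  assumes fg: "\<And>x. x \<in> \<Omega> - K \<Longrightarrow> f x = g x" and x: "x \<in> \<Omega> - K"
    and f: "(f has_derivative (\<lambda>h. a1 * h$1 + a2 * h$2)) (at x)"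
    and g: "(g has_derivative (\<lambda>h. b1 * h$1 + b2 * h$2)) (at x)"
  shows "a1 = b1 \<and> a2 = b2"
proof -
  have "(f has_derivative (\<lambda>h. b1 * h$1 + b2 * h$2)) (at x)"
    by (rule has_derivative_transform_within_open[OF g open_off_K x]) (simp add: fg)
  from has_derivative_unique[OF f this]
  have "a1 * h$1 + a2 * h$2 = b1 * h$1 + b2 * h$2" for h :: "real^2"
    by meson
  from this[of "axis 1 1"] this[of "axis 2 1"] show ?thesis
    by (simp add: axis_def)
qed

lemma grad_eq: "x \<in> \<Omega> - K \<Longrightarrow> p1 x = q1 x \<and> p2 x = q2 x"
  by (rule deriv_eq_off_K[OF z_eq _ deriv_z bd.deriv_z]) auto

lemma hess_eq: "x \<in> \<Omega> - K \<Longrightarrow> p11 x = q11 x \<and> p12 x = q12 x \<and> p22 x = q22 x"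
  using deriv_eq_off_K[OF conjunct1[OF grad_eq] _ deriv_p1 bd.deriv_p1]
    deriv_eq_off_K[OF conjunct2[OF grad_eq] _ deriv_p2 bd.deriv_p2] by auto

text \<open>Continuity on an open set gives no bound by itself. Compactness handles
  \<open>K\<close>, and off \<open>K\<close> the quantities in question are those of the
  datum.\<close>

lemma bounded_if_bounded_off_K:
  assumes "continuous_on \<Omega> f" "\<And>x. x \<in> \<Omega> - K \<Longrightarrow> \<bar>f x\<bar> \<le> C"
  obtains C' where "\<And>x. x \<in> \<Omega> \<Longrightarrow> \<bar>f x\<bar> \<le> (C' :: real)"
proof -
  have "compact (f ` K)"
    using compact_K K_subset assms(1) by (intro compact_continuous_image) (auto intro: continuous_on_subset)
  then obtain D where D: "\<And>x. x \<in> K \<Longrightarrow> \<bar>f x\<bar> \<le> D"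
    by (metis (mono_tags, lifting) bounded_iff compact_imp_bounded image_eqI real_norm_def)
  have "\<bar>f x\<bar> \<le> max C D" if "x \<in> \<Omega>" for x
    using D[of x] assms(2)[of x] that by (cases "x \<in> K") force+
  then show ?thesis using that by blast
qed

lemma Q_bd_le: "x \<in> \<Omega> \<Longrightarrow> bd.Q x \<le> 1 + 2 * B"
proof -
  assume "x \<in> \<Omega>"
  note b = bound[OF this]
  then have "B \<ge> 0" by linarith
  moreover have "(q1 x)\<^sup>2 \<le> B\<^sup>2" "(q2 x)\<^sup>2 \<le> B\<^sup>2"
    using b by (auto simp: abs_le_square_iff[symmetric])
  ultimately show ?thesis
    unfolding bd.Q_def by (intro real_le_lsqrt) (simp_all add: power2_sum power_mult_distrib, use zero_le_power2[of B] in linarith)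
qed

lemma H_bd_le: "\<exists>C. \<forall>x\<in>\<Omega>. \<bar>bd.H x\<bar> \<le> C"
proof -
  \<comment> \<open>\<open>4 * B ^ 3\<close> counts the cubic products in the numerator, the mixed
    one twice; the denominators only help because \<open>bd.Q\<close> is at least 1.\<close>
  have "\<bar>bd.H x\<bar> \<le> 2 * B + 4 * B ^ 3" if x: "x \<in> \<Omega>" for x
  proof -
    note b = bound[OF x]
    have B: "B \<ge> 0" using b by linarith
    have h1: "\<bar>(q11 x + q22 x) / bd.Q x\<bar> \<le> \<bar>q11 x + q22 x\<bar> / 1"
      unfolding abs_divide using bd.Q_ge_1[of x] by (intro divide_left_mono) auto
    have h2: "\<bar>q11 x + q22 x\<bar> \<le> 2 * B" using b by linarith
    let ?n = "(q1 x)\<^sup>2 * q11 x + 2 * q1 x * q2 x * q12 x + (q2 x)\<^sup>2 * q22 x"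
    have h3: "\<bar>?n / (bd.Q x)^3\<bar> \<le> \<bar>?n\<bar> / 1"
      unfolding abs_divide using bd.Q_ge_1[of x] by (intro divide_left_mono) auto
    have "\<bar>a * b * c\<bar> \<le> B ^ 3" if "\<bar>a\<bar> \<le> B" "\<bar>b\<bar> \<le> B" "\<bar>c\<bar> \<le> B" for a b c
      unfolding abs_mult power3_eq_cube using that B by (intro mult_mono) auto
    from this[of "q1 x" "q1 x" "q11 x"] this[of "q1 x" "q2 x" "q12 x"] this[of "q2 x" "q2 x" "q22 x"]
    have h4: "\<bar>?n\<bar> \<le> 4 * B ^ 3" using b by (simp add: power2_eq_square)
    show ?thesis unfolding bd.H_def
      using order_trans[OF h1[unfolded div_by_1] h2] order_trans[OF h3[unfolded div_by_1] h4]
      by (intro order_trans[OF abs_triangle_ineq4] add_mono)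
  qed
  then show ?thesis by blast
qed

lemma Q_bounded: obtains C where "\<And>x. x \<in> \<Omega> \<Longrightarrow> \<bar>Q x\<bar> \<le> C"
proof (rule bounded_if_bounded_off_K[OF cont_Q])
  show "\<bar>Q x\<bar> \<le> 1 + 2 * B" if "x \<in> \<Omega> - K" for x
  proof -
    have "Q x = bd.Q x" using grad_eq[OF that] by (simp add: Q_def bd.Q_def)
    then show ?thesis using Q_bd_le[of x] that Q_pos[of x] by simp
  qed
qed (use that in blast)

lemma H_bounded: obtains C where "\<And>x. x \<in> \<Omega> \<Longrightarrow> \<bar>H x\<bar> \<le> C"
proof -
  obtain C where C: "\<And>x. x \<in> \<Omega> \<Longrightarrow> \<bar>bd.H x\<bar> \<le> C" using H_bd_le by blast
  show ?thesis
  proof (rule bounded_if_bounded_off_K[OF cont_H])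
    show "\<bar>H x\<bar> \<le> C" if "x \<in> \<Omega> - K" for x
    proof -
      have "H x = bd.H x" using grad_eq[OF that] hess_eq[OF that]
        by (simp add: H_def bd.H_def Q_def bd.Q_def)
      then show ?thesis using C[of x] that by simp
    qed
  qed (use that in blast)
qed

lemma integrable_Q: "integrable (lebesgue_on \<Omega>) Q"
  using Q_bounded integrable_continuous_bounded[OF open_domain bounded_domain cont_Q] by metis

lemma integrable_H2Q: "integrable (lebesgue_on \<Omega>) (\<lambda>x. (H x)\<^sup>2 * Q x)"
proof -
  obtain C D where C: "\<And>x. x \<in> \<Omega> \<Longrightarrow> \<bar>Q x\<bar> \<le> C" and D: "\<And>x. x \<in> \<Omega> \<Longrightarrow> \<bar>H x\<bar> \<le> D"
    using Q_bounded H_bounded by metis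
  have "\<bar>(H x)\<^sup>2 * Q x\<bar> \<le> D\<^sup>2 * C" if "x \<in> \<Omega>" for x
    unfolding abs_mult using C[OF that] D[OF that]
    by (intro mult_mono) (auto simp: abs_le_square_iff[symmetric])
  then show ?thesis
    by (intro integrable_continuous_bounded[OF open_domain bounded_domain] continuous_intros cont_H cont_Q)
qed

text \<open>The field is the position vector projected to the plane, and \<open>f\<close> is its
  first variation integrand. By Cauchy-Schwarz the curvature term is at most
  \<open>R * Q * |H|\<close>, and Young's inequality trades half of the area for energy.\<close>

lemma area_bound:
  assumes R: "\<And>x. x \<in> \<Omega> \<Longrightarrow> norm x \<le> R"
  shows "(\<integral>x. Q x \<partial>lebesgue_on \<Omega>) \<le> R\<^sup>2 * (\<integral>x. (H x)\<^sup>2 * Q x \<partial>lebesgue_on \<Omega>)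
    + 2 * (\<integral>x. bd.Q x + 1 / bd.Q x - (x$1 * q1 x + x$2 * q2 x) * bd.H x \<partial>lebesgue_on \<Omega>)"
proof -
  let ?X1 = "\<lambda>x::real^2. x$1" and ?X2 = "\<lambda>x::real^2. x$2"
  have X1: "(?X1 has_derivative (\<lambda>h. 1 * h$1 + 0 * h$2)) (at x)" for x
    by (auto intro!: derivative_eq_intros bounded_linear_imp_has_derivative bounded_linear_vec_nth)
  have X2: "(?X2 has_derivative (\<lambda>h. 0 * h$1 + 1 * h$2)) (at x)" for x
    by (auto intro!: derivative_eq_intros bounded_linear_imp_has_derivative bounded_linear_vec_nth)
  have X3: "((\<lambda>_. 0) has_derivative (\<lambda>h. 0 * h$1 + 0 * h$2)) (at x)" for x :: "real^2"
    by simp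
  let ?V1 = "\<lambda>x. ?X1 x * Q x + (0 - ?X1 x * p1 x - ?X2 x * p2 x) * p1 x / Q x"
  let ?V2 = "\<lambda>x. ?X2 x * Q x + (0 - ?X1 x * p1 x - ?X2 x * p2 x) * p2 x / Q x"
  let ?U1 = "\<lambda>x. ?X1 x * bd.Q x + (0 - ?X1 x * q1 x - ?X2 x * q2 x) * q1 x / bd.Q x"
  let ?U2 = "\<lambda>x. ?X2 x * bd.Q x + (0 - ?X1 x * q1 x - ?X2 x * q2 x) * q2 x / bd.Q x"
  let ?d1 = "dV1 ?X1 ?X2 (\<lambda>_. 0) (\<lambda>_. 1) (\<lambda>_. 0) (\<lambda>_. 0)"
  let ?d2 = "dV2 ?X1 ?X2 (\<lambda>_. 0) (\<lambda>_. 0) (\<lambda>_. 1) (\<lambda>_. 0)"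
  let ?e1 = "bd.dV1 ?X1 ?X2 (\<lambda>_. 0) (\<lambda>_. 1) (\<lambda>_. 0) (\<lambda>_. 0)"
  let ?e2 = "bd.dV2 ?X1 ?X2 (\<lambda>_. 0) (\<lambda>_. 0) (\<lambda>_. 1) (\<lambda>_. 0)"
  have F1: "\<exists>F'. ((\<lambda>x. ?V1 x - ?U1 x) has_derivative F') (at x) \<and> F' (axis 1 1) = ?d1 x - ?e1 x"
    if "x \<in> \<Omega>" for x
    by (rule has_derivative_diff_value[OF deriv_V1[OF that X1 X2 X3] bd.deriv_V1[OF that X1 X2 X3]])
  have F2: "\<exists>F'. ((\<lambda>x. ?V2 x - ?U2 x) has_derivative F') (at x) \<and> F' (axis 2 1) = ?d2 x - ?e2 x"
    if "x \<in> \<Omega>" for x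
    by (rule has_derivative_diff_value[OF deriv_V2[OF that X1 X2 X3] bd.deriv_V2[OF that X1 X2 X3]])
  have off1: "?V1 x - ?U1 x = 0" and off2: "?V2 x - ?U2 x = 0" if "x \<in> \<Omega> - K" for x
    using grad_eq[OF that] by (simp_all add: Q_def bd.Q_def)
  have c1: "continuous_on \<Omega> (\<lambda>x. ?d1 x - ?e1 x)" and c2: "continuous_on \<Omega> (\<lambda>x. ?d2 x - ?e2 x)"
    by (intro continuous_intros cont_dV1 cont_dV2 bd.cont_dV1 bd.cont_dV2)+
  note I1 = integral_partial_eq_0[OF open_domain compact_K K_subset off1 F1 c1]
  note I2 = integral_partial_eq_0[OF open_domain compact_K K_subset off2 F2 c2]
  define f where "f x = Q x + 1 / Q x - (x$1 * p1 x + x$2 * p2 x) * H x" for x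
  define g where "g x = bd.Q x + 1 / bd.Q x - (x$1 * q1 x + x$2 * q2 x) * bd.H x" for x
  \<comment> \<open>The relation \<open>Q\<^sup>2 = 1 + p1\<^sup>2 + p2\<^sup>2\<close> turns the
    tangential correction into \<open>1 / Q - Q\<close>, leaving \<open>Q + 1 / Q\<close> of the
    planar divergence \<open>2 * Q\<close>.\<close>
  have id: "q * (1 + 1) + (a * 0 + b * 0 - a * (a * 1 + b * 0) - b * (a * 0 + b * 1)) / q + (0 - u * a - v * b) * h
      = q + 1 / q - (u * a + v * b) * h" if "q\<^sup>2 = 1 + a\<^sup>2 + b\<^sup>2" "q \<noteq> 0" for q a b u v h :: real
  proof -
    have "(a * 0 + b * 0 - a * (a * 1 + b * 0) - b * (a * 0 + b * 1)) / q = (1 - q * q) / q"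
      using that(1) by (simp add: power2_eq_square algebra_simps)
    also have "\<dots> = 1 / q - q"
      using that(2) by (simp add: diff_divide_distrib)
    finally show ?thesis by (simp add: algebra_simps)
  qed
  have d12: "?d1 x + ?d2 x = f x" for x
    unfolding dV_sum f_def by (rule id[OF Q_sq Q_neq_0])
  have e12: "?e1 x + ?e2 x = g x" for x
    unfolding bd.dV_sum g_def by (rule id[OF bd.Q_sq bd.Q_neq_0])
  have sumd: "(?d1 x - ?e1 x) + (?d2 x - ?e2 x) = f x - g x" for x
    using d12[of x] e12[of x] by linarith
  have fg: "(\<integral>x. f x - g x \<partial>lebesgue_on \<Omega>) = 0"
    using Bochner_Integration.integral_add[OF I1(1) I2(1)] I1(2) I2(2) by (simp add: sumd)
  have cs: "\<bar>x$1 * a + x$2 * b\<bar> \<le> R * sqrt (1 + a\<^sup>2 + b\<^sup>2)" if "x \<in> \<Omega>" for x :: "real^2" and a b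
  proof -
    have R0: "R \<ge> 0" using R[OF that] norm_ge_zero[of x] by linarith
    have "(x$1 * a + x$2 * b)\<^sup>2 \<le> ((x$1)\<^sup>2 + (x$2)\<^sup>2) * (a\<^sup>2 + b\<^sup>2)"
      using zero_le_power2[of "x$1 * b - x$2 * a"] by (simp add: power2_eq_square algebra_simps)
    also have "(x$1)\<^sup>2 + (x$2)\<^sup>2 = (norm x)\<^sup>2"
      by (simp add: norm_vec_def L2_set_def sum_2)
    also have "(norm x)\<^sup>2 * (a\<^sup>2 + b\<^sup>2) \<le> R\<^sup>2 * (1 + a\<^sup>2 + b\<^sup>2)"
      using R[OF that] by (intro mult_mono power_mono) auto
    also have "\<dots> = (R * sqrt (1 + a\<^sup>2 + b\<^sup>2))\<^sup>2"
      by (simp add: power_mult_distrib)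
    finally show ?thesis
      using R0 by (simp add: abs_le_square_iff[symmetric])
  qed
  have csQ: "\<bar>x$1 * p1 x + x$2 * p2 x\<bar> \<le> R * Q x" "\<bar>x$1 * q1 x + x$2 * q2 x\<bar> \<le> R * bd.Q x" if "x \<in> \<Omega>" for x
    using cs[OF that] by (simp_all add: Q_def bd.Q_def)
  have intfg: "integrable (lebesgue_on \<Omega>) (\<lambda>x. f x - g x)"
    using Bochner_Integration.integrable_add[OF I1(1) I2(1)] by (simp add: sumd)
  have intg: "integrable (lebesgue_on \<Omega>) g"
  proof -
    obtain C where C: "\<And>x. x \<in> \<Omega> \<Longrightarrow> \<bar>bd.H x\<bar> \<le> C" using H_bd_le by blast
    show ?thesis
    proof (rule integrable_continuous_bounded[OF open_domain bounded_domain])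
      show "continuous_on \<Omega> g"
        unfolding g_def[abs_def]
        by (intro continuous_intros bd.cont_Q bd.cont_H bd.cont_p1 bd.cont_p2) (simp_all add: bd.Q_neq_0)
      show "\<bar>g x\<bar> \<le> (1 + 2 * B) + 1 + (R * (1 + 2 * B)) * C" if "x \<in> \<Omega>" for x
      proof -
        have R0: "R \<ge> 0" using R[OF that] norm_ge_zero[of x] by linarith
        have "\<bar>(x$1 * q1 x + x$2 * q2 x) * bd.H x\<bar> \<le> (R * (1 + 2 * B)) * C"
        proof -
          have "R * bd.Q x \<le> R * (1 + 2 * B)"
            using R0 Q_bd_le[OF that] by (rule mult_left_mono[rotated])
          with csQ(2)[OF that] have "\<bar>x$1 * q1 x + x$2 * q2 x\<bar> \<le> R * (1 + 2 * B)"
            by linarith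
          then show ?thesis
            unfolding abs_mult using C[OF that] by (intro mult_mono) auto
        qed
        moreover have "\<bar>1 / bd.Q x\<bar> \<le> 1" using bd.Q_ge_1[of x] by simp
        moreover have "\<bar>bd.Q x\<bar> \<le> 1 + 2 * B" using bd.Q_ge_1[of x] Q_bd_le[OF that] by simp
        ultimately show ?thesis unfolding g_def by linarith
      qed
    qed
  qed
  have intf: "integrable (lebesgue_on \<Omega>) f"
    using Bochner_Integration.integrable_add[OF intfg intg] by simp
  have fg': "integral\<^sup>L (lebesgue_on \<Omega>) f = integral\<^sup>L (lebesgue_on \<Omega>) g"
    using fg intf intg by simp
  \<comment> \<open>The square of \<open>1 - R * |H|\<close>, weighted with \<open>Q / 2\<close>, is
    Young's inequality; the positive summand \<open>1 / Q\<close> is dropped.\<close>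
  have le: "Q x / 2 - R\<^sup>2 / 2 * ((H x)\<^sup>2 * Q x) \<le> f x" if "x \<in> \<Omega>" for x
  proof -
    have "\<bar>(x$1 * p1 x + x$2 * p2 x) * H x\<bar> \<le> (R * Q x) * \<bar>H x\<bar>"
      unfolding abs_mult by (intro mult_right_mono csQ that) auto
    moreover have "0 \<le> Q x * (1 - R * \<bar>H x\<bar>)\<^sup>2 / 2"
      using Q_pos[of x] by simp
    moreover have "Q x * (1 - R * \<bar>H x\<bar>)\<^sup>2 / 2 = Q x / 2 + R\<^sup>2 / 2 * ((H x)\<^sup>2 * Q x) - (R * Q x) * \<bar>H x\<bar>"
      by (simp add: power2_diff power_mult_distrib field_simps)
    moreover have "1 / Q x \<ge> 0" using Q_pos[of x] by simp
    ultimately show ?thesis unfolding f_def by linarith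
  qed
  have "integrable (lebesgue_on \<Omega>) (\<lambda>x. Q x / 2 - R\<^sup>2 / 2 * ((H x)\<^sup>2 * Q x))"
    by (rule Bochner_Integration.integrable_diff) (use integrable_Q integrable_H2Q in simp_all)
  from integral_mono[OF this intf]
  have "(\<integral>x. Q x / 2 - R\<^sup>2 / 2 * ((H x)\<^sup>2 * Q x) \<partial>lebesgue_on \<Omega>) \<le> integral\<^sup>L (lebesgue_on \<Omega>) f"
    using le by simp
  moreover have "(\<integral>x. Q x / 2 - R\<^sup>2 / 2 * ((H x)\<^sup>2 * Q x) \<partial>lebesgue_on \<Omega>)
      = (\<integral>x. Q x \<partial>lebesgue_on \<Omega>) / 2 - R\<^sup>2 / 2 * (\<integral>x. (H x)\<^sup>2 * Q x \<partial>lebesgue_on \<Omega>)"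
    by (subst Bochner_Integration.integral_diff) (use integrable_Q integrable_H2Q in simp_all)
  moreover have "integral\<^sup>L (lebesgue_on \<Omega>) g
      = (\<integral>x. bd.Q x + 1 / bd.Q x - (x$1 * q1 x + x$2 * q2 x) * bd.H x \<partial>lebesgue_on \<Omega>)"
    unfolding g_def ..
  ultimately show ?thesis unfolding fg' by linarith
qed
end

subsection \<open>Monotonicity formula\<close>

text \<open>A continuously differentiable substitute for the factor of Simon's radial field, as a
  function of the squared distance \<open>t\<close>: \<open>e\<close> removes the singularity 1 / t
  at the centre, and the cut-off is squared so that its derivative is continuous at
  \<open>t = 1\<close>.\<close>

definition monotonicity_weight :: "real \<Rightarrow> real \<Rightarrow> real" where
  "monotonicity_weight e t = (max 0 (1 - t))\<^sup>2 / (t + e)"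

definition monotonicity_weight' :: "real \<Rightarrow> real \<Rightarrow> real" where
  "monotonicity_weight' e t = - 2 * max 0 (1 - t) / (t + e) - (max 0 (1 - t))\<^sup>2 / (t + e)\<^sup>2"

lemma deriv_max_square:
  "((\<lambda>t::real. (max 0 (1 - t))\<^sup>2) has_real_derivative - 2 * max 0 (1 - t)) (at t)"
proof -
  consider "t < 1" | "t > 1" | "t = 1" by linarith
  then show ?thesis
  proof cases
    case 1
    have "((\<lambda>t::real. (1 - t)\<^sup>2) has_real_derivative - 2 * max 0 (1 - t)) (at t)"
      using 1 by (auto intro!: derivative_eq_intros)
    then show ?thesis
      by (rule has_field_derivative_transform_within_open[where S = "{..<1}"]) (use 1 in auto)
  next
    case 2
    have "((\<lambda>t::real. 0) has_real_derivative - 2 * max 0 (1 - t)) (at t)"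
      using 2 by auto
    then show ?thesis
      by (rule has_field_derivative_transform_within_open[where S = "{1<..}"]) (use 2 in auto)
  next
    case 3
    have "((\<lambda>y. (max 0 (1 - y))\<^sup>2 / (y - 1)) \<longlongrightarrow> 0) (at (1::real))"
    proof (rule Lim_null_comparison)
      have "norm ((max 0 (1 - y))\<^sup>2 / (y - 1)) \<le> \<bar>y - 1\<bar>" for y :: real
      proof (cases "y < 1")
        case True
        then have "(1 - y)\<^sup>2 / (y - 1) = y - 1" by (simp add: field_simps power2_eq_square)
        then show ?thesis using True by (simp add: max_def)
      qed (simp add: max_def)
      then show "\<forall>\<^sub>F y in at (1::real). norm ((max 0 (1 - y))\<^sup>2 / (y - 1)) \<le> \<bar>y - 1\<bar>"
        by simp
      show "((\<lambda>y::real. \<bar>y - 1\<bar>) \<longlongrightarrow> 0) (at 1)"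
        by (intro tendsto_eq_intros) auto
    qed
    then show ?thesis using 3 by (simp add: has_field_derivative_iff)
  qed
qed

lemma deriv_monotonicity_weight:
  assumes "t + e \<noteq> 0"
  shows "(monotonicity_weight e has_real_derivative monotonicity_weight' e t) (at t)"
proof -
  have alg: "(- 2 * m * u - m\<^sup>2 * 1) / (u * u) = - 2 * m / u - m\<^sup>2 / u\<^sup>2" if "u \<noteq> 0" for m u :: real
    using that by (simp add: field_simps power2_eq_square)
  have "((\<lambda>t. t + e) has_real_derivative 1) (at t)"
    by (auto intro!: derivative_eq_intros)
  from DERIV_divide[OF deriv_max_square this assms] show ?thesis
    unfolding monotonicity_weight_def[abs_def] monotonicity_weight'_def
    by (rule DERIV_cong) (use alg[OF assms] in simp)
qed

text \<open>To be read with \<open>q\<close> the area element, \<open>n\<close> the position paired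
  with the normal \<open>(- p1, - p2, 1)\<close>, and \<open>h\<close> the curvature. Completing the
  square in \<open>n / (t + e) + h * q / 4\<close> absorbs the mixed term at the price
  \<open>h\<^sup>2 * q / 8\<close>; the derivative of the cut-off costs at most
  \<open>4 * q\<close>. What remains is the term that concentrates at the centre.\<close>

lemma monotonicity_pointwise:
  fixes q n t e h :: real
  assumes q: "q > 0" and e: "e > 0" and t: "t \<ge> 0"
  shows "2 * (max 0 (1 - t))\<^sup>2 * q * e / (t + e)\<^sup>2 - (if t < 1 then 4 * q + h\<^sup>2 * q / 8 else 0)
    \<le> q * (2 * monotonicity_weight e t + 2 * monotonicity_weight' e t * (t - n\<^sup>2 / q\<^sup>2))
       + monotonicity_weight e t * n * h"
proof (cases "t < 1")
  case False
  then show ?thesis by (simp add: monotonicity_weight_def monotonicity_weight'_def)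
next
  case True
  define u c where "u = t + e" and "c = 1 - t"
  have u: "u > 0" "t \<le> u" and c: "0 \<le> c" "c \<le> 1" "max 0 (1 - t) = c"
    using True e t by (auto simp: u_def c_def)
  define n' where "n' = n\<^sup>2 / q\<^sup>2"
  have n': "n' \<ge> 0" by (simp add: n'_def)
  have "c * (t - n') \<le> c * t" using n' c by (intro mult_left_mono) auto
  also have "\<dots> \<le> 1 * t" using c t by (intro mult_right_mono) auto
  finally have "c * (t - n') \<le> u" using u by simp
  then have "c * (t - n') / u \<le> 1" using u by simp
  then have 1: "4 * q * (c * (t - n') / u) \<le> 4 * q"
    using mult_left_mono[of "c * (t - n') / u" 1 "4 * q"] q by simp
  have "c\<^sup>2 \<le> 1" using c by (simp add: power_le_one)
  then have "c\<^sup>2 * (h\<^sup>2 * q / 8) \<le> 1 * (h\<^sup>2 * q / 8)"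
    using q by (intro mult_right_mono) auto
  moreover have "0 \<le> c\<^sup>2 * (2 / q * (n / u + h * q / 4)\<^sup>2)"
    using q by simp
  moreover have "c\<^sup>2 * (2 / q * (n / u + h * q / 4)\<^sup>2) = 2 * q * c\<^sup>2 * n' / u\<^sup>2 + c\<^sup>2 * h * n / u + c\<^sup>2 * (h\<^sup>2 * q / 8)"
    using q u by (simp add: n'_def field_simps power2_eq_square)
  ultimately have 2: "2 * q * c\<^sup>2 * n' / u\<^sup>2 + c\<^sup>2 * h * n / u + h\<^sup>2 * q / 8 \<ge> 0"
    by linarith
  \<comment> \<open>Writing \<open>t = u - e\<close> cancels the contributions of order
    \<open>c\<^sup>2 / u\<close> up to the gain
    \<open>2 * c\<^sup>2 * q * e / u\<^sup>2\<close>.\<close>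
  have t: "t = u - e" by (simp add: u_def)
  have "q * (2 * (c\<^sup>2 / u) + 2 * (- 2 * c / u - c\<^sup>2 / u\<^sup>2) * (t - n')) + c\<^sup>2 / u * n * h
     = 2 * c\<^sup>2 * q * e / u\<^sup>2 - 4 * q * (c * (t - n') / u) + (2 * q * c\<^sup>2 * n' / u\<^sup>2 + c\<^sup>2 * h * n / u)"
    unfolding t using u(1) by (simp add: field_simps power2_eq_square)
  moreover have "L - (4 * q + w) \<le> L - Z + Y" if "Z \<le> 4 * q" "Y + w \<ge> 0" for L Z Y w
    using that by linarith
  from this[OF 1 2] have "2 * c\<^sup>2 * q * e / u\<^sup>2 - (4 * q + h\<^sup>2 * q / 8)
    \<le> 2 * c\<^sup>2 * q * e / u\<^sup>2 - 4 * q * (c * (t - n') / u) + (2 * q * c\<^sup>2 * n' / u\<^sup>2 + c\<^sup>2 * h * n / u)" .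
  ultimately show ?thesis
    using True unfolding monotonicity_weight_def monotonicity_weight'_def c(3) u_def[symmetric] n'_def[symmetric]
    by simp
qed

context C2_graph_pair
begin

text \<open>A slab instead of a ball: it contains the part of the graph in the unit ball about any
  point of height \<open>s\<close>, and slabs at heights 2 apart are disjoint wherever their base
  points lie.\<close>

definition slab :: "real \<Rightarrow> (real^2) set" where "slab s = {x \<in> \<Omega>. \<bar>z x - s\<bar> < 1}"

lemma open_slab: "open (slab s)"
proof -
  have "open (\<Omega> \<inter> z -` {s - 1<..<s + 1})"
    by (rule continuous_open_preimage[OF cont_z open_domain open_greaterThanLessThan])
  also have "\<Omega> \<inter> z -` {s - 1<..<s + 1} = slab s" by (auto simp: slab_def)
  finally show ?thesis .
qed

lemma slab_sets: "slab s \<in> sets (lebesgue_on \<Omega>)"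
  using open_slab[of s] open_domain by (subst sets_restrict_space_iff) (auto simp: slab_def)

text \<open>The error terms of \<open>monotonicity_pointwise\<close>, made independent of the
  centre.\<close>

definition mass :: "real^2 \<Rightarrow> real" where "mass x = 4 * Q x + (H x)\<^sup>2 * Q x / 8"

lemma mass_nonneg: "mass x \<ge> 0"
  using Q_pos[of x] by (simp add: mass_def)

lemma integrable_mass: "integrable (lebesgue_on \<Omega>) mass"
  unfolding mass_def[abs_def] using integrable_Q integrable_H2Q by simp

definition sqdist :: "real^2 \<Rightarrow> real \<Rightarrow> real^2 \<Rightarrow> real" where
  "sqdist a s x = (x$1 - a$1)\<^sup>2 + (x$2 - a$2)\<^sup>2 + (z x - s)\<^sup>2"

lemma sqdist_nonneg: "sqdist a s x \<ge> 0"
  by (simp add: sqdist_def)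

lemma sqdist_less_1: "x \<in> \<Omega> \<Longrightarrow> sqdist a s x < 1 \<Longrightarrow> x \<in> slab s"
  unfolding sqdist_def slab_def
  by (simp add: abs_square_less_1[symmetric])
     (smt (verit) zero_le_power2)

lemma cont_sqdist: "continuous_on \<Omega> (sqdist a s)"
  unfolding sqdist_def[abs_def] by (intro continuous_intros cont_z)

text \<open>The gain in \<open>monotonicity_pointwise\<close>. Over a plane through
  \<open>(a, s)\<close> its integral tends to 2 pi as \<open>e\<close> tends to 0, concentrated at
  that point.\<close>

definition kernel :: "real^2 \<Rightarrow> real \<Rightarrow> real \<Rightarrow> real^2 \<Rightarrow> real" where
  "kernel a s e x = 2 * (max 0 (1 - sqdist a s x))\<^sup>2 * Q x * e / (sqdist a s x + e)\<^sup>2"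

lemma integrable_kernel:
  assumes "e > 0"
  shows "integrable (lebesgue_on \<Omega>) (kernel a s e)"
proof -
  obtain C where C: "\<And>x. x \<in> \<Omega> \<Longrightarrow> \<bar>Q x\<bar> \<le> C" using Q_bounded by metis
  have pos: "sqdist a s x + e > 0" for x using sqdist_nonneg[of a s x] assms by linarith
  show ?thesis
  proof (rule integrable_continuous_bounded[OF open_domain bounded_domain])
    show "continuous_on \<Omega> (kernel a s e)"
      unfolding kernel_def[abs_def] using pos
      by (intro continuous_intros cont_sqdist cont_Q) (auto simp: less_imp_neq[THEN not_sym])
    show "\<bar>kernel a s e x\<bar> \<le> 2 * 1 * C * e / e\<^sup>2" if x: "x \<in> \<Omega>" for x
    proof -
      have "kernel a s e x \<ge> 0" using assms Q_pos[of x] by (simp add: kernel_def)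
      moreover have "kernel a s e x \<le> 2 * 1 * C * e / e\<^sup>2"
        unfolding kernel_def using assms sqdist_nonneg[of a s x] C[OF x] Q_pos[of x]
        by (intro frac_le mult_mono power_mono mult_nonneg_nonneg power_le_one) auto
      ultimately show ?thesis by simp
    qed
  qed
qed

text \<open>Simon's monotonicity formula, localised to the unit ball around \<open>(a, s)\<close>.\<close>

lemma integral_kernel_le:
  assumes e: "e > 0" and S: "\<And>x. x \<in> \<Omega> \<Longrightarrow> \<phi> x \<le> S" and s: "S + 1 < s"
  shows "(\<integral>x. kernel a s e x \<partial>lebesgue_on \<Omega>) \<le> (\<integral>x. indicator (slab s) x * mass x \<partial>lebesgue_on \<Omega>)"
proof -
  define t where "t = sqdist a s"
  define t1 where "t1 x = 2 * ((x$1 - a$1) + (z x - s) * p1 x)" for x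
  define t2 where "t2 x = 2 * ((x$2 - a$2) + (z x - s) * p2 x)" for x
  define G where "G x = monotonicity_weight e (t x)" for x
  define G' where "G' x = monotonicity_weight' e (t x)" for x
  have pos: "t x + e > 0" for x unfolding t_def using sqdist_nonneg[of a s x] e by linarith
  have pos0: "t x + e \<noteq> 0" for x using pos[of x] by simp
  have dt: "(t has_derivative (\<lambda>h. t1 x * h$1 + t2 x * h$2)) (at x)" if "x \<in> \<Omega>" for x
    unfolding t_def sqdist_def[abs_def] t1_def t2_def
    by (rule derivative_eq_intros deriv_z that refl bounded_linear_imp_has_derivative bounded_linear_vec_nth)+
       (simp add: fun_eq_iff algebra_simps)
  have dG: "(G has_derivative (\<lambda>h. G' x * (t1 x * h$1 + t2 x * h$2))) (at x)" if "x \<in> \<Omega>" for x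
    unfolding G_def[abs_def] G'_def
    using has_derivative_compose[OF dt[OF that] deriv_monotonicity_weight[OF pos0, unfolded has_field_derivative_def]]
    by simp
  have contt: "continuous_on \<Omega> t" by (simp add: t_def cont_sqdist)
  have contG: "continuous_on \<Omega> G" "continuous_on \<Omega> G'"
    unfolding G_def[abs_def] G'_def[abs_def] monotonicity_weight_def monotonicity_weight'_def
    by (intro continuous_intros contt; simp add: pos0)+
  have contt1: "continuous_on \<Omega> t1" "continuous_on \<Omega> t2"
    unfolding t1_def[abs_def] t2_def[abs_def] by (intro continuous_intros cont_z cont_p1 cont_p2)+
  define X1 where "X1 x = G x * (x$1 - a$1)" for x
  define X2 where "X2 x = G x * (x$2 - a$2)" for x
  define X3 where "X3 x = G x * (z x - s)" for x
  define a11 where "a11 x = G x + G' x * t1 x * (x$1 - a$1)" for x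
  define a12 where "a12 x = G' x * t2 x * (x$1 - a$1)" for x
  define a21 where "a21 x = G' x * t1 x * (x$2 - a$2)" for x
  define a22 where "a22 x = G x + G' x * t2 x * (x$2 - a$2)" for x
  define a31 where "a31 x = G x * p1 x + G' x * t1 x * (z x - s)" for x
  define a32 where "a32 x = G x * p2 x + G' x * t2 x * (z x - s)" for x
  have dX1: "(X1 has_derivative (\<lambda>h. a11 x * h$1 + a12 x * h$2)) (at x)" if "x \<in> \<Omega>" for x
    unfolding X1_def[abs_def] a11_def a12_def
    by (rule derivative_eq_intros dG that refl bounded_linear_imp_has_derivative bounded_linear_vec_nth)+
       (simp add: fun_eq_iff algebra_simps)
  have dX2: "(X2 has_derivative (\<lambda>h. a21 x * h$1 + a22 x * h$2)) (at x)" if "x \<in> \<Omega>" for x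
    unfolding X2_def[abs_def] a21_def a22_def
    by (rule derivative_eq_intros dG that refl bounded_linear_imp_has_derivative bounded_linear_vec_nth)+
       (simp add: fun_eq_iff algebra_simps)
  have dX3: "(X3 has_derivative (\<lambda>h. a31 x * h$1 + a32 x * h$2)) (at x)" if "x \<in> \<Omega>" for x
    unfolding X3_def[abs_def] a31_def a32_def
    by (rule derivative_eq_intros dG deriv_z that refl)+
       (simp add: fun_eq_iff algebra_simps)
  have contX: "continuous_on \<Omega> X1" "continuous_on \<Omega> X2" "continuous_on \<Omega> X3"
    unfolding X1_def[abs_def] X2_def[abs_def] X3_def[abs_def] by (intro continuous_intros cont_z contG)+
  have conta: "continuous_on \<Omega> a11" "continuous_on \<Omega> a12" "continuous_on \<Omega> a21" "continuous_on \<Omega> a22"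
      "continuous_on \<Omega> a31" "continuous_on \<Omega> a32"
    unfolding a11_def[abs_def] a12_def[abs_def] a21_def[abs_def] a22_def[abs_def] a31_def[abs_def] a32_def[abs_def]
    by (intro continuous_intros cont_z cont_p1 cont_p2 contG contt1)+
  \<comment> \<open>Off \<open>K\<close> the height is at most \<open>S\<close>, more than 1 below
    \<open>s\<close>, so the weight is 0 there. The field itself has compact support, and no
    identity for the datum has to be subtracted.\<close>
  have off: "X1 x = 0 \<and> X2 x = 0 \<and> X3 x = 0" if "x \<in> \<Omega> - K" for x
  proof -
    have "s - z x > 1" using z_eq[OF that] S[of x] s that by simp
    then have "(s - z x)\<^sup>2 > 1" by (simp add: power2_eq_square less_1_mult)
    then have "t x > 1" unfolding t_def sqdist_def
      by (simp add: power2_commute[of "z x" s]) (smt (verit) zero_le_power2)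
    then show ?thesis by (simp add: X1_def X2_def X3_def G_def monotonicity_weight_def)
  qed
  have off1: "X1 x * Q x + (X3 x - X1 x * p1 x - X2 x * p2 x) * p1 x / Q x = 0"
    and off2: "X2 x * Q x + (X3 x - X1 x * p1 x - X2 x * p2 x) * p2 x / Q x = 0" if "x \<in> \<Omega> - K" for x
    using off[OF that] by simp_all
  have V1: "\<exists>F'. ((\<lambda>x. X1 x * Q x + (X3 x - X1 x * p1 x - X2 x * p2 x) * p1 x / Q x) has_derivative F') (at x)
      \<and> F' (axis 1 1) = dV1 X1 X2 X3 a11 a21 a31 x" if "x \<in> \<Omega>" for x
    by (rule deriv_V1[of x X1 a11 a12 X2 a21 a22 X3 a31 a32, OF that dX1[OF that] dX2[OF that] dX3[OF that]])
  have V2: "\<exists>F'. ((\<lambda>x. X2 x * Q x + (X3 x - X1 x * p1 x - X2 x * p2 x) * p2 x / Q x) has_derivative F') (at x)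
      \<and> F' (axis 2 1) = dV2 X1 X2 X3 a12 a22 a32 x" if "x \<in> \<Omega>" for x
    by (rule deriv_V2[of x X1 a11 a12 X2 a21 a22 X3 a31 a32, OF that dX1[OF that] dX2[OF that] dX3[OF that]])
  note I1 = integral_partial_eq_0[OF open_domain compact_K K_subset off1 V1 cont_dV1[OF contX conta(1,3,5)]]
  note I2 = integral_partial_eq_0[OF open_domain compact_K K_subset off2 V2 cont_dV2[OF contX conta(2,4,6)]]
  define D where "D x = dV1 X1 X2 X3 a11 a21 a31 x + dV2 X1 X2 X3 a12 a22 a32 x" for x
  have D: "integrable (lebesgue_on \<Omega>) D" "integral\<^sup>L (lebesgue_on \<Omega>) D = 0"
    unfolding D_def[abs_def]
    using I1 I2 by simp_all
  \<comment> \<open>The tangential divergence of \<open>G\<close> times the position vector is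
    \<open>2 * G\<close> plus \<open>2 * G'\<close> times the squared tangential part of the
    position, that is, squared distance minus squared normal component.\<close>
  have D_eq: "D x = Q x * (2 * G x + 2 * G' x * (t x - ((z x - s) - (x$1 - a$1) * p1 x - (x$2 - a$2) * p2 x)\<^sup>2 / (Q x)\<^sup>2))
      + G x * ((z x - s) - (x$1 - a$1) * p1 x - (x$2 - a$2) * p2 x) * H x" for x
  proof -
    have alg: "q * ((g + g' * (2 * (y1 + y3 * a)) * y1) + (g + g' * (2 * (y2 + y3 * b)) * y2))
       + (a * (g * a + g' * (2 * (y1 + y3 * a)) * y3) + b * (g * b + g' * (2 * (y2 + y3 * b)) * y3)
          - a * (a * (g + g' * (2 * (y1 + y3 * a)) * y1) + b * (g' * (2 * (y1 + y3 * a)) * y2))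
          - b * (a * (g' * (2 * (y2 + y3 * b)) * y1) + b * (g + g' * (2 * (y2 + y3 * b)) * y2))) / q
       + (g * y3 - g * y1 * a - g * y2 * b) * h
      = q * (2 * g + 2 * g' * (y1\<^sup>2 + y2\<^sup>2 + y3\<^sup>2 - (y3 - y1 * a - y2 * b)\<^sup>2 / q\<^sup>2)) + g * (y3 - y1 * a - y2 * b) * h"
      if q: "q\<^sup>2 = 1 + a\<^sup>2 + b\<^sup>2" "q \<noteq> 0" for q a b g g' y1 y2 y3 h :: real
    proof -
      have "(a * (g * a + g' * (2 * (y1 + y3 * a)) * y3) + b * (g * b + g' * (2 * (y2 + y3 * b)) * y3)
          - a * (a * (g + g' * (2 * (y1 + y3 * a)) * y1) + b * (g' * (2 * (y1 + y3 * a)) * y2))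
          - b * (a * (g' * (2 * (y2 + y3 * b)) * y1) + b * (g + g' * (2 * (y2 + y3 * b)) * y2)))
        = 2 * g' * (q\<^sup>2 * (y3\<^sup>2 - y3 * (y1 * a + y2 * b)) - (y3 - y1 * a - y2 * b)\<^sup>2)"
        unfolding q(1) by (simp add: algebra_simps power2_eq_square)
      then show ?thesis
        using q(2) by (simp only:) (simp add: field_simps power2_eq_square)
    qed
    show ?thesis
      unfolding D_def dV_sum X1_def X2_def X3_def a11_def a12_def a21_def a22_def a31_def a32_def
        t1_def t2_def t_def sqdist_def
      by (rule alg[OF Q_sq Q_neq_0])
  qed
  have "kernel a s e x - indicator (slab s) x * mass x \<le> D x" if x: "x \<in> \<Omega>" for x
  proof -
    have "(if t x < 1 then 4 * Q x + (H x)\<^sup>2 * Q x / 8 else 0) \<le> indicator (slab s) x * mass x"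
      using sqdist_less_1[OF x, of a s] mass_nonneg[of x] by (auto simp: t_def mass_def indicator_def)
    from order_trans[OF diff_left_mono[OF this] monotonicity_pointwise[OF Q_pos e,
        where n = "(z x - s) - (x$1 - a$1) * p1 x - (x$2 - a$2) * p2 x"]]
    show ?thesis
      unfolding D_eq kernel_def G_def G'_def using sqdist_nonneg[of a s x] by (simp add: t_def)
  qed
  moreover have int: "integrable (lebesgue_on \<Omega>) (\<lambda>x. indicator (slab s) x * mass x)"
    using integrable_mult_indicator[OF slab_sets integrable_mass] by simp
  ultimately have "(\<integral>x. kernel a s e x - indicator (slab s) x * mass x \<partial>lebesgue_on \<Omega>) \<le> integral\<^sup>L (lebesgue_on \<Omega>) D"
    by (intro integral_mono D Bochner_Integration.integrable_diff integrable_kernel e) auto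
  then show ?thesis
    using D(2) int integrable_kernel[OF e] by simp
qed

end

section \<open>Lower bound for the kernel integral near its centre\<close>

text \<open>Columns form an orthonormal frame of the tangent plane with slopes \<open>a\<close>, \<open>b\<close>, projected to the base plane.\<close>

definition tangent_frame :: "real \<Rightarrow> real \<Rightarrow> real^2^2" where
  "tangent_frame a b = (let \<alpha> = sqrt (1 + a\<^sup>2); q = sqrt (1 + a\<^sup>2 + b\<^sup>2) in
     vector [vector [1 / \<alpha>, - (a * b) / (\<alpha> * q)], vector [0, \<alpha> / q]])"

lemma norm_sq_real2: "(norm (x::real^2))\<^sup>2 = (x$1)\<^sup>2 + (x$2)\<^sup>2"
  by (simp add: norm_vec_def L2_set_def sum_2)

text \<open>A unit square of the tangent plane projects to this area; the factor later cancels the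
  weight \<open>Q\<close> in \<open>kernel\<close>.\<close>

lemma det_tangent_frame: "det (tangent_frame a b) = 1 / sqrt (1 + a\<^sup>2 + b\<^sup>2)"
proof -
  have "sqrt (1 + a\<^sup>2) > 0" by (simp add: add_pos_nonneg)
  then show ?thesis by (simp add: tangent_frame_def Let_def det_2)
qed

text \<open>The left side is the squared length of \<open>y\<close> lifted to the tangent plane, so
  the frame followed by the lift is an isometry.\<close>

lemma tangent_frame_isometric:
  fixes x y :: "real^2"
  assumes y_def: "y = tangent_frame a b *v x"
  shows "(y$1)\<^sup>2 + (y$2)\<^sup>2 + (a * y$1 + b * y$2)\<^sup>2 = (norm x)\<^sup>2"
proof -
  define \<alpha> q where "\<alpha> = sqrt (1 + a\<^sup>2)" and "q = sqrt (1 + a\<^sup>2 + b\<^sup>2)"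
  have \<alpha>: "\<alpha>\<^sup>2 = 1 + a\<^sup>2" and q: "q\<^sup>2 = \<alpha>\<^sup>2 + b\<^sup>2" by (simp_all add: \<alpha>_def q_def)
  have pos: "\<alpha> > 0" "q > 0" by (auto simp: \<alpha>_def q_def add_pos_nonneg)
  have tf: "tangent_frame a b = vector [vector [1 / \<alpha>, - (a * b) / (\<alpha> * q)], vector [0, \<alpha> / q]]"
    by (simp only: tangent_frame_def Let_def \<alpha>_def q_def)
  have y: "y$1 = (q * x$1 - a * b * x$2) / (\<alpha> * q)" "y$2 = \<alpha> * x$2 / q"
    using pos unfolding y_def
    by (simp_all add: tf matrix_vector_mult_def sum_2 field_simps)
  have ay: "a * y$1 + b * y$2 = (a * q * x$1 + b * x$2 * (\<alpha>\<^sup>2 - a\<^sup>2)) / (\<alpha> * q)"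
    unfolding y using pos by (simp add: field_simps power2_eq_square)
  have ay': "a * y$1 + b * y$2 = (a * q * x$1 + b * x$2) / (\<alpha> * q)"
    unfolding ay \<alpha> by simp
  have "\<alpha> * q * y$1 = q * x$1 - a * b * x$2" "\<alpha> * q * y$2 = \<alpha>\<^sup>2 * x$2"
      "\<alpha> * q * (a * y$1 + b * y$2) = a * q * x$1 + b * x$2"
    unfolding ay' unfolding y using pos by (simp_all add: power2_eq_square)
  moreover have "(\<alpha> * q)\<^sup>2 * ((y$1)\<^sup>2 + (y$2)\<^sup>2 + (a * y$1 + b * y$2)\<^sup>2)
      = (\<alpha> * q * y$1)\<^sup>2 + (\<alpha> * q * y$2)\<^sup>2 + (\<alpha> * q * (a * y$1 + b * y$2))\<^sup>2"
  proof -
    have "c\<^sup>2 * (u\<^sup>2 + v\<^sup>2 + w\<^sup>2) = (c * u)\<^sup>2 + (c * v)\<^sup>2 + (c * w)\<^sup>2" for c u v w :: real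
      by (simp add: power_mult_distrib distrib_left)
    then show ?thesis .
  qed
  ultimately have "(\<alpha> * q)\<^sup>2 * ((y$1)\<^sup>2 + (y$2)\<^sup>2 + (a * y$1 + b * y$2)\<^sup>2)
      = (q * x$1 - a * b * x$2)\<^sup>2 + (\<alpha>\<^sup>2 * x$2)\<^sup>2 + (a * q * x$1 + b * x$2)\<^sup>2"
    by (simp only:)
  also have "\<dots> = (q * x$1 - a * b * x$2)\<^sup>2 + \<alpha>\<^sup>2 * \<alpha>\<^sup>2 * (x$2)\<^sup>2 + (a * q * x$1 + b * x$2)\<^sup>2"
    by (simp add: power2_eq_square)
  also have "\<dots> = q\<^sup>2 * (1 + a\<^sup>2) * (x$1)\<^sup>2 + ((1 + a\<^sup>2) * b\<^sup>2 + \<alpha>\<^sup>2 * \<alpha>\<^sup>2) * (x$2)\<^sup>2"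
    by (simp add: power2_eq_square algebra_simps)
  also have "\<dots> = (\<alpha> * q)\<^sup>2 * ((x$1)\<^sup>2 + (x$2)\<^sup>2)"
    unfolding \<alpha>[symmetric] by (simp add: q power_mult_distrib) (simp add: algebra_simps)
  finally show ?thesis using pos by (simp add: norm_sq_real2)
qed

context C2_graph_pair
begin

lemma kernel_nonneg: "e > 0 \<Longrightarrow> kernel a s e x \<ge> 0"
  using Q_pos[of x] by (simp add: kernel_def)

text \<open>\<open>D\<close> is the projection of a square of side \<open>2 * m\<close> in the
  tangent plane at \<open>a\<close>, so it has measure \<open>4 * m\<^sup>2 / Q a\<close>. On
  \<open>D\<close> the kernel is at least \<open>Q a / (16 * e)\<close>, and
  \<open>e = 6 * m\<^sup>2\<close> makes the product 1 / 24, whatever the slope at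
  \<open>a\<close>.\<close>

lemma integral_kernel_ge:
  assumes a: "a \<in> \<Omega>"
  obtains e where "e > 0" "1 / 24 \<le> (\<integral>x. kernel a (z a) e x \<partial>lebesgue_on \<Omega>)"
proof -
  define A where "A = tangent_frame (p1 a) (p2 a)"
  have detA: "det A = 1 / Q a" by (simp add: A_def det_tangent_frame Q_def)
  obtain d1 where d1: "d1 > 0" "ball a d1 \<subseteq> \<Omega>"
    using open_domain a by (meson open_contains_ball)
  \<comment> \<open>Tolerance 1 in the differentiability is enough: a remainder as large as the
    displacement costs only a constant factor.\<close>
  obtain d2 where d2: "d2 > 0"
      "\<And>y. norm (y - a) < d2 \<Longrightarrow> norm (z y - z a - (p1 a * (y - a)$1 + p2 a * (y - a)$2)) \<le> 1 * norm (y - a)"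
    using deriv_z[OF a] unfolding has_derivative_at_alt by (metis zero_less_one)
  have "continuous (at a) Q"
    using cont_Q open_domain a by (simp add: continuous_on_eq_continuous_at)
  then obtain d3 where d3: "d3 > 0" "\<And>y. dist y a < d3 \<Longrightarrow> dist (Q y) (Q a) < Q a / 2"
    unfolding continuous_at_eps_delta using Q_pos[of a] by (metis half_gt_zero)
  define d where "d = Min {d1, d2, d3, 1}"
  have d: "d > 0" "d \<le> d1" "d \<le> d2" "d \<le> d3" "d \<le> 1"
    using d1 d2 d3 by (auto simp: d_def)
  \<comment> \<open>\<open>d / 4\<close> keeps \<open>D\<close> within distance \<open>d\<close> of
    \<open>a\<close>, since its points have squared displacement at most
    \<open>2 * m\<^sup>2\<close>. The factor 6 in \<open>e\<close> pays for the estimate of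
    \<open>sqdist\<close> by \<open>3 * (norm y)\<^sup>2 + 2 * l\<^sup>2\<close>.\<close>
  define m where "m = d / 4"
  define e where "e = 6 * m\<^sup>2"
  have m: "m > 0" using d by (simp add: m_def)
  have e: "e > 0" using m by (simp add: e_def)
  have "d\<^sup>2 \<le> 1" using d by (simp add: power_le_one)
  then have e_half: "e \<le> 1 / 2" by (simp add: e_def m_def power_divide)
  define C where "C = cbox (vec (- m)) (vec m :: real^2)"
  define D where "D = (+) a ` ((*v) A ` C)"
  have C_norm: "(norm x)\<^sup>2 \<le> e / 3" if "x \<in> C" for x
  proof -
    have "\<bar>x$1\<bar> \<le> m" "\<bar>x$2\<bar> \<le> m" using that by (auto simp: C_def mem_box_cart abs_le_iff minus_le_iff[of _ m])
    then have "(x$1)\<^sup>2 \<le> m\<^sup>2" "(x$2)\<^sup>2 \<le> m\<^sup>2" using m by (auto simp: abs_le_square_iff[symmetric])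
    then show ?thesis by (simp add: norm_sq_real2 e_def)
  qed
  have compact_D: "compact D"
    unfolding D_def C_def by (intro compact_continuous_image compact_cbox continuous_intros matrix_vector_mult_linear_continuous_on)
  have D_props: "x \<in> \<Omega> \<and> sqdist a (z a) x \<le> e \<and> Q a / 2 \<le> Q x" if "x \<in> D" for x
  proof -
    obtain w where w: "w \<in> C" "x = a + A *v w" using \<open>x \<in> D\<close> by (auto simp: D_def)
    define y where "y = x - a"
    have y: "y = A *v w" by (simp add: y_def w)
    define l where "l = p1 a * y$1 + p2 a * y$2"
    have iso: "(norm y)\<^sup>2 + l\<^sup>2 \<le> e / 3"
      using tangent_frame_isometric[OF y[unfolded A_def]] C_norm[OF w(1)]
      by (simp add: norm_sq_real2 l_def)
    then have "(norm y)\<^sup>2 \<le> 2 * m\<^sup>2" using zero_le_power2[of l] unfolding e_def by linarith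
    also have "\<dots> < d\<^sup>2" using d by (simp add: m_def power_divide)
    finally have ny: "norm y < d" using d(1) by (simp add: power2_less_imp_less)
    have "\<bar>z x - z a - l\<bar> \<le> norm y" using d2(2)[of x] ny d by (simp add: y_def l_def)
    then have "(z x - z a - l)\<^sup>2 \<le> (norm y)\<^sup>2" by (simp add: abs_le_square_iff[symmetric])
    moreover have "(z x - z a)\<^sup>2 + (z x - z a - 2 * l)\<^sup>2 = 2 * (z x - z a - l)\<^sup>2 + 2 * l\<^sup>2"
      by (simp add: power2_eq_square algebra_simps)
    moreover have "0 \<le> (z x - z a - 2 * l)\<^sup>2" by simp
    ultimately have "(z x - z a)\<^sup>2 \<le> 2 * (norm y)\<^sup>2 + 2 * l\<^sup>2" by linarith
    moreover have "sqdist a (z a) x = (norm y)\<^sup>2 + (z x - z a)\<^sup>2"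
      by (simp add: sqdist_def y_def norm_sq_real2)
    ultimately have "sqdist a (z a) x \<le> 3 * (norm y)\<^sup>2 + 2 * l\<^sup>2" by simp
    also have "\<dots> \<le> 3 * ((norm y)\<^sup>2 + l\<^sup>2)" by simp
    also have "\<dots> \<le> e" using iso by simp
    finally have "sqdist a (z a) x \<le> e" .
    moreover have "x \<in> \<Omega>" using ny d d1 by (auto simp: y_def dist_norm norm_minus_commute)
    moreover have "Q a / 2 \<le> Q x"
    proof -
      have "dist (Q x) (Q a) < Q a / 2" using d3(2)[of x] ny d by (simp add: y_def dist_norm)
      then show ?thesis unfolding dist_real_def by linarith
    qed
    ultimately show ?thesis by simp
  qed
  have D_sub: "D \<subseteq> \<Omega>" using D_props by blast
  have measC: "measure lebesgue C = 4 * m\<^sup>2"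
  proof -
    have "C \<noteq> {}" using m by (auto simp: C_def interval_ne_empty_cart)
    then have "measure lborel C = (\<Prod>i\<in>(UNIV :: 2 set). m - - m)"
      unfolding C_def by (subst content_cbox_cart) simp_all
    then show ?thesis by (simp add: C_def power2_eq_square)
  qed
  have measD: "measure lebesgue D = 4 * m\<^sup>2 / Q a"
    unfolding D_def measure_translation
    using measure_linear_image[OF matrix_vector_mul_linear[of A], of C] Q_pos[of a]
    by (simp add: C_def measC[unfolded C_def] detA)
  have D_sets: "D \<in> sets (lebesgue_on \<Omega>)"
    using compact_D D_sub open_domain by (subst sets_restrict_space_iff) (auto simp: lmeasurable_compact fmeasurableD)
  \<comment> \<open>On \<open>D\<close> the squared distance is at most \<open>e\<close>, itself at
    most 1 / 2. So the cut-off is at least 1 / 2, the denominator at most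
    \<open>(2 * e)\<^sup>2\<close>, and the area element at least half of
    \<open>Q a\<close>.\<close>
  have low: "indicator D x * (Q a / (16 * e)) \<le> kernel a (z a) e x" for x
  proof (cases "x \<in> D")
    case False
    then show ?thesis using kernel_nonneg[OF e] by simp
  next
    case True
    define t where "t = sqdist a (z a) x"
    have t: "0 \<le> t" "t \<le> e" "Q a / 2 \<le> Q x" using D_props[OF True] sqdist_nonneg by (auto simp: t_def)
    have "1 / 2 \<le> 1 - t" using t(2) e_half by linarith
    then have "1 / 2 \<le> max 0 (1 - t)" by (rule max.coboundedI2)
    then have A: "(1 / 2)\<^sup>2 \<le> (max 0 (1 - t))\<^sup>2" by (rule power_mono) simp
    have B: "(t + e)\<^sup>2 \<le> (2 * e)\<^sup>2" using t e by (intro power_mono) auto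
    have "2 * (1 / 2)\<^sup>2 * (Q a / 2) * e / (2 * e)\<^sup>2 \<le> 2 * (max 0 (1 - t))\<^sup>2 * Q x * e / (t + e)\<^sup>2"
      using t e Q_pos[of a] Q_pos[of x] by (intro frac_le mult_mono A B) auto
    moreover have "2 * (1 / 2)\<^sup>2 * (Q a / 2) * e / (2 * e)\<^sup>2 = Q a / (16 * e)"
      using e by (simp add: power2_eq_square)
    ultimately show ?thesis using True by (simp add: kernel_def t_def)
  qed
  have meas_on: "measure (lebesgue_on \<Omega>) D = measure lebesgue D"
    using D_sub open_domain by (intro measure_restrict_space) auto
  have "integrable (lebesgue_on \<Omega>) (\<lambda>x. indicator D x * (Q a / (16 * e)))"
  proof -
    have "finite_measure (lebesgue_on \<Omega>)"
      using open_domain bounded_domain by (intro finite_measure_lebesgue_on lmeasurable_open)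
    then show ?thesis
      using D_sets by (intro integrable_mult_left integrable_real_indicator)
        (auto simp: finite_measure.emeasure_finite less_top[symmetric])
  qed
  then have "(\<integral>x. indicator D x * (Q a / (16 * e)) \<partial>lebesgue_on \<Omega>) \<le> (\<integral>x. kernel a (z a) e x \<partial>lebesgue_on \<Omega>)"
    using low by (intro integral_mono integrable_kernel e) auto
  also have "(\<integral>x. indicator D x * (Q a / (16 * e)) \<partial>lebesgue_on \<Omega>) = measure lebesgue D * (Q a / (16 * e))"
    using D_sub by (simp add: meas_on[symmetric] Int_absorb2)
  also have "\<dots> = 1 / 24"
    using m Q_pos[of a] by (simp add: measD e_def)
  finally show ?thesis using e that by blast
qed

lemma integral_slab_ge:
  assumes a: "a \<in> \<Omega>" and S: "\<And>x. x \<in> \<Omega> \<Longrightarrow> \<phi> x \<le> S" "S + 1 < z a"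
  shows "1 / 24 \<le> (\<integral>x. indicator (slab (z a)) x * mass x \<partial>lebesgue_on \<Omega>)"
proof -
  obtain e where e: "e > 0" "1 / 24 \<le> (\<integral>x. kernel a (z a) e x \<partial>lebesgue_on \<Omega>)"
    by (rule integral_kernel_ge[OF a])
  from e(2) integral_kernel_le[OF e(1) S] show ?thesis by (rule order_trans)
qed

section \<open>Uniform bound for the height\<close>

lemma ex_off_K:
  assumes "\<Omega> \<noteq> {}"
  obtains x where "x \<in> \<Omega> - K"
proof -
  \<comment> \<open>Otherwise \<open>\<Omega>\<close> would be open and closed, hence the whole
    plane, which is not compact.\<close>
  have "K \<noteq> \<Omega>"
  proof
    assume "K = \<Omega>"
    then have "open K" "closed K" using open_domain compact_K compact_imp_closed by auto
    then have "K = {} \<or> K = UNIV" using clopen by blast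
    then show False using assms \<open>K = \<Omega>\<close> compact_K by (auto simp: not_compact_UNIV)
  qed
  then show ?thesis using K_subset that by blast
qed

lemma upper_bound:
  assumes conn: "connected \<Omega>" and S: "\<And>x. x \<in> \<Omega> \<Longrightarrow> \<phi> x \<le> S" and x: "x \<in> \<Omega>"
  shows "z x \<le> S + 4 + 48 * (\<integral>x. mass x \<partial>lebesgue_on \<Omega>)"
proof (rule ccontr)
  define I where "I = (\<integral>x. mass x \<partial>lebesgue_on \<Omega>)"
  assume "\<not> ?thesis"
  then have zx: "z x > S + 4 + 48 * I" by (simp add: I_def)
  have I0: "I \<ge> 0" unfolding I_def using mass_nonneg by (intro integral_nonneg_AE) auto
  \<comment> \<open>Each slab carries mass at least 1 / 24, so more than \<open>24 * I\<close>
    disjoint ones are impossible.\<close>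
  define N where "N = nat \<lfloor>24 * I\<rfloor> + 1"
  have N: "real N > 24 * I" "real N \<le> 24 * I + 1"
  proof -
    have "real N = of_int \<lfloor>24 * I\<rfloor> + 1" using I0 by (simp add: N_def)
    then show "real N > 24 * I" "real N \<le> 24 * I + 1" by linarith+
  qed
  \<comment> \<open>The lowest height exceeds \<open>S + 1\<close>, as
    \<open>integral_slab_ge\<close> demands; spacing 2 makes the slabs disjoint; the highest is at
    most \<open>S + 2 + 48 * I\<close>, below the assumed value of \<open>z x\<close>.\<close>
  define s where "s j = S + 2 + 2 * real j" for j :: nat
  obtain y where y: "y \<in> \<Omega> - K" using ex_off_K x by blast
  have zy: "z y \<le> S" using z_eq[OF y] S[of y] y by auto
  have "\<exists>a\<in>\<Omega>. z a = s j" if "j < N" for j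
  proof -
    have "connected (z ` \<Omega>)" by (rule connected_continuous_image[OF cont_z conn])
    then have "{z y..z x} \<subseteq> z ` \<Omega>" by (rule connected_contains_Icc) (use y x in auto)
    moreover have "real j \<le> 24 * I" using that N(2) by simp
    then have "s j \<in> {z y..z x}" using zy zx by (auto simp: s_def)
    ultimately show ?thesis by (metis (no_types, lifting) imageE subsetD)
  qed
  then have slab_ge: "1 / 24 \<le> (\<integral>x. indicator (slab (s j)) x * mass x \<partial>lebesgue_on \<Omega>)" if "j < N" for j
  proof -
    obtain a where a: "a \<in> \<Omega>" "z a = s j" using \<open>j < N\<close> \<open>\<And>j. j < N \<Longrightarrow> \<exists>a\<in>\<Omega>. z a = s j\<close> by blast
    have "S + 1 < z a" by (simp add: a s_def)
    from integral_slab_ge[OF a(1) S this] show ?thesis by (simp add: a)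
  qed
  have int: "integrable (lebesgue_on \<Omega>) (\<lambda>x. indicator (slab (s j)) x * mass x)" for j
    using integrable_mult_indicator[OF slab_sets integrable_mass] by simp
  have disj: "disjoint_family_on (\<lambda>j. slab (s j)) {..<N}"
    unfolding disjoint_family_on_def
  proof (intro ballI impI)
    fix i j :: nat assume "i \<noteq> j"
    then have "\<bar>real i - real j\<bar> \<ge> 1" by linarith
    then have "\<bar>s i - s j\<bar> \<ge> 2" by (auto simp: s_def)
    then show "slab (s i) \<inter> slab (s j) = {}"
      by (auto simp: slab_def abs_if split: if_splits)
  qed
  have "real N / 24 = (\<Sum>j<N. 1 / 24)" by simp
  also have "\<dots> \<le> (\<Sum>j<N. \<integral>x. indicator (slab (s j)) x * mass x \<partial>lebesgue_on \<Omega>)"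
    by (intro sum_mono slab_ge) auto
  also have "\<dots> = (\<integral>x. (\<Sum>j<N. indicator (slab (s j)) x * mass x) \<partial>lebesgue_on \<Omega>)"
    by (rule Bochner_Integration.integral_sum[symmetric]) (rule int)
  also have "\<dots> \<le> I"
    unfolding I_def
  proof (rule integral_mono)
    fix x
    have "(\<Sum>j<N. indicator (slab (s j)) x * mass x) = indicator (\<Union>j<N. slab (s j)) x * mass x"
      using disj by (simp add: indicator_UN_disjoint sum_distrib_right)
    also have "\<dots> \<le> mass x" using mass_nonneg[of x] by (simp add: indicator_def)
    finally show "(\<Sum>j<N. indicator (slab (s j)) x * mass x) \<le> mass x" .
  qed (intro Bochner_Integration.integrable_sum int integrable_mass)+
  finally show False using N(1) by simp
qed

lemma C2_graph_pair_uminus: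
  "C2_graph_pair \<Omega> (\<lambda>x. - z x) (\<lambda>x. - p1 x) (\<lambda>x. - p2 x) (\<lambda>x. - p11 x) (\<lambda>x. - p12 x) (\<lambda>x. - p22 x)
     (\<lambda>x. - \<phi> x) (\<lambda>x. - q1 x) (\<lambda>x. - q2 x) (\<lambda>x. - q11 x) (\<lambda>x. - q12 x) (\<lambda>x. - q22 x) K B"
proof -
  have *: "((\<lambda>x. - f x) has_derivative (\<lambda>h. - (c1 * h$1) - c2 * h$2)) (at x)"
    if "(f has_derivative (\<lambda>h. c1 * h$1 + c2 * h$2)) (at x)" for f :: "real^2 \<Rightarrow> real" and c1 c2 x
    using has_derivative_minus[OF that] by (simp add: fun_eq_iff)
  show ?thesis
    by unfold_locales
      (auto intro!: * deriv_z deriv_p1 deriv_p2 bd.deriv_z bd.deriv_p1 bd.deriv_p2 continuous_intros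
        cont_p11 cont_p12 cont_p22 bd.cont_p11 bd.cont_p12 bd.cont_p22 open_domain bounded_domain
        compact_K z_eq simp: bound K_subset[THEN subsetD])
qed

text \<open>The lower bound is the upper bound for the reflected graph: reflection keeps
  \<open>Q\<close>, changes the sign of \<open>H\<close> and therefore preserves
  \<open>mass\<close>.\<close>

lemma sup_bound:
  assumes conn: "connected \<Omega>" and x: "x \<in> \<Omega>"
  shows "\<bar>z x\<bar> \<le> B + 4 + 48 * (\<integral>x. mass x \<partial>lebesgue_on \<Omega>)"
proof -
  interpret neg: C2_graph_pair \<Omega> "\<lambda>x. - z x" "\<lambda>x. - p1 x" "\<lambda>x. - p2 x" "\<lambda>x. - p11 x" "\<lambda>x. - p12 x" "\<lambda>x. - p22 x"
     "\<lambda>x. - \<phi> x" "\<lambda>x. - q1 x" "\<lambda>x. - q2 x" "\<lambda>x. - q11 x" "\<lambda>x. - q12 x" "\<lambda>x. - q22 x" K B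
    by (rule C2_graph_pair_uminus)
  have Q: "neg.Q = Q" by (simp add: fun_eq_iff Q_def neg.Q_def)
  have "neg.H x = - H x" for x
    unfolding H_def neg.H_def Q by (simp add: diff_divide_distrib add_divide_distrib)
  then have mass: "neg.mass = mass" by (simp add: fun_eq_iff mass_def neg.mass_def Q)
  have b: "\<phi> y \<le> B" "- \<phi> y \<le> B" if "y \<in> \<Omega>" for y using bound[OF that] by auto
  show ?thesis
    using upper_bound[OF conn b(1) x] neg.upper_bound[OF conn b(2) x] by (simp add: mass)
qed

end

subsection \<open>Test functions and weak derivatives\<close>

text \<open>Derivatives of exp (- c / t) are combinations of these functions with larger
  \<open>k\<close>, so one family covers all orders. The parameter \<open>c\<close> is free so that
  it can shrink to 0 in \<open>box_bump\<close>.\<close>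

definition flat_exp :: "real \<Rightarrow> nat \<Rightarrow> real \<Rightarrow> real" where
  "flat_exp c k t = (if t > 0 then exp (- c / t) / t ^ k else 0)"

lemma flat_exp_tendsto_0:
  assumes "c > 0"
  shows "((\<lambda>t. flat_exp c k t) \<longlongrightarrow> 0) (at_right 0)"
proof -
  have "filterlim (\<lambda>t. c / t) at_top (at_right 0)"
    using filterlim_tendsto_pos_mult_at_top[OF tendsto_const assms filterlim_inverse_at_top_right]
    by (simp add: divide_inverse)
  from filterlim_compose[OF tendsto_power_div_exp_0[of k] this]
  have "((\<lambda>t. (c / t) ^ k / exp (c / t) * (1 / c ^ k)) \<longlongrightarrow> 0 * (1 / c ^ k)) (at_right 0)"
    by (intro tendsto_mult tendsto_const)
  then have "((\<lambda>t. (c / t) ^ k / exp (c / t) * (1 / c ^ k)) \<longlongrightarrow> 0) (at_right 0)" by simp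
  then show ?thesis
    by (rule Lim_transform_eventually)
       (use assms in \<open>auto simp: eventually_at_right_field flat_exp_def exp_minus power_divide field_simps intro!: exI[of _ 1]\<close>)
qed

lemma deriv_flat_exp:
  assumes c: "c > 0"
  shows "(flat_exp c k has_real_derivative (c * flat_exp c (k + 2) t - real k * flat_exp c (k + 1) t)) (at t)"
proof -
  consider "t > 0" | "t < 0" | "t = 0" by linarith
  then show ?thesis
  proof cases
    case 1
    have "((\<lambda>t. exp (- c / t) / t ^ k) has_real_derivative
        (c * flat_exp c (k + 2) t - real k * flat_exp c (k + 1) t)) (at t)"
    proof -
      have "((\<lambda>t. exp (- c / t)) has_real_derivative exp (- c / t) * (c / t\<^sup>2)) (at t)"
        using 1 by (auto intro!: derivative_eq_intros simp: power2_eq_square)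
      moreover have "t ^ k \<noteq> 0" using 1 by simp
      ultimately show ?thesis
        using 1 by (intro DERIV_cong[OF DERIV_divide[OF _ DERIV_pow]]) (assumption | cases k; simp add: flat_exp_def field_simps power2_eq_square)+
    qed
    then show ?thesis
      by (rule has_field_derivative_transform_within_open[where S = "{0<..}"]) (use 1 in \<open>auto simp: flat_exp_def\<close>)
  next
    case 2
    have "((\<lambda>t. 0) has_real_derivative (c * flat_exp c (k + 2) t - real k * flat_exp c (k + 1) t)) (at t)"
      using 2 by (auto simp: flat_exp_def)
    then show ?thesis
      by (rule has_field_derivative_transform_within_open[where S = "{..<0}"]) (use 2 in \<open>auto simp: flat_exp_def\<close>)
  next
    case 3
    \<comment> \<open>On the right the difference quotient is again a member of the family, with
      exponent \<open>k + 1\<close>; on the left it is 0.\<close>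
    have "((\<lambda>h. flat_exp c k h / h) \<longlongrightarrow> 0) (at_right 0)"
      by (rule Lim_transform_eventually[OF flat_exp_tendsto_0[OF c, of "k + 1"]])
         (auto simp: flat_exp_def eventually_at_right_field intro!: exI[of _ 1])
    moreover have "((\<lambda>h. flat_exp c k h / h) \<longlongrightarrow> 0) (at_left 0)"
      by (rule Lim_transform_eventually[OF tendsto_const])
         (auto simp: flat_exp_def eventually_at_left_field intro!: exI[of _ "-1"])
    ultimately have "((\<lambda>h. flat_exp c k h / h) \<longlongrightarrow> 0) (at 0)"
      by (simp add: filterlim_split_at)
    then show ?thesis
      using 3 by (simp add: has_field_derivative_iff flat_exp_def)
  qed
qed

text \<open>An algebra stable under partial derivatives, so smoothness of its members follows by
  induction without formulas for higher derivatives.\<close>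

inductive_set flat_exp_algebra :: "real \<Rightarrow> ('a::euclidean_space \<Rightarrow> real) set" for c where
  base: "(\<lambda>x. flat_exp c k (s * (x \<bullet> i) + a)) \<in> flat_exp_algebra c"
| const: "(\<lambda>x. r) \<in> flat_exp_algebra c"
| add: "f \<in> flat_exp_algebra c \<Longrightarrow> g \<in> flat_exp_algebra c \<Longrightarrow> (\<lambda>x. f x + g x) \<in> flat_exp_algebra c"
| mult: "f \<in> flat_exp_algebra c \<Longrightarrow> g \<in> flat_exp_algebra c \<Longrightarrow> (\<lambda>x. f x * g x) \<in> flat_exp_algebra c"

lemma flat_exp_algebra_deriv:
  assumes "f \<in> flat_exp_algebra c" "c > 0"
  shows "\<exists>f'. (\<forall>x. (f has_derivative f' x) (at x)) \<and> (\<forall>b. (\<lambda>x. f' x b) \<in> flat_exp_algebra c)"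
  using assms(1)
proof induction
  case (base k s i a)
  let ?d = "\<lambda>x. c * flat_exp c (k + 2) (s * (x \<bullet> i) + a) + - real k * flat_exp c (k + 1) (s * (x \<bullet> i) + a)"
  have "((\<lambda>x. flat_exp c k (s * (x \<bullet> i) + a)) has_derivative (\<lambda>h. ?d x * (s * (h \<bullet> i)))) (at x)" for x
  proof -
    have 1: "((\<lambda>x. s * (x \<bullet> i) + a) has_derivative (\<lambda>h. s * (h \<bullet> i))) (at x)"
      by (auto intro!: derivative_eq_intros)
    show ?thesis
      using has_derivative_compose[OF 1 deriv_flat_exp[OF assms(2), of k, unfolded has_field_derivative_def]] by simp
  qed
  moreover have "(\<lambda>x. ?d x * (s * (b \<bullet> i))) \<in> flat_exp_algebra c" for b :: 'a
    by (intro flat_exp_algebra.intros)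
  ultimately show ?case by (intro exI[of _ "\<lambda>x h. ?d x * (s * (h \<bullet> i))"]) blast
next
  case (const r)
  show ?case
    by (rule exI[of _ "\<lambda>x h. 0"]) (auto intro: flat_exp_algebra.const)
next
  case (add f g)
  then obtain f' g' where "\<forall>x. (f has_derivative f' x) (at x)" "\<forall>b. (\<lambda>x. f' x b) \<in> flat_exp_algebra c"
     "\<forall>x. (g has_derivative g' x) (at x)" "\<forall>b. (\<lambda>x. g' x b) \<in> flat_exp_algebra c" by blast
  then show ?case
    by (intro exI[of _ "\<lambda>x h. f' x h + g' x h"]) (auto intro: flat_exp_algebra.intros has_derivative_add)
next
  case (mult f g)
  then obtain f' g' where "\<forall>x. (f has_derivative f' x) (at x)" "\<forall>b. (\<lambda>x. f' x b) \<in> flat_exp_algebra c"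
     "\<forall>x. (g has_derivative g' x) (at x)" "\<forall>b. (\<lambda>x. g' x b) \<in> flat_exp_algebra c" by blast
  note fg = this
  have "(\<lambda>x. f x * g' x b + f' x b * g x) \<in> flat_exp_algebra c" for b
    using fg mult.hyps by (intro flat_exp_algebra.add flat_exp_algebra.mult) auto
  with fg show ?case
    by (intro exI[of _ "\<lambda>x h. f x * g' x h + f' x h * g x"]) (auto intro: has_derivative_mult)
qed

lemma flat_exp_algebra_partials:
  assumes "f \<in> flat_exp_algebra c" "c > 0"
  shows "partials bs f \<in> flat_exp_algebra c"
proof (induction bs)
  case (Cons b bs)
  obtain f' where f': "\<And>x. (partials bs f has_derivative f' x) (at x)" "\<And>b. (\<lambda>x. f' x b) \<in> flat_exp_algebra c"
    using flat_exp_algebra_deriv[OF Cons assms(2)] by blast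
  have "partials (b # bs) f = (\<lambda>x. f' x b)"
    using frechet_derivative_at[OF f'(1)] by (auto simp: fun_eq_iff)
  then show ?case using f'(2) by simp
qed (use assms in simp)

lemma flat_exp_algebra_Ck:
  assumes "f \<in> flat_exp_algebra c" "c > 0"
  shows "f \<in> Ck_on k UNIV"
proof -
  have "partials bs f differentiable (at x)" for bs x
    using flat_exp_algebra_deriv[OF flat_exp_algebra_partials[OF assms] assms(2)] differentiable_def by blast
  then show ?thesis
    by (auto simp: Ck_on_def intro!: continuous_at_imp_continuous_on differentiable_imp_continuous_within)
qed

text \<open>As \<open>n\<close> grows the exponents tend to 0 inside the box, so the product tends
  to its indicator. The explicit factors \<open>1\<close> and \<open>- 1\<close> match the shape of
  the rule \<open>base\<close>.\<close>

definition box_bump :: "nat \<Rightarrow> 'a::euclidean_space \<Rightarrow> 'a \<Rightarrow> 'a \<Rightarrow> real" where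
  "box_bump n a b x = (\<Prod>i\<in>Basis. flat_exp (1 / Suc n) 0 (1 * (x \<bullet> i) + - (a \<bullet> i)) * flat_exp (1 / Suc n) 0 (- 1 * (x \<bullet> i) + b \<bullet> i))"

lemma flat_exp_algebra_prod:
  "finite I \<Longrightarrow> (\<And>i. i \<in> I \<Longrightarrow> f i \<in> flat_exp_algebra c) \<Longrightarrow> (\<lambda>x. \<Prod>i\<in>I. f i x) \<in> flat_exp_algebra c"
  by (induction I rule: finite_induct) (auto intro: flat_exp_algebra.intros)

lemma box_bump_eq_0:
  assumes "x \<notin> box a b"
  shows "box_bump n a b x = 0"
proof -
  obtain i where i: "i \<in> Basis" "x \<bullet> i \<le> a \<bullet> i \<or> b \<bullet> i \<le> x \<bullet> i"
    using assms by (auto simp: mem_box not_less)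
  then show ?thesis
    unfolding box_bump_def by (intro prod_zero finite_Basis bexI[of _ i]) (auto simp: flat_exp_def)
qed

lemma box_bump_bounds: "0 \<le> box_bump n a b x" "box_bump n a b x \<le> 1"
proof -
  have "0 \<le> flat_exp (1 / Suc n) 0 t" "flat_exp (1 / Suc n) 0 t \<le> 1" for t
    by (auto simp: flat_exp_def)
  then show "0 \<le> box_bump n a b x" "box_bump n a b x \<le> 1"
    unfolding box_bump_def by (auto intro!: prod_nonneg prod_le_1 mult_nonneg_nonneg mult_le_one)
qed

lemma box_bump_tendsto: "(\<lambda>n. box_bump n a b x) \<longlonglongrightarrow> indicator (box a b) x"
proof (cases "x \<in> box a b")
  case False
  then show ?thesis by (simp add: box_bump_eq_0)
next
  case True
  have *: "(\<lambda>n. flat_exp (1 / Suc n) 0 t) \<longlonglongrightarrow> 1" if "t > 0" for t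
  proof -
    have "(\<lambda>n. exp (- (1 / Suc n) / t)) \<longlonglongrightarrow> exp (- 0 / t)"
      using LIMSEQ_Suc[OF lim_1_over_n] that by (intro tendsto_intros) auto
    then show ?thesis using that by (simp add: flat_exp_def)
  qed
  have "(\<lambda>n. box_bump n a b x) \<longlonglongrightarrow> (\<Prod>i\<in>(Basis::'a set). 1 * 1)"
    unfolding box_bump_def using True by (intro tendsto_prod tendsto_mult *) (auto simp: mem_box)
  then show ?thesis using True by simp
qed

lemma box_bump_test:
  assumes "cbox a b \<subseteq> \<Omega>"
  shows "box_bump n a b \<in> test_functions \<Omega>"
proof -
  have "box_bump n a b \<in> flat_exp_algebra (1 / Suc n)"
    unfolding box_bump_def[abs_def] by (intro flat_exp_algebra_prod flat_exp_algebra.intros) auto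
  then have "box_bump n a b \<in> Ck_on k UNIV" for k by (rule flat_exp_algebra_Ck) simp
  moreover have "closure {x. box_bump n a b x \<noteq> 0} \<subseteq> cbox a b"
    by (intro closure_minimal) (use box_bump_eq_0 box_subset_cbox in \<open>blast+\<close>)
  moreover from this have "compact (closure {x. box_bump n a b x \<noteq> 0})"
    using compact_Int_closed[OF compact_cbox closed_closure] by (metis inf.absorb_iff2)
  ultimately show ?thesis using assms by (auto simp: test_functions_def compactly_supported_in_def)
qed

text \<open>Dynkin argument: open boxes form an intersection-stable generator of the Borel sets, and
  the sets on which \<open>f\<close> integrates to 0 form a Dynkin system.\<close>

lemma AE_eq_0_if_box_integrals_0:
  fixes f :: "'a::euclidean_space \<Rightarrow> real"
  assumes f: "integrable lborel f" and box0: "\<And>a b. (\<integral>x. indicator (box a b) x * f x \<partial>lborel) = 0"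
  shows "AE x in lborel. f x = 0"
proof (rule sigma_finite_measure.density_zero[OF sigma_finite_lborel f])
  have int: "integrable lborel (\<lambda>x. indicator A x * f x)" if "A \<in> sets borel" for A
    using integrable_mult_indicator[OF _ f, of A] that by simp
  \<comment> \<open>The complement step needs the integral over the whole space to vanish; it is the
    limit over growing cubes.\<close>
  have total: "(\<integral>x. f x \<partial>lborel) = 0"
  proof -
    let ?B = "\<lambda>n::nat. box (- real n *\<^sub>R One) (real n *\<^sub>R One) :: 'a set"
    have "(\<lambda>n. \<integral>x. indicator (?B n) x * f x \<partial>lborel) \<longlonglongrightarrow> (\<integral>x. f x \<partial>lborel)"
    proof (rule integral_dominated_convergence[where w="\<lambda>x. \<bar>f x\<bar>"])
      show "AE x in lborel. (\<lambda>n. indicator (?B n) x * f x) \<longlonglongrightarrow> f x"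
      proof (rule AE_I2)
        fix x :: 'a
        obtain N :: nat where N: "norm x < real N" using reals_Archimedean2 by blast
        have "x \<in> ?B n" if "n \<ge> N" for n
        proof -
          have "\<bar>x \<bullet> i\<bar> < real n" if "i \<in> Basis" for i
            using Basis_le_norm[OF that, of x] N \<open>n \<ge> N\<close> by linarith
          then show ?thesis by (auto simp: mem_box abs_less_iff minus_less_iff)
        qed
        then have "\<forall>\<^sub>F n in sequentially. indicator (?B n) x * f x = f x"
          by (auto simp: eventually_sequentially intro!: exI[of _ N])
        then show "(\<lambda>n. indicator (?B n) x * f x) \<longlonglongrightarrow> f x" by (rule tendsto_eventually)
      qed
    qed (use f in \<open>auto simp: indicator_def\<close>)
    then show ?thesis by (simp add: box0 LIMSEQ_const_iff)
  qed
  fix A :: "'a set" assume "A \<in> sets lborel"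
  then have A: "A \<in> sigma_sets UNIV (range (\<lambda>(a, b). box a b :: 'a set))"
    by (simp add: borel_eq_box)
  have "Int_stable (range (\<lambda>(a, b). box a b :: 'a set))"
    by (auto simp: Int_stable_def box_Int_box)
  moreover have "range (\<lambda>(a, b). box a b :: 'a set) \<subseteq> Pow UNIV" by simp
  ultimately have "(\<integral>x. indicator A x * f x \<partial>lborel) = 0"
    using A
  proof (induction rule: sigma_sets_induct_disjoint)
    case (basic A) then show ?case using box0 by auto
  next
    case empty then show ?case by simp
  next
    case (compl A)
    then have [measurable]: "A \<in> sets borel" by (simp add: borel_eq_box)
    have "(\<integral>x. indicator (UNIV - A) x * f x \<partial>lborel) = (\<integral>x. f x - indicator A x * f x \<partial>lborel)"
      by (intro Bochner_Integration.integral_cong) (auto simp: indicator_def)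
    also have "\<dots> = 0" using compl total f int[of A] by simp
    finally show ?case .
  next
    case (union B)
    then have B[measurable]: "B i \<in> sets borel" for i by (auto simp: borel_eq_box)
    have "set_lebesgue_integral lborel (\<Union>i. B i) f = (\<Sum>i. set_lebesgue_integral lborel (B i) f)"
      using union.hyps(1) int[of "\<Union>i. B i"]
      by (intro lebesgue_integral_countable_add) (auto simp: set_integrable_def disjoint_family_on_def)
    then show ?case using union.IH by (simp add: set_lebesgue_integral_def)
  qed
  then show "set_lebesgue_integral lborel A f = 0" by (simp add: set_lebesgue_integral_def)
qed


section \<open>Pairing of test functions with locally integrable functions\<close>

abbreviation tsupp :: "('a::euclidean_space \<Rightarrow> real) \<Rightarrow> 'a set" where
  "tsupp \<zeta> \<equiv> closure {x. \<zeta> x \<noteq> 0}"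

lemma test_functionsD:
  assumes "\<zeta> \<in> test_functions \<Omega>"
  shows "compact (tsupp \<zeta>)" "tsupp \<zeta> \<subseteq> \<Omega>" "\<zeta> \<in> Ck_on k UNIV"
  using assms by (auto simp: test_functions_def compactly_supported_in_def)

lemma differentiable_partials_test:
  assumes "\<zeta> \<in> test_functions \<Omega>" "set bs \<subseteq> Basis"
  shows "partials bs \<zeta> differentiable (at x)"
  using test_functionsD(3)[OF assms(1), of "Suc (length bs)"] assms(2) by (auto simp: Ck_on_def multi_indices_def)

lemma continuous_partials_test:
  assumes "\<zeta> \<in> test_functions \<Omega>" "set bs \<subseteq> Basis"
  shows "continuous_on UNIV (partials bs \<zeta>)"
  by (intro continuous_at_imp_continuous_on ballI differentiable_imp_continuous_within
      differentiable_partials_test[OF assms])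

lemma partials_eq_0_off_tsupp: "x \<notin> tsupp \<zeta> \<Longrightarrow> partials bs \<zeta> x = 0"
proof (induction bs arbitrary: x)
  case Nil
  then show ?case using closure_subset[of "{x. \<zeta> x \<noteq> 0}"] by auto
next
  case (Cons b bs)
  have "(partials bs \<zeta> has_derivative (\<lambda>_. 0)) (at x)"
    by (rule has_derivative_transform_within_open[OF has_derivative_const[of 0], of "- tsupp \<zeta>"])
       (use Cons in \<open>auto simp: open_Compl\<close>)
  from frechet_derivative_at[OF this] show ?case by (simp add: fun_eq_iff)
qed

lemma integrable_L1_loc_mult:
  fixes g \<zeta> :: "'a::euclidean_space \<Rightarrow> real"
  assumes "open \<Omega>" "g \<in> L1_loc \<Omega>" and K: "compact K" "K \<subseteq> \<Omega>" and \<zeta>: "continuous_on UNIV \<zeta>" "\<And>x. x \<notin> K \<Longrightarrow> \<zeta> x = 0"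
  shows "integrable (lebesgue_on \<Omega>) (\<lambda>x. g x * \<zeta> x)"
proof -
  have "integrable (lebesgue_on K) g" using assms by (simp add: L1_loc_def)
  then have gK: "integrable lebesgue (\<lambda>x. if x \<in> K then g x else 0)"
    using K by (subst Lebesgue_Measure.integrable_restrict_UNIV) (auto simp: lmeasurable_compact fmeasurableD)
  obtain B where B: "\<And>x. x \<in> K \<Longrightarrow> norm (\<zeta> x) \<le> B"
    using compact_imp_bounded[OF compact_continuous_image[OF continuous_on_subset[OF \<zeta>(1) subset_UNIV] K(1)]]
    unfolding bounded_iff by blast
  have "integrable lebesgue (\<lambda>x. (if x \<in> K then g x else 0) * \<zeta> x)"
  proof (rule Bochner_Integration.integrable_bound[OF integrable_mult_left[OF gK, of B]])
    have "\<zeta> \<in> borel_measurable lebesgue"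
      using borel_measurable_continuous_onI[OF \<zeta>(1)] by (simp add: measurable_completion)
    then show "(\<lambda>x. (if x \<in> K then g x else 0) * \<zeta> x) \<in> borel_measurable lebesgue"
      using borel_measurable_integrable[OF gK] by measurable
    have "norm ((if x \<in> K then g x else 0) * \<zeta> x) \<le> norm ((if x \<in> K then g x else 0) * B)" for x
      using B[of x] by (auto simp: abs_mult intro!: mult_left_mono)
    then show "AE x in lebesgue. norm ((if x \<in> K then g x else 0) * \<zeta> x) \<le> norm ((if x \<in> K then g x else 0) * B)"
      by simp
  qed
  also have "(\<lambda>x. (if x \<in> K then g x else 0) * \<zeta> x) = (\<lambda>x. if x \<in> \<Omega> then g x * \<zeta> x else 0)"
    using \<zeta>(2) K by (auto simp: fun_eq_iff)
  finally show ?thesis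
    using assms(1) by (subst (asm) Lebesgue_Measure.integrable_restrict_UNIV) auto
qed

lemma integrable_L1_loc_partials:
  assumes "open \<Omega>" "g \<in> L1_loc \<Omega>" "\<zeta> \<in> test_functions \<Omega>" "set bs \<subseteq> Basis"
  shows "integrable (lebesgue_on \<Omega>) (\<lambda>x. g x * partials bs \<zeta> x)"
  by (rule integrable_L1_loc_mult[OF assms(1,2) test_functionsD(1,2)[OF assms(3)]
      continuous_partials_test[OF assms(3,4)] partials_eq_0_off_tsupp])

text \<open>The fundamental lemma of the calculus of variations. Bumps inside a closed box of
  \<open>\<Omega>\<close> converge boundedly to the indicator of its interior, so \<open>g\<close>
  integrates to 0 over every such box; countably many closed boxes exhaust
  \<open>\<Omega>\<close>.\<close>

lemma AE_eq_0_if_test_integrals_0: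
  fixes g :: "'a::euclidean_space \<Rightarrow> real"
  assumes \<Omega>: "open \<Omega>" and g: "g \<in> L1_loc \<Omega>"
    and test: "\<And>\<zeta>. \<zeta> \<in> test_functions \<Omega> \<Longrightarrow> (\<integral>x. g x * \<zeta> x \<partial>lebesgue_on \<Omega>) = 0"
  shows "AE x in lebesgue_on \<Omega>. g x = 0"
proof -
  have int_box: "integrable lebesgue (\<lambda>x. if x \<in> box c d then g x else 0)" if "cbox c d \<subseteq> \<Omega>" for c d
  proof -
    have "integrable (lebesgue_on (cbox c d)) g" using g that by (simp add: L1_loc_def)
    then have "integrable lebesgue (\<lambda>x. if x \<in> cbox c d then g x else 0)"
      by (subst Lebesgue_Measure.integrable_restrict_UNIV) auto
    then have "integrable lebesgue (\<lambda>x. indicator (box c d) x *\<^sub>R (if x \<in> cbox c d then g x else 0))"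
      by (rule integrable_mult_indicator[rotated]) auto
    also have "(\<lambda>x. indicator (box c d) x *\<^sub>R (if x \<in> cbox c d then g x else 0)) = (\<lambda>x. if x \<in> box c d then g x else 0)"
      using box_subset_cbox by (force simp: fun_eq_iff indicator_def)
    finally show ?thesis .
  qed
  have box0: "(\<integral>x. (if x \<in> box c d then g x else 0) \<partial>lebesgue) = 0" if "cbox c d \<subseteq> \<Omega>" for c d
  proof -
    have gK: "integrable (lebesgue_on (cbox c d)) g" using g that by (simp add: L1_loc_def)
    then have gK': "integrable lebesgue (\<lambda>x. if x \<in> cbox c d then g x else 0)"
      by (subst Lebesgue_Measure.integrable_restrict_UNIV) auto
    have "(\<lambda>n. \<integral>x. g x * box_bump n c d x \<partial>lebesgue_on \<Omega>) \<longlonglongrightarrow> (\<integral>x. (if x \<in> box c d then g x else 0) \<partial>lebesgue_on \<Omega>)"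
    proof (rule integral_dominated_convergence)
      have "integrable lebesgue (\<lambda>x. if x \<in> \<Omega> then norm (if x \<in> cbox c d then g x else 0) else 0)"
      proof -
        have "(\<lambda>x. if x \<in> \<Omega> then norm (if x \<in> cbox c d then g x else 0) else 0)
            = (\<lambda>x. norm (if x \<in> cbox c d then g x else 0))"
          using that by (auto simp: fun_eq_iff)
        then show ?thesis using integrable_norm[OF gK'] by simp
      qed
      then show "integrable (lebesgue_on \<Omega>) (\<lambda>x. norm (if x \<in> cbox c d then g x else 0))"
        using \<Omega> by (subst (asm) Lebesgue_Measure.integrable_restrict_UNIV) auto
      show "(\<lambda>x. g x * box_bump n c d x) \<in> borel_measurable (lebesgue_on \<Omega>)" for n
        using integrable_L1_loc_partials[OF \<Omega> g box_bump_test[OF that], of "[]" n] by auto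
      show "(\<lambda>x. if x \<in> box c d then g x else 0) \<in> borel_measurable (lebesgue_on \<Omega>)"
        using int_box[OF that] by (intro measurable_restrict_space1) auto
      show "AE x in lebesgue_on \<Omega>. (\<lambda>n. g x * box_bump n c d x) \<longlonglongrightarrow> (if x \<in> box c d then g x else 0)"
      proof (rule AE_I2)
        fix x
        have "(\<lambda>n. g x * box_bump n c d x) \<longlonglongrightarrow> g x * indicator (box c d) x"
          by (intro tendsto_mult tendsto_const box_bump_tendsto)
        then show "(\<lambda>n. g x * box_bump n c d x) \<longlonglongrightarrow> (if x \<in> box c d then g x else 0)"
          by (simp add: indicator_def of_bool_def if_distrib cong: if_cong)
      qed
      show "AE x in lebesgue_on \<Omega>. norm (g x * box_bump n c d x) \<le> norm (if x \<in> cbox c d then g x else 0)" for n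
      proof (rule AE_I2)
        fix x
        have "box_bump n c d x = 0" if "x \<notin> cbox c d" using that box_bump_eq_0 box_subset_cbox by blast
        then show "norm (g x * box_bump n c d x) \<le> norm (if x \<in> cbox c d then g x else 0)"
          using box_bump_bounds[of n c d x] by (auto simp: abs_mult intro: mult_left_le)
      qed
    qed
    then have "(\<integral>x. (if x \<in> box c d then g x else 0) \<partial>lebesgue_on \<Omega>) = 0"
      using test[OF box_bump_test[OF that]] by (simp add: LIMSEQ_const_iff)
    moreover have "(\<integral>x. (if x \<in> box c d then g x else 0) \<partial>lebesgue_on \<Omega>) = (\<integral>x. (if x \<in> box c d then g x else 0) \<partial>lebesgue)"
    proof -
      have "(\<integral>x. (if x \<in> \<Omega> then if x \<in> box c d then g x else 0 else 0) \<partial>lebesgue) = (\<integral>x. (if x \<in> box c d then g x else 0) \<partial>lebesgue_on \<Omega>)"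
        using \<Omega> by (intro Lebesgue_Measure.integral_restrict_UNIV) auto
      moreover have "(\<lambda>x. if x \<in> \<Omega> then if x \<in> box c d then g x else 0 else 0) = (\<lambda>x. if x \<in> box c d then g x else 0)"
        using that box_subset_cbox by (force simp: fun_eq_iff)
      ultimately show ?thesis by simp
    qed
    ultimately show ?thesis by simp
  qed
  have AE_box: "AE x in lebesgue. x \<in> box a b \<longrightarrow> g x = 0" if ab: "cbox a b \<subseteq> \<Omega>" for a b
  proof -
    define G where "G x = (if x \<in> box a b then g x else 0)" for x
    have G: "integrable lebesgue G"
      unfolding G_def[abs_def] by (rule int_box[OF ab])
    \<comment> \<open>The box criterion is stated for \<open>lborel\<close>, whereas
      \<open>g\<close> is only Lebesgue measurable; a Borel representative of \<open>G\<close>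
      mediates.\<close>
    then obtain G' where G'[measurable]: "G' \<in> borel_measurable lborel" and ae: "AE x in lborel. G x = G' x"
      using completion_ex_borel_measurable_real[OF borel_measurable_integrable] by blast
    have aeL: "AE x in lebesgue. G x = G' x" using ae by (rule AE_completion)
    have "integrable lebesgue G'"
      using integrable_cong_AE[OF borel_measurable_integrable[OF G] measurable_completion[OF G'] aeL] G by blast
    then have intG': "integrable lborel G'" by (simp add: integrable_completion)
    have "AE x in lborel. G' x = 0"
    proof (rule AE_eq_0_if_box_integrals_0[OF intG'])
      fix c d :: 'a
      obtain c' d' where cd: "box c d \<inter> box a b = box c' d'"
        using box_Int_box[of c d a b] by blast
      have "(\<integral>x. indicator (box c d) x * G' x \<partial>lborel) = (\<integral>x. indicator (box c d) x * G' x \<partial>lebesgue)"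
        by (subst integral_completion) auto
      also have "\<dots> = (\<integral>x. indicator (box c d) x * G x \<partial>lebesgue)"
      proof (rule integral_cong_AE)
        have "(\<lambda>x. indicator (box c d) x :: real) \<in> borel_measurable lebesgue"
          by (intro borel_measurable_indicator) auto
        then show "(\<lambda>x. indicator (box c d) x * G' x) \<in> borel_measurable lebesgue"
            "(\<lambda>x. indicator (box c d) x * G x) \<in> borel_measurable lebesgue"
          using measurable_completion[OF G'] borel_measurable_integrable[OF G]
          by (simp_all add: borel_measurable_times)
        show "AE x in lebesgue. indicator (box c d) x * G' x = indicator (box c d) x * G x"
          using aeL by eventually_elim simp
      qed
      also have "(\<lambda>x. indicator (box c d) x * G x) = (\<lambda>x. if x \<in> box c' d' then g x else 0)"
        unfolding cd[symmetric] by (simp add: fun_eq_iff G_def indicator_def)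
      also have "(\<integral>x. (if x \<in> box c' d' then g x else 0) \<partial>lebesgue) = 0"
      \<comment> \<open>Nonemptiness is needed to recover the corners: an empty open box says
        nothing about \<open>cbox c' d'\<close>.\<close>
      proof (cases "box c' d' = {}")
        case False
        then have "cbox c' d' \<subseteq> cbox a b"
        proof -
          have "box c' d' \<subseteq> box a b" using cd by blast
          then have "closure (box c' d') \<subseteq> closure (box a b)" by (rule closure_mono)
          moreover have "closure (box c' d') = cbox c' d'" using False by (rule closure_box)
          moreover have "closure (box a b) \<subseteq> cbox a b"
            by (rule closure_minimal[OF box_subset_cbox closed_cbox])
          ultimately show ?thesis by blast
        qed
        then show ?thesis using box0 ab by blast
      qed simp
      finally show "(\<integral>x. indicator (box c d) x * G' x \<partial>lborel) = 0" .
    qed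
    then have "AE x in lebesgue. G' x = 0" by (rule AE_completion)
    then show ?thesis using aeL by eventually_elim (simp add: G_def split: if_splits)
  qed
  have AE_cbox: "AE x in lebesgue. x \<in> cbox a b \<longrightarrow> g x = 0" if ab: "cbox a b \<subseteq> \<Omega>" for a b
  proof -
    have "cbox a b - box a b \<in> null_sets lebesgue"
      using negligible_frontier_interval by (simp add: negligible_iff_null_sets)
    from AE_not_in[OF this] AE_box[OF ab] show ?thesis by eventually_elim auto
  qed
  have "\<exists>D. countable D \<and> D \<subseteq> Pow \<Omega> \<and> (\<forall>X\<in>D. \<exists>a b. X = cbox a b) \<and> \<Union>D = \<Omega>"
  proof (rule open_countable_Union_open_cbox[OF \<Omega>])
    fix D :: "'a set set"
    assume D: "countable D" "D \<subseteq> Pow \<Omega>" "\<And>X. X \<in> D \<Longrightarrow> \<exists>a b. X = cbox a b" "\<Union>D = \<Omega>"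
    show ?thesis
      by (intro exI[of _ D] conjI ballI D(1,2,4)) (rule D(3))
  qed
  then obtain D where D: "countable D" "D \<subseteq> Pow \<Omega>" "\<And>X. X \<in> D \<Longrightarrow> \<exists>a b. X = cbox a b" "\<Union>D = \<Omega>"
    by blast
  have "AE x in lebesgue. x \<in> X \<longrightarrow> g x = 0" if "X \<in> D" for X
  proof -
    obtain a b where X: "X = cbox a b" using D(3)[OF \<open>X \<in> D\<close>] by blast
    show ?thesis unfolding X by (rule AE_cbox) (use D(2) \<open>X \<in> D\<close> X in auto)
  qed
  then have "AE x in lebesgue. \<forall>X\<in>D. x \<in> X \<longrightarrow> g x = 0"
    unfolding AE_ball_countable[OF D(1)] by (rule ballI)
  then have "AE x in lebesgue. x \<in> \<Omega> \<longrightarrow> g x = 0"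
    unfolding D(4)[symmetric] by eventually_elim auto
  then show ?thesis
    using \<Omega> by (subst AE_restrict_space_iff) auto
qed

section \<open>Calculus of weak derivatives\<close>

lemma L1_loc_diff: "f \<in> L1_loc \<Omega> \<Longrightarrow> g \<in> L1_loc \<Omega> \<Longrightarrow> (\<lambda>x. f x - g x) \<in> L1_loc \<Omega>"
  by (auto simp: L1_loc_def)

lemma L1_loc_add: "f \<in> L1_loc \<Omega> \<Longrightarrow> g \<in> L1_loc \<Omega> \<Longrightarrow> (\<lambda>x. f x + g x) \<in> L1_loc \<Omega>"
  by (auto simp: L1_loc_def)

lemma is_weak_deriv_unique:
  assumes \<Omega>: "open \<Omega>" and w: "is_weak_deriv \<Omega> bs f g1" "is_weak_deriv \<Omega> bs f g2"
  shows "AE x in lebesgue_on \<Omega>. g1 x = g2 x"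
proof -
  have "AE x in lebesgue_on \<Omega>. g1 x - g2 x = 0"
  proof (rule AE_eq_0_if_test_integrals_0[OF \<Omega>])
    show "(\<lambda>x. g1 x - g2 x) \<in> L1_loc \<Omega>" using w by (auto simp: is_weak_deriv_def intro: L1_loc_diff)
    fix \<zeta> assume \<zeta>: "\<zeta> \<in> test_functions \<Omega>"
    have "integrable (lebesgue_on \<Omega>) (\<lambda>x. g1 x * \<zeta> x)" "integrable (lebesgue_on \<Omega>) (\<lambda>x. g2 x * \<zeta> x)"
      using integrable_L1_loc_partials[OF \<Omega> _ \<zeta>, of _ "[]"] w by (auto simp: is_weak_deriv_def)
    moreover have "(-1) ^ length bs * (\<integral>x. g1 x * \<zeta> x \<partial>lebesgue_on \<Omega>) = (-1) ^ length bs * (\<integral>x. g2 x * \<zeta> x \<partial>lebesgue_on \<Omega>)"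
      using w \<zeta> by (auto simp: is_weak_deriv_def)
    ultimately show "(\<integral>x. (g1 x - g2 x) * \<zeta> x \<partial>lebesgue_on \<Omega>) = 0"
      by (simp add: left_diff_distrib)
  qed
  then show ?thesis by simp
qed

lemma L1_loc_continuous:
  fixes f :: "'a::euclidean_space \<Rightarrow> real"
  assumes "continuous_on \<Omega> f"
  shows "f \<in> L1_loc \<Omega>"
  unfolding L1_loc_def
proof (intro CollectI allI impI, elim conjE)
  fix K assume K: "compact K" "K \<subseteq> \<Omega>"
  have c: "continuous_on K f" using assms K(2) by (rule continuous_on_subset)
  have "integrable lborel (\<lambda>x. indicator K x *\<^sub>R f x)"
    by (rule borel_integrable_compact[OF K(1) c])
  then have "integrable lebesgue (\<lambda>x. indicator K x *\<^sub>R f x)"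
    by (subst integrable_completion) auto
  then have "integrable lebesgue (\<lambda>x. if x \<in> K then f x else 0)"
    by (rule Bochner_Integration.integrable_cong[THEN iffD1, rotated 2]) (auto simp: indicator_def)
  then show "integrable (lebesgue_on K) f"
    by (subst (asm) Lebesgue_Measure.integrable_restrict_UNIV) (use K(1) in \<open>auto simp: lmeasurable_compact fmeasurableD\<close>)
qed

lemma integral_by_parts_test:
  fixes f :: "'a::euclidean_space \<Rightarrow> real"
  assumes \<Omega>: "open \<Omega>"
    and f: "\<And>x. x \<in> \<Omega> \<Longrightarrow> (f has_derivative f' x) (at x)" "\<And>x. x \<in> \<Omega> \<Longrightarrow> f' x b = d x"
    and d: "continuous_on \<Omega> d"
    and g: "\<And>x. (g has_derivative g' x) (at x)" "\<And>x. g' x b = e x"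
    and e: "continuous_on UNIV e"
    and K: "compact K" "K \<subseteq> \<Omega>" "\<And>x. x \<notin> K \<Longrightarrow> g x = 0" "\<And>x. x \<notin> K \<Longrightarrow> e x = 0"
  shows "(\<integral>x. f x * e x \<partial>lebesgue_on \<Omega>) = - (\<integral>x. d x * g x \<partial>lebesgue_on \<Omega>)"
proof -
  have contf: "continuous_on \<Omega> f"
    using f(1) by (intro continuous_at_imp_continuous_on ballI) (blast intro: has_derivative_continuous)
  have contg: "continuous_on UNIV g"
    using g(1) by (intro continuous_at_imp_continuous_on ballI) (blast intro: has_derivative_continuous)
  have F: "((\<lambda>x. f x * g x) has_derivative (\<lambda>h. f x * g' x h + f' x h * g x)) (at x)" if "x \<in> \<Omega>" for x
    by (rule has_derivative_mult[OF f(1)[OF that] g(1)])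
  have "(\<integral>x. f x * e x + d x * g x \<partial>lebesgue_on \<Omega>) = 0"
  proof (rule integral_directional_derivative_eq_0(2)[OF \<Omega> K(1,2) _ F])
    show "f x * g x = 0" if "x \<in> \<Omega> - K" for x using K(3)[of x] that by simp
    show "f x * g' x b + f' x b * g x = f x * e x + d x * g x" if "x \<in> \<Omega>" for x
      by (simp add: f(2)[OF that] g(2))
    show "continuous_on \<Omega> (\<lambda>x. f x * e x + d x * g x)"
      by (intro continuous_intros contf d continuous_on_subset[OF e] continuous_on_subset[OF contg]) auto
  qed
  moreover have "integrable (lebesgue_on \<Omega>) (\<lambda>x. f x * e x)" "integrable (lebesgue_on \<Omega>) (\<lambda>x. d x * g x)"
    by (intro integrable_L1_loc_mult[OF \<Omega> _ K(1,2)] L1_loc_continuous contf d e contg K(3,4); assumption)+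
  ultimately show ?thesis by simp
qed

text \<open>\<open>partials (b # bs)\<close> takes the derivative along \<open>b\<close> last, so it
  is the head of the list that can be moved over first.\<close>

lemma integral_by_parts_partials:
  fixes f :: "'a::euclidean_space \<Rightarrow> real"
  assumes \<Omega>: "open \<Omega>" and b: "b \<in> Basis" "set bs \<subseteq> Basis" and \<zeta>: "\<zeta> \<in> test_functions \<Omega>"
    and f: "\<And>x. x \<in> \<Omega> \<Longrightarrow> (f has_derivative f' x) (at x)" "\<And>x. x \<in> \<Omega> \<Longrightarrow> f' x b = d x"
    and d: "continuous_on \<Omega> d"
  shows "(\<integral>x. f x * partials (b # bs) \<zeta> x \<partial>lebesgue_on \<Omega>) = - (\<integral>x. d x * partials bs \<zeta> x \<partial>lebesgue_on \<Omega>)"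
proof (rule integral_by_parts_test[OF \<Omega> f d _ _ _ test_functionsD(1,2)[OF \<zeta>]])
  show "(partials bs \<zeta> has_derivative frechet_derivative (partials bs \<zeta>) (at x)) (at x)" for x
    using differentiable_partials_test[OF \<zeta> b(2)] frechet_derivative_works by blast
  show "continuous_on UNIV (partials (b # bs) \<zeta>)"
    by (rule continuous_partials_test[OF \<zeta>]) (use b in auto)
  show "partials bs \<zeta> x = 0" "partials (b # bs) \<zeta> x = 0" if "x \<notin> tsupp \<zeta>" for x
    using partials_eq_0_off_tsupp[OF that] by blast+
qed simp_all

lemma multi_indices_2_cases:
  assumes "bs \<in> multi_indices 2"
  obtains "bs = []" | b where "b \<in> Basis" "bs = [b]" | b c where "b \<in> Basis" "c \<in> Basis" "bs = [b, c]"
proof (cases bs)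
  case (Cons b cs)
  then show ?thesis using assms that(2,3)
    by (cases cs) (auto simp: multi_indices_def)
qed (use that in blast)

lemma Ck_on_mono: "f \<in> Ck_on k T \<Longrightarrow> S \<subseteq> T \<Longrightarrow> f \<in> Ck_on k S"
  by (auto simp: Ck_on_def intro: continuous_on_subset)

lemma Ck_on_has_derivative:
  assumes "f \<in> Ck_on k \<Omega>" "x \<in> \<Omega>" "set bs \<subseteq> Basis" "length bs < k"
  shows "(partials bs f has_derivative frechet_derivative (partials bs f) (at x)) (at x)"
proof -
  have "bs \<in> multi_indices k" using assms by (auto simp: multi_indices_def)
  then have "partials bs f differentiable (at x)" using assms by (auto simp: Ck_on_def)
  then show ?thesis by (simp add: frechet_derivative_works)
qed

lemma Ck_on_continuous:
  "f \<in> Ck_on k \<Omega> \<Longrightarrow> set bs \<subseteq> Basis \<Longrightarrow> length bs \<le> k \<Longrightarrow> continuous_on \<Omega> (partials bs f)"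
  by (auto simp: Ck_on_def multi_indices_def)

lemma Ck_on_2_partials_commute:
  fixes f :: "'a::euclidean_space \<Rightarrow> real"
  assumes "open \<Omega>" "f \<in> Ck_on 2 \<Omega>" "x \<in> \<Omega>" "b \<in> Basis" "c \<in> Basis"
  shows "partials [b, c] f x = partials [c, b] f x"
proof -
  have "frechet_derivative (\<lambda>y. frechet_derivative f (at y) c) (at x) b
      = frechet_derivative (\<lambda>y. frechet_derivative f (at y) b) (at x) c"
  proof (rule mixed_partials_eq[OF assms(1,3)])
    show "(f has_derivative frechet_derivative f (at y)) (at y)" if "y \<in> \<Omega>" for y
      using Ck_on_has_derivative[OF assms(2) that, of "[]"] by simp
    show "((\<lambda>y. frechet_derivative f (at y) c) has_derivative
       frechet_derivative (\<lambda>y. frechet_derivative f (at y) c) (at y)) (at y)" if "y \<in> \<Omega>" for y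
      using Ck_on_has_derivative[OF assms(2) that, of "[c]"] assms by simp
    show "((\<lambda>y. frechet_derivative f (at y) b) has_derivative
       frechet_derivative (\<lambda>y. frechet_derivative f (at y) b) (at y)) (at y)" if "y \<in> \<Omega>" for y
      using Ck_on_has_derivative[OF assms(2) that, of "[b]"] assms by simp
    show "continuous_on \<Omega> (\<lambda>y. frechet_derivative (\<lambda>y. frechet_derivative f (at y) c) (at y) b)"
      using Ck_on_continuous[OF assms(2), of "[b, c]"] assms by simp
    show "continuous_on \<Omega> (\<lambda>y. frechet_derivative (\<lambda>y. frechet_derivative f (at y) b) (at y) c)"
      using Ck_on_continuous[OF assms(2), of "[c, b]"] assms by simp
  qed
  then show ?thesis by simp
qed

text \<open>Moving derivatives from \<open>\<zeta>\<close> to \<open>f\<close> one at a time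
  reverses their order: \<open>[b, c]\<close> arrives as \<open>[c, b]\<close>. Commutation of
  second derivatives restores it.\<close>

lemma is_weak_deriv_classical:
  fixes f :: "'a::euclidean_space \<Rightarrow> real"
  assumes \<Omega>: "open \<Omega>" and f: "f \<in> Ck_on 2 \<Omega>" and bs: "bs \<in> multi_indices 2"
  shows "is_weak_deriv \<Omega> bs f (partials bs f)"
proof -
  have bs': "set bs \<subseteq> Basis" "length bs \<le> 2" using bs by (auto simp: multi_indices_def)
  have loc: "f \<in> L1_loc \<Omega>" "partials bs f \<in> L1_loc \<Omega>"
    using Ck_on_continuous[OF f, of "[]"] Ck_on_continuous[OF f bs'] by (auto intro: L1_loc_continuous)
  have f1: "(f has_derivative frechet_derivative f (at x)) (at x)" if "x \<in> \<Omega>" for x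
    using Ck_on_has_derivative[OF f that, of "[]"] by simp
  have c1: "continuous_on \<Omega> (\<lambda>x. frechet_derivative f (at x) b)" if "b \<in> Basis" for b
    using Ck_on_continuous[OF f, of "[b]"] that by simp
  show ?thesis
    unfolding is_weak_deriv_def
  proof (intro conjI loc ballI)
    fix \<zeta> :: "'a \<Rightarrow> real" assume \<zeta>: "\<zeta> \<in> test_functions \<Omega>"
    show "(\<integral>x. f x * partials bs \<zeta> x \<partial>lebesgue_on \<Omega>) = (-1) ^ length bs * (\<integral>x. partials bs f x * \<zeta> x \<partial>lebesgue_on \<Omega>)"
      using bs
    proof (cases rule: multi_indices_2_cases)
      case 1
      then show ?thesis by simp
    next
      case (2 b)
      have "(\<integral>x. f x * partials [b] \<zeta> x \<partial>lebesgue_on \<Omega>)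
          = - (\<integral>x. frechet_derivative f (at x) b * partials [] \<zeta> x \<partial>lebesgue_on \<Omega>)"
        by (rule integral_by_parts_partials[OF \<Omega> 2(1) _ \<zeta> f1 refl c1[OF 2(1)]]) simp
      then show ?thesis by (simp add: 2)
    next
      case (3 b c)
      have "(\<integral>x. f x * partials [b, c] \<zeta> x \<partial>lebesgue_on \<Omega>)
          = - (\<integral>x. frechet_derivative f (at x) b * partials [c] \<zeta> x \<partial>lebesgue_on \<Omega>)"
        by (rule integral_by_parts_partials[OF \<Omega> 3(1) _ \<zeta> f1 refl c1[OF 3(1)]]) (use 3 in simp)
      also have "(\<integral>x. frechet_derivative f (at x) b * partials [c] \<zeta> x \<partial>lebesgue_on \<Omega>)
          = - (\<integral>x. partials [c, b] f x * partials [] \<zeta> x \<partial>lebesgue_on \<Omega>)"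
      proof (rule integral_by_parts_partials[OF \<Omega> 3(2) _ \<zeta>])
        show "((\<lambda>x. frechet_derivative f (at x) b) has_derivative
          frechet_derivative (\<lambda>x. frechet_derivative f (at x) b) (at x)) (at x)" if "x \<in> \<Omega>" for x
          using Ck_on_has_derivative[OF f that, of "[b]"] 3 by simp
        show "continuous_on \<Omega> (partials [c, b] f)"
          using Ck_on_continuous[OF f, of "[c, b]"] 3 by simp
      qed simp_all
      also have "(\<integral>x. partials [c, b] f x * partials [] \<zeta> x \<partial>lebesgue_on \<Omega>) = (\<integral>x. partials [b, c] f x * \<zeta> x \<partial>lebesgue_on \<Omega>)"
        using Ck_on_2_partials_commute[OF \<Omega> f _ 3(1,2)]
        by (intro Bochner_Integration.integral_cong) auto
      finally show ?thesis by (simp add: 3)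
    qed
  qed
qed

lemma is_weak_deriv_add:
  assumes \<Omega>: "open \<Omega>" and bs: "set bs \<subseteq> Basis" and f: "is_weak_deriv \<Omega> bs f1 g1" "is_weak_deriv \<Omega> bs f2 g2"
  shows "is_weak_deriv \<Omega> bs (\<lambda>x. f1 x + f2 x) (\<lambda>x. g1 x + g2 x)"
  unfolding is_weak_deriv_def
proof (intro conjI ballI)
  note loc = f[unfolded is_weak_deriv_def, THEN conjunct1] f[unfolded is_weak_deriv_def, THEN conjunct2, THEN conjunct1]
  show "(\<lambda>x. f1 x + f2 x) \<in> L1_loc \<Omega>" "(\<lambda>x. g1 x + g2 x) \<in> L1_loc \<Omega>" using loc by (auto intro: L1_loc_add)
  fix \<zeta> :: "'a \<Rightarrow> real" assume \<zeta>: "\<zeta> \<in> test_functions \<Omega>"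
  note i = integrable_L1_loc_partials[OF \<Omega> _ \<zeta>]
  have eq: "(\<integral>x. f1 x * partials bs \<zeta> x \<partial>lebesgue_on \<Omega>) = (-1) ^ length bs * (\<integral>x. g1 x * \<zeta> x \<partial>lebesgue_on \<Omega>)"
    "(\<integral>x. f2 x * partials bs \<zeta> x \<partial>lebesgue_on \<Omega>) = (-1) ^ length bs * (\<integral>x. g2 x * \<zeta> x \<partial>lebesgue_on \<Omega>)"
    using f \<zeta> by (auto simp: is_weak_deriv_def)
  have "(\<integral>x. (f1 x + f2 x) * partials bs \<zeta> x \<partial>lebesgue_on \<Omega>)
      = (\<integral>x. f1 x * partials bs \<zeta> x \<partial>lebesgue_on \<Omega>) + (\<integral>x. f2 x * partials bs \<zeta> x \<partial>lebesgue_on \<Omega>)"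
    unfolding distrib_right by (rule Bochner_Integration.integral_add[OF i[OF loc(1) bs] i[OF loc(2) bs]])
  also have "\<dots> = (-1) ^ length bs * ((\<integral>x. g1 x * \<zeta> x \<partial>lebesgue_on \<Omega>) + (\<integral>x. g2 x * \<zeta> x \<partial>lebesgue_on \<Omega>))"
    unfolding eq by (simp add: distrib_left)
  also have "(\<integral>x. g1 x * \<zeta> x \<partial>lebesgue_on \<Omega>) + (\<integral>x. g2 x * \<zeta> x \<partial>lebesgue_on \<Omega>) = (\<integral>x. (g1 x + g2 x) * \<zeta> x \<partial>lebesgue_on \<Omega>)"
    unfolding distrib_right using i[OF loc(3), of "[]"] i[OF loc(4), of "[]"] by simp
  finally show "(\<integral>x. (f1 x + f2 x) * partials bs \<zeta> x \<partial>lebesgue_on \<Omega>)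
      = (-1) ^ length bs * (\<integral>x. (g1 x + g2 x) * \<zeta> x \<partial>lebesgue_on \<Omega>)" .
qed

lemma is_weak_deriv_uminus:
  "is_weak_deriv \<Omega> bs f g \<Longrightarrow> is_weak_deriv \<Omega> bs (\<lambda>x. - f x) (\<lambda>x. - g x)"
  by (auto simp: is_weak_deriv_def L1_loc_def)

lemma is_weak_deriv_diff:
  assumes "open \<Omega>" "set bs \<subseteq> Basis" "is_weak_deriv \<Omega> bs f1 g1" "is_weak_deriv \<Omega> bs f2 g2"
  shows "is_weak_deriv \<Omega> bs (\<lambda>x. f1 x - f2 x) (\<lambda>x. g1 x - g2 x)"
  using is_weak_deriv_add[OF assms(1-3) is_weak_deriv_uminus[OF assms(4)]] by simp

lemma measurable_lebesgue_on_AE: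
  fixes f g :: "'a::euclidean_space \<Rightarrow> real"
  assumes \<Omega>: "\<Omega> \<in> sets lebesgue" and f: "f \<in> borel_measurable (lebesgue_on \<Omega>)" and ae: "AE x in lebesgue_on \<Omega>. f x = g x"
  shows "g \<in> borel_measurable (lebesgue_on \<Omega>)"
proof -
  have "AE x in lebesgue. x \<in> \<Omega> \<longrightarrow> f x = g x"
    using ae \<Omega> by (subst (asm) AE_restrict_space_iff) auto
  then have "AE x in lebesgue. (if x \<in> \<Omega> then f x else 0) = (if x \<in> \<Omega> then g x else 0)"
    by eventually_elim auto
  moreover have "(\<lambda>x. if x \<in> \<Omega> then f x else 0) \<in> borel_measurable lebesgue"
    using f by (simp add: borel_measurable_if[OF \<Omega>])
  ultimately have "(\<lambda>x. if x \<in> \<Omega> then g x else 0) \<in> borel_measurable lebesgue"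
    by (rule borel_measurable_AE[rotated])
  then show ?thesis by (simp add: borel_measurable_if[OF \<Omega>])
qed

lemma integrable_lebesgue_on_AE:
  fixes f g :: "'a::euclidean_space \<Rightarrow> real"
  assumes "\<Omega> \<in> sets lebesgue" "integrable (lebesgue_on \<Omega>) f" "AE x in lebesgue_on \<Omega>. f x = g x"
  shows "integrable (lebesgue_on \<Omega>) g" "(\<integral>x. f x \<partial>lebesgue_on \<Omega>) = (\<integral>x. g x \<partial>lebesgue_on \<Omega>)"
proof -
  have m: "f \<in> borel_measurable (lebesgue_on \<Omega>)" using assms(2) by auto
  have m': "g \<in> borel_measurable (lebesgue_on \<Omega>)" by (rule measurable_lebesgue_on_AE[OF assms(1) m assms(3)])
  show "integrable (lebesgue_on \<Omega>) g" using integrable_cong_AE[OF m m' assms(3)] assms(2) by simp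
  show "(\<integral>x. f x \<partial>lebesgue_on \<Omega>) = (\<integral>x. g x \<partial>lebesgue_on \<Omega>)"
    by (rule integral_cong_AE[OF m m' assms(3)])
qed

lemma AE_lebesgue_on_subset:
  assumes "K \<subseteq> \<Omega>" "K \<in> sets lebesgue" "\<Omega> \<in> sets lebesgue" "AE x in lebesgue_on \<Omega>. P x"
  shows "AE x in lebesgue_on K. P x"
proof -
  have "AE x in lebesgue. x \<in> \<Omega> \<longrightarrow> P x"
    using assms(3,4) by (subst (asm) AE_restrict_space_iff) auto
  then have "AE x in lebesgue. x \<in> K \<longrightarrow> P x"
    by eventually_elim (use assms(1) in auto)
  then show ?thesis using assms(2) by (subst AE_restrict_space_iff) auto
qed

text \<open>\<open>weak_deriv\<close> is a choice, known only up to null sets. This lemma lets a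
  normalised gradient built from chosen representatives be replaced by one built from explicit
  derivatives.\<close>

lemma is_weak_deriv_cong_AE:
  assumes \<Omega>: "open \<Omega>" and bs: "set bs \<subseteq> Basis" and w: "is_weak_deriv \<Omega> bs f g" and ae: "AE x in lebesgue_on \<Omega>. f x = f' x"
  shows "is_weak_deriv \<Omega> bs f' g"
  unfolding is_weak_deriv_def
proof (intro conjI ballI)
  have \<Omega>m: "\<Omega> \<in> sets lebesgue" using \<Omega> by auto
  have f: "f \<in> L1_loc \<Omega>" and g: "g \<in> L1_loc \<Omega>" using w by (auto simp: is_weak_deriv_def)
  show "g \<in> L1_loc \<Omega>" by (rule g)
  show "f' \<in> L1_loc \<Omega>"
    unfolding L1_loc_def
  proof (intro CollectI allI impI)
    fix K assume K: "compact K \<and> K \<subseteq> \<Omega>"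
    then have Km: "K \<in> sets lebesgue" by (auto simp: lmeasurable_compact fmeasurableD)
    have "integrable (lebesgue_on K) f" using f K by (auto simp: L1_loc_def)
    then show "integrable (lebesgue_on K) f'"
      by (rule integrable_lebesgue_on_AE(1)[OF Km _ AE_lebesgue_on_subset[OF _ Km \<Omega>m ae]]) (use K in auto)
  qed
  fix \<zeta> :: "'a \<Rightarrow> real" assume \<zeta>: "\<zeta> \<in> test_functions \<Omega>"
  have "AE x in lebesgue_on \<Omega>. f x * partials bs \<zeta> x = f' x * partials bs \<zeta> x"
    using ae by eventually_elim simp
  from integrable_lebesgue_on_AE(2)[OF \<Omega>m integrable_L1_loc_partials[OF \<Omega> f \<zeta> bs] this]
  show "(\<integral>x. f' x * partials bs \<zeta> x \<partial>lebesgue_on \<Omega>) = (-1) ^ length bs * (\<integral>x. g x * \<zeta> x \<partial>lebesgue_on \<Omega>)"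
    using w \<zeta> by (simp add: is_weak_deriv_def)
qed

lemma AE_weak_deriv:
  assumes "open \<Omega>" "is_weak_deriv \<Omega> bs f g"
  shows "AE x in lebesgue_on \<Omega>. weak_deriv \<Omega> bs f x = g x"
proof -
  have "is_weak_deriv \<Omega> bs f (weak_deriv \<Omega> bs f)"
    unfolding weak_deriv_def by (rule someI[of "is_weak_deriv \<Omega> bs f", OF assms(2)])
  then show ?thesis using is_weak_deriv_unique assms by blast
qed

text \<open>A converse of dominated convergence along a subsequence: once the integrals are below
  \<open>(1/2) ^ n\<close>, the sum of the functions is integrable, so almost everywhere its terms
  tend to 0 and are dominated by it.\<close>

lemma integrable_dominated_subsequence:
  fixes f :: "nat \<Rightarrow> 'a \<Rightarrow> real"
  assumes int: "\<And>n. integrable M (f n)" and nn: "\<And>n x. 0 \<le> f n x"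
    and lim: "(\<lambda>n. \<integral>x. f n x \<partial>M) \<longlonglongrightarrow> 0"
  shows "\<exists>r F. strict_mono (r :: nat \<Rightarrow> nat) \<and> integrable M F \<and> (\<forall>x. 0 \<le> F x)
    \<and> (AE x in M. (\<lambda>n. f (r n) x) \<longlonglongrightarrow> 0) \<and> (AE x in M. \<forall>n. f (r n) x \<le> F x)"
proof -
  have ev: "\<exists>m>k. (\<integral>x. f m x \<partial>M) < (1/2) ^ n" for k n
  proof -
    have "\<forall>\<^sub>F m in sequentially. (\<integral>x. f m x \<partial>M) < (1/2) ^ n"
      by (rule order_tendstoD(2)[OF lim]) simp
    then have "\<forall>\<^sub>F m in sequentially. (\<integral>x. f m x \<partial>M) < (1/2) ^ n \<and> m > k"
      using eventually_gt_at_top by (rule eventually_conj)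
    then show ?thesis by (auto simp: eventually_sequentially)
  qed
  have "\<exists>r. \<forall>n. (\<integral>x. f (r n) x \<partial>M) < (1/2) ^ n \<and> r n < r (Suc n)"
  proof (rule dependent_nat_choice)
    show "\<exists>m. (\<integral>x. f m x \<partial>M) < (1/2) ^ 0" using ev[of 0 0] by blast
    show "\<exists>m'. (\<integral>x. f m' x \<partial>M) < (1/2) ^ Suc n \<and> m < m'" for m n
      using ev[of m "Suc n"] by blast
  qed
  then obtain r where r_less: "\<And>n. (\<integral>x. f (r n) x \<partial>M) < (1/2) ^ n" and r_Suc: "\<And>n. r n < r (Suc n)"
    by blast
  have mono: "strict_mono r" using r_Suc by (simp add: strict_mono_Suc_iff)
  have "(\<integral>\<^sup>+x. (\<Sum>n. ennreal (f (r n) x)) \<partial>M) = (\<Sum>n. \<integral>\<^sup>+x. ennreal (f (r n) x) \<partial>M)"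
    using int by (intro nn_integral_suminf) auto
  also have "\<dots> = (\<Sum>n. ennreal (\<integral>x. f (r n) x \<partial>M))"
    using int nn by (intro suminf_cong nn_integral_eq_integral) auto
  also have "\<dots> \<le> (\<Sum>n. ennreal ((1/2) ^ n))"
    using r_less by (intro suminf_le ennreal_leI) (auto intro: less_imp_le)
  also have "\<dots> < \<infinity>"
  proof -
    have "(\<Sum>n. ennreal ((1/2::real) ^ n)) = ennreal (\<Sum>n. (1/2) ^ n)"
      by (rule suminf_ennreal2) (auto intro: summable_geometric)
    then show ?thesis by (simp only: ennreal_less_top infinity_ennreal_def)
  qed
  finally have fin: "(\<integral>\<^sup>+x. (\<Sum>n. ennreal (f (r n) x)) \<partial>M) < \<infinity>" .
  have "AE x in M. (\<Sum>n. ennreal (f (r n) x)) \<noteq> \<infinity>"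
    using fin int by (intro nn_integral_noteq_infinite) auto
  then have summ: "AE x in M. summable (\<lambda>n. f (r n) x)"
    by eventually_elim (auto intro!: summable_suminf_not_top nn)
  define F where "F x = max 0 (\<Sum>n. f (r n) x)" for x
  have "integrable M (\<lambda>x. \<Sum>n. f (r n) x)"
  proof (rule integrable_suminf)
    show "AE x in M. summable (\<lambda>i. norm (f (r i) x))" using summ by eventually_elim (simp add: nn)
    show "summable (\<lambda>i. \<integral>x. norm (f (r i) x) \<partial>M)"
      by (rule summable_comparison_test'[of "\<lambda>n. (1/2::real) ^ n" 0])
         (use nn r_less in \<open>auto intro!: less_imp_le[OF r_less] simp: integral_nonneg_AE\<close>)
  qed (rule int)
  then have intF: "integrable M F" unfolding F_def by (intro integrable_max integrable_zero)
  have nnF: "\<forall>x. 0 \<le> F x" unfolding F_def by simp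
  have limF: "AE x in M. (\<lambda>n. f (r n) x) \<longlonglongrightarrow> 0" using summ by eventually_elim (rule summable_LIMSEQ_zero)
  have domF: "AE x in M. \<forall>n. f (r n) x \<le> F x"
    using summ
  proof eventually_elim
    case (elim x)
    have "f (r n) x \<le> (\<Sum>n. f (r n) x)" for n
      using sum_le_suminf[OF elim, of "{n}"] nn by simp
    then show ?case by (simp add: F_def max.coboundedI2)
  qed
  show ?thesis by (intro exI[of _ r] exI[of _ F] conjI mono intF nnF limF domF)
qed

abbreviation E1 :: "real^2" where "E1 \<equiv> axis 1 1"
abbreviation E2 :: "real^2" where "E2 \<equiv> axis 2 1"

lemma Basis_real2: "(Basis :: (real^2) set) = {E1, E2}"
proof -
  have "(Basis :: (real^2) set) = (\<Union>i. {axis i 1})" by (auto simp: Basis_vec_def)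
  also have "\<dots> = {E1, E2}" by (auto simp: UNIV_2)
  finally show ?thesis .
qed

lemma E1_neq_E2: "E1 \<noteq> E2"
  by (simp add: axis_eq_axis)

lemma linear_real2:
  fixes f :: "real^2 \<Rightarrow> real"
  assumes "linear f"
  shows "f h = f E1 * h$1 + f E2 * h$2"
proof -
  have "h = h$1 *\<^sub>R E1 + h$2 *\<^sub>R E2"
    by (auto simp: vec_eq_iff axis_def forall_2)
  then have "f h = f (h$1 *\<^sub>R E1 + h$2 *\<^sub>R E2)" by simp
  also have "\<dots> = h$1 * f E1 + h$2 * f E2"
    using assms by (simp add: linear_add linear_scale)
  finally show ?thesis by (simp add: mult.commute)
qed

subsection \<open>Willmore energy and approximation by classical graphs\<close>

text \<open>With \<open>mean_curv\<close>, the pointwise counterpart of \<open>Q\<close> and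
  \<open>H\<close> in \<open>C2_graph\<close>: functions of derivative values alone, so that they
  apply to weak derivatives as well.\<close>

definition area_fn :: "real \<Rightarrow> real \<Rightarrow> real" where "area_fn a b = sqrt (1 + a\<^sup>2 + b\<^sup>2)"

definition mean_curv :: "real \<Rightarrow> real \<Rightarrow> real \<Rightarrow> real \<Rightarrow> real \<Rightarrow> real" where
  "mean_curv a b r s t = (r + t) / area_fn a b - (a\<^sup>2 * r + 2 * a * b * s + b\<^sup>2 * t) / (area_fn a b)^3"

text \<open>The argument assigns to a list of directions the value of that iterated derivative.\<close>

definition willmore_density :: "((real^2) list \<Rightarrow> real) \<Rightarrow> real" where
  "willmore_density D = (mean_curv (D [E1]) (D [E2]) (D [E1, E1]) (D [E1, E2]) (D [E2, E2]))\<^sup>2 * area_fn (D [E1]) (D [E2])"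

lemma area_fn_ge_1: "area_fn a b \<ge> 1" and area_fn_pos: "area_fn a b > 0" and area_fn_sq: "(area_fn a b)\<^sup>2 = 1 + a\<^sup>2 + b\<^sup>2"
proof -
  show 1: "area_fn a b \<ge> 1" by (simp add: area_fn_def)
  then show "area_fn a b > 0" by linarith
  show "(area_fn a b)\<^sup>2 = 1 + a\<^sup>2 + b\<^sup>2" by (simp add: area_fn_def)
qed

lemma area_fn_abs_le: "\<bar>a\<bar> \<le> area_fn a b" "\<bar>b\<bar> \<le> area_fn a b"
  by (auto simp: area_fn_def intro!: real_le_rsqrt)

lemma C2_graph_Ck:
  assumes \<Omega>: "open \<Omega>" and f: "f \<in> Ck_on 2 \<Omega>"
  shows "C2_graph \<Omega> f (partials [E1] f) (partials [E2] f) (partials [E1, E1] f) (partials [E1, E2] f) (partials [E2, E2] f)"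
proof
  have d: "(partials bs f has_derivative (\<lambda>h. partials (E1 # bs) f x * h$1 + partials (E2 # bs) f x * h$2)) (at x)"
    if "x \<in> \<Omega>" "set bs \<subseteq> Basis" "length bs < 2" for x bs
  proof -
    have D: "(partials bs f has_derivative frechet_derivative (partials bs f) (at x)) (at x)"
      by (rule Ck_on_has_derivative[OF f that])
    show ?thesis
    proof (rule has_derivative_eq_rhs[OF D], rule ext)
      show "frechet_derivative (partials bs f) (at x) h = partials (E1 # bs) f x * h$1 + partials (E2 # bs) f x * h$2" for h
        using linear_real2[OF has_derivative_linear[OF D], of h] by simp
    qed
  qed
  show "open \<Omega>" by fact
  show "(f has_derivative (\<lambda>h. partials [E1] f x * h$1 + partials [E2] f x * h$2)) (at x)" if "x \<in> \<Omega>" for x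
    using d[OF that, of "[]"] by simp
  show "(partials [E1] f has_derivative (\<lambda>h. partials [E1, E1] f x * h$1 + partials [E1, E2] f x * h$2)) (at x)"
    if "x \<in> \<Omega>" for x
    using d[OF that, of "[E1]"] Ck_on_2_partials_commute[OF \<Omega> f that, of E1 E2] by (simp add: Basis_real2)
  show "(partials [E2] f has_derivative (\<lambda>h. partials [E1, E2] f x * h$1 + partials [E2, E2] f x * h$2)) (at x)"
    if "x \<in> \<Omega>" for x
    using d[OF that, of "[E2]"] by (simp add: Basis_real2)
  show "continuous_on \<Omega> (partials [E1, E1] f)" "continuous_on \<Omega> (partials [E1, E2] f)" "continuous_on \<Omega> (partials [E2, E2] f)"
    by (rule Ck_on_continuous[OF f]; simp add: Basis_real2)+
qed

lemma C2_graph_add: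
  assumes "C2_graph \<Omega> f f1 f2 f11 f12 f22" "C2_graph \<Omega> g g1 g2 g11 g12 g22"
  shows "C2_graph \<Omega> (\<lambda>x. f x + g x) (\<lambda>x. f1 x + g1 x) (\<lambda>x. f2 x + g2 x)
    (\<lambda>x. f11 x + g11 x) (\<lambda>x. f12 x + g12 x) (\<lambda>x. f22 x + g22 x)"
proof -
  interpret f: C2_graph \<Omega> f f1 f2 f11 f12 f22 by fact
  interpret g: C2_graph \<Omega> g g1 g2 g11 g12 g22 by fact
  have *: "((\<lambda>x. a x + b x) has_derivative (\<lambda>h. (a1 + b1) * h$1 + (a2 + b2) * h$2)) (at x)"
    if "(a has_derivative (\<lambda>h. a1 * h$1 + a2 * h$2)) (at x)" "(b has_derivative (\<lambda>h. b1 * h$1 + b2 * h$2)) (at x)"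
    for a b :: "real^2 \<Rightarrow> real" and a1 a2 b1 b2 x
    using has_derivative_add[OF that] by (simp add: algebra_simps)
  show ?thesis
    by unfold_locales
      (intro f.open_domain * f.deriv_z g.deriv_z f.deriv_p1 g.deriv_p1 f.deriv_p2 g.deriv_p2 continuous_intros
       f.cont_p11 f.cont_p12 f.cont_p22 g.cont_p11 g.cont_p12 g.cont_p22; assumption)+
qed

text \<open>Each derivative extends continuously to the compact closure and is therefore bounded;
  finitely many multi-indices allow a common bound.\<close>

lemma partials_bounded:
  fixes \<Omega> :: "'a::euclidean_space set"
  assumes \<Omega>: "bounded \<Omega>" and \<phi>: "\<phi> \<in> Ck_closure 2 \<Omega>"
  obtains B where "\<And>bs x. bs \<in> multi_indices 2 \<Longrightarrow> x \<in> \<Omega> \<Longrightarrow> \<bar>partials bs \<phi> x\<bar> \<le> B"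
proof -
  have fin: "finite (multi_indices 2 :: 'a list set)"
    unfolding multi_indices_def by (rule finite_lists_length_le) simp
  have "\<exists>B. \<forall>x\<in>\<Omega>. \<bar>partials bs \<phi> x\<bar> \<le> B" if bs: "bs \<in> multi_indices 2" for bs
  proof -
    obtain g where g: "continuous_on (closure \<Omega>) g" "\<forall>x\<in>\<Omega>. g x = partials bs \<phi> x"
      using \<phi> bs unfolding Ck_closure_def by blast
    have "compact (closure \<Omega>)" using \<Omega> by simp
    then have "bounded (g ` closure \<Omega>)" using g(1) by (intro compact_imp_bounded compact_continuous_image)
    then obtain B where B: "\<forall>y\<in>g ` closure \<Omega>. norm y \<le> B" unfolding bounded_iff by blast
    have "\<bar>partials bs \<phi> x\<bar> \<le> B" if "x \<in> \<Omega>" for x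
      using B g(2) that closure_subset[of \<Omega>] by force
    then show ?thesis by blast
  qed
  then obtain B where B: "\<And>bs x. bs \<in> multi_indices 2 \<Longrightarrow> x \<in> \<Omega> \<Longrightarrow> \<bar>partials bs \<phi> x\<bar> \<le> B bs"
    by metis
  have "\<bar>partials bs \<phi> x\<bar> \<le> Max (B ` multi_indices 2)" if "bs \<in> multi_indices 2" "x \<in> \<Omega>" for bs x
  proof -
    have "B bs \<le> Max (B ` multi_indices 2)" by (intro Max_ge finite_imageI fin imageI that)
    with B[OF that] show ?thesis by (rule order_trans)
  qed
  then show ?thesis by (rule that)
qed

lemma multi_indices_2_real2:
  "[] \<in> multi_indices 2" "[E1] \<in> multi_indices 2" "[E2] \<in> multi_indices 2"
  "[E1, E1] \<in> multi_indices 2" "[E1, E2] \<in> multi_indices 2" "[E2, E2] \<in> multi_indices 2"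
  by (simp_all add: multi_indices_def Basis_real2)

abbreviation grad_data :: "(real^2 \<Rightarrow> real) \<Rightarrow> (real^2 \<Rightarrow> real) \<Rightarrow> real^2 \<Rightarrow> (real^2) list \<Rightarrow> real" where
  "grad_data \<phi> \<zeta> x \<equiv> \<lambda>bs. partials bs \<phi> x + partials bs \<zeta> x"

lemma C2_graph_pair_test:
  assumes \<Omega>: "open \<Omega>" "bounded \<Omega>" and \<phi>: "\<phi> \<in> Ck_on 2 \<Omega>" and \<zeta>: "\<zeta> \<in> test_functions \<Omega>"
    and B: "\<And>bs x. bs \<in> multi_indices 2 \<Longrightarrow> x \<in> \<Omega> \<Longrightarrow> \<bar>partials bs \<phi> x\<bar> \<le> B"
  shows "C2_graph_pair \<Omega> (\<lambda>x. \<phi> x + \<zeta> x)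
    (\<lambda>x. partials [E1] \<phi> x + partials [E1] \<zeta> x) (\<lambda>x. partials [E2] \<phi> x + partials [E2] \<zeta> x)
    (\<lambda>x. partials [E1, E1] \<phi> x + partials [E1, E1] \<zeta> x) (\<lambda>x. partials [E1, E2] \<phi> x + partials [E1, E2] \<zeta> x)
    (\<lambda>x. partials [E2, E2] \<phi> x + partials [E2, E2] \<zeta> x)
    \<phi> (partials [E1] \<phi>) (partials [E2] \<phi>) (partials [E1, E1] \<phi>) (partials [E1, E2] \<phi>) (partials [E2, E2] \<phi>)
    (tsupp \<zeta>) B"
proof -
  have \<zeta>2: "\<zeta> \<in> Ck_on 2 \<Omega>" using test_functionsD(3)[OF \<zeta>] by (rule Ck_on_mono) simp
  have g: "C2_graph \<Omega> \<phi> (partials [E1] \<phi>) (partials [E2] \<phi>) (partials [E1, E1] \<phi>) (partials [E1, E2] \<phi>) (partials [E2, E2] \<phi>)"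
    by (rule C2_graph_Ck[OF \<Omega>(1) \<phi>])
  have z: "C2_graph \<Omega> (\<lambda>x. \<phi> x + \<zeta> x)
    (\<lambda>x. partials [E1] \<phi> x + partials [E1] \<zeta> x) (\<lambda>x. partials [E2] \<phi> x + partials [E2] \<zeta> x)
    (\<lambda>x. partials [E1, E1] \<phi> x + partials [E1, E1] \<zeta> x) (\<lambda>x. partials [E1, E2] \<phi> x + partials [E1, E2] \<zeta> x)
    (\<lambda>x. partials [E2, E2] \<phi> x + partials [E2, E2] \<zeta> x)"
    by (rule C2_graph_add[OF g C2_graph_Ck[OF \<Omega>(1) \<zeta>2]])
  show ?thesis
  proof (rule C2_graph_pair.intro[OF z g], unfold_locales)
    show "bounded \<Omega>" "compact (tsupp \<zeta>)" "tsupp \<zeta> \<subseteq> \<Omega>" using \<Omega> test_functionsD[OF \<zeta>] by auto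
    show "\<phi> x + \<zeta> x = \<phi> x" if "x \<in> \<Omega> - tsupp \<zeta>" for x
      using partials_eq_0_off_tsupp[of x \<zeta> "[]"] that by simp
    show "\<bar>\<phi> x\<bar> \<le> B \<and> \<bar>partials [E1] \<phi> x\<bar> \<le> B \<and> \<bar>partials [E2] \<phi> x\<bar> \<le> B \<and> \<bar>partials [E1, E1] \<phi> x\<bar> \<le> B
      \<and> \<bar>partials [E1, E2] \<phi> x\<bar> \<le> B \<and> \<bar>partials [E2, E2] \<phi> x\<bar> \<le> B" if "x \<in> \<Omega>" for x
      using B[OF multi_indices_2_real2(1) that] B[OF multi_indices_2_real2(2) that] B[OF multi_indices_2_real2(3) that]
        B[OF multi_indices_2_real2(4) that] B[OF multi_indices_2_real2(5) that] B[OF multi_indices_2_real2(6) that]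
      by simp
  qed
qed

text \<open>The slopes are at most the area element, so two of the three powers in the denominator
  absorb them.\<close>

lemma hessian_term_le:
  assumes "\<bar>u\<bar> \<le> area_fn a b" "\<bar>v\<bar> \<le> area_fn a b"
  shows "\<bar>u * v * r / (area_fn a b)^3\<bar> \<le> \<bar>r\<bar> / area_fn a b"
proof -
  have "\<bar>u * v * r\<bar> \<le> area_fn a b * area_fn a b * \<bar>r\<bar>"
    unfolding abs_mult using assms area_fn_pos[of a b] by (intro mult_mono) auto
  then have "\<bar>u * v * r\<bar> / (area_fn a b)^3 \<le> area_fn a b * area_fn a b * \<bar>r\<bar> / (area_fn a b)^3"
    using area_fn_pos[of a b] by (intro divide_right_mono) auto
  also have "\<dots> = \<bar>r\<bar> / area_fn a b"
    using area_fn_pos[of a b] by (simp add: power3_eq_cube)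
  finally show ?thesis using area_fn_pos[of a b] by (simp add: abs_divide)
qed

lemma mean_curv_le: "\<bar>mean_curv a b r s t\<bar> \<le> 2 * (\<bar>r\<bar> + \<bar>s\<bar> + \<bar>t\<bar>) / area_fn a b"
proof -
  have "mean_curv a b r s t = r / area_fn a b + t / area_fn a b - a * a * r / (area_fn a b)^3 - 2 * (a * b * s / (area_fn a b)^3) - b * b * t / (area_fn a b)^3"
    by (simp add: mean_curv_def add_divide_distrib power2_eq_square)
  moreover have "\<bar>r / area_fn a b\<bar> = \<bar>r\<bar> / area_fn a b" "\<bar>t / area_fn a b\<bar> = \<bar>t\<bar> / area_fn a b"
    using area_fn_pos[of a b] by (simp_all add: abs_divide)
  moreover note hessian_term_le[of a a b a r, OF area_fn_abs_le(1) area_fn_abs_le(1)]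
    hessian_term_le[of a a b b s, OF area_fn_abs_le(1) area_fn_abs_le(2)] hessian_term_le[of b a b b t, OF area_fn_abs_le(2) area_fn_abs_le(2)]
  moreover have "2 * (\<bar>r\<bar> + \<bar>s\<bar> + \<bar>t\<bar>) / area_fn a b = 2 * (\<bar>r\<bar> / area_fn a b) + 2 * (\<bar>s\<bar> / area_fn a b) + 2 * (\<bar>t\<bar> / area_fn a b)"
    by (simp add: add_divide_distrib)
  ultimately show ?thesis by linarith
qed

lemma willmore_density_nonneg: "0 \<le> willmore_density D"
  using area_fn_pos by (simp add: willmore_density_def less_imp_le)

text \<open>A bound free of the gradient, hence a majorant from the Hessian alone when passing to
  the limit. The 12 is 4, from squaring \<open>mean_curv_le\<close>, times 3, from the square of a
  sum of three terms.\<close>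

lemma willmore_density_le:
  assumes "\<bar>D [E1, E1]\<bar> \<le> A" "\<bar>D [E1, E2]\<bar> \<le> B" "\<bar>D [E2, E2]\<bar> \<le> C"
  shows "willmore_density D \<le> 12 * (A\<^sup>2 + B\<^sup>2 + C\<^sup>2)"
proof -
  let ?q = "area_fn (D [E1]) (D [E2])"
  let ?m = "\<bar>D [E1, E1]\<bar> + \<bar>D [E1, E2]\<bar> + \<bar>D [E2, E2]\<bar>"
  have q: "?q \<ge> 1" by (rule area_fn_ge_1)
  have "(mean_curv (D [E1]) (D [E2]) (D [E1, E1]) (D [E1, E2]) (D [E2, E2]))\<^sup>2 \<le> (2 * ?m / ?q)\<^sup>2"
    using power_mono[OF mean_curv_le abs_ge_zero, where n=2] by simp
  then have "willmore_density D \<le> (2 * ?m / ?q)\<^sup>2 * ?q"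
    unfolding willmore_density_def using q by (intro mult_right_mono) auto
  also have "\<dots> = (2 * ?m)\<^sup>2 / ?q" using q by (simp add: power2_eq_square)
  also have "\<dots> \<le> (2 * ?m)\<^sup>2 / 1" using q by (intro divide_left_mono) auto
  also have "\<dots> \<le> (2 * (A + B + C))\<^sup>2" using assms by (simp only: div_by_1) (intro power_mono mult_left_mono add_mono; simp)
  also have "\<dots> \<le> 12 * (A\<^sup>2 + B\<^sup>2 + C\<^sup>2)"
    using zero_le_power2[of "A - B"] zero_le_power2[of "B - C"] zero_le_power2[of "A - C"]
    by (simp add: power2_eq_square algebra_simps)
  finally show ?thesis .
qed

lemma tendsto_willmore_density:
  assumes "\<And>bs. bs \<in> multi_indices 2 \<Longrightarrow> (\<lambda>n. Z n bs) \<longlonglongrightarrow> G bs"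
  shows "(\<lambda>n. willmore_density (Z n)) \<longlonglongrightarrow> willmore_density G"
  using area_fn_pos[THEN less_imp_neq, THEN not_sym, of "G [E1]" "G [E2]"]
  unfolding willmore_density_def mean_curv_def area_fn_def
  by (intro tendsto_intros assms multi_indices_2_real2) simp_all

section \<open>Approximation by test functions in the Sobolev space\<close>

lemma integrable_imp_L1_loc:
  assumes \<Omega>: "\<Omega> \<in> sets lebesgue" and f: "integrable (lebesgue_on \<Omega>) f"
  shows "f \<in> L1_loc \<Omega>"
  unfolding L1_loc_def
proof (intro CollectI allI impI, elim conjE)
  fix K assume K: "compact K" "K \<subseteq> \<Omega>"
  then have Km: "K \<in> sets lebesgue" by (auto simp: lmeasurable_compact fmeasurableD)
  have "integrable lebesgue (\<lambda>x. if x \<in> \<Omega> then f x else 0)"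
    using f \<Omega> by (subst Lebesgue_Measure.integrable_restrict_UNIV)
  from integrable_mult_indicator[OF Km this]
  have "integrable lebesgue (\<lambda>x. if x \<in> K then f x else 0)"
    by (rule Bochner_Integration.integrable_cong[THEN iffD1, rotated 2]) (use K in \<open>auto simp: indicator_def\<close>)
  then show "integrable (lebesgue_on K) f"
    using Km by (subst (asm) Lebesgue_Measure.integrable_restrict_UNIV)
qed

lemma partials_test_bounded:
  assumes \<zeta>: "\<zeta> \<in> test_functions \<Omega>" and bs: "set bs \<subseteq> Basis"
  obtains B where "\<And>x. \<bar>partials bs \<zeta> x\<bar> \<le> B"
proof -
  have "compact (partials bs \<zeta> ` tsupp \<zeta>)"
    using continuous_partials_test[OF \<zeta> bs] test_functionsD(1)[OF \<zeta>]
    by (intro compact_continuous_image) (auto intro: continuous_on_subset)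
  from compact_imp_bounded[OF this] obtain B where B: "\<forall>y\<in>partials bs \<zeta> ` tsupp \<zeta>. norm y \<le> B"
    unfolding bounded_iff by blast
  have "\<bar>partials bs \<zeta> x\<bar> \<le> max B 0" for x
    using B partials_eq_0_off_tsupp[of x \<zeta> bs] by (cases "x \<in> tsupp \<zeta>") force+
  then show ?thesis by (rule that)
qed

lemma integrable_partials_test:
  assumes \<Omega>: "open \<Omega>" "bounded \<Omega>" and \<zeta>: "\<zeta> \<in> test_functions \<Omega>" and bs: "set bs \<subseteq> Basis"
  shows "integrable (lebesgue_on \<Omega>) (partials bs \<zeta>)" "integrable (lebesgue_on \<Omega>) (\<lambda>x. (partials bs \<zeta> x)\<^sup>2)"
proof -
  obtain B where B: "\<And>x. \<bar>partials bs \<zeta> x\<bar> \<le> B" by (rule partials_test_bounded[OF \<zeta> bs]) blast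
  have c: "continuous_on \<Omega> (partials bs \<zeta>)"
    using continuous_partials_test[OF \<zeta> bs] by (rule continuous_on_subset) simp
  show "integrable (lebesgue_on \<Omega>) (partials bs \<zeta>)"
    by (rule integrable_continuous_bounded[OF \<Omega> c B])
  have "\<bar>(partials bs \<zeta> x)\<^sup>2\<bar> \<le> B\<^sup>2" for x
    using power_mono[OF B[of x] abs_ge_zero, of 2] by simp
  then show "integrable (lebesgue_on \<Omega>) (\<lambda>x. (partials bs \<zeta> x)\<^sup>2)"
    by (intro integrable_continuous_bounded[OF \<Omega>] continuous_intros c)
qed

lemma integrable_square_diff:
  assumes f: "f \<in> borel_measurable M" "integrable M (\<lambda>x. (f x)\<^sup>2)" and g: "g \<in> borel_measurable M" "integrable M (\<lambda>x. (g x)\<^sup>2)"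
  shows "integrable M (\<lambda>x. (f x - g x :: real)\<^sup>2)"
proof (rule Bochner_Integration.integrable_bound)
  show "integrable M (\<lambda>x. 2 * (f x)\<^sup>2 + 2 * (g x)\<^sup>2)" using f g by simp
  show "(\<lambda>x. (f x - g x)\<^sup>2) \<in> borel_measurable M" using f(1) g(1) by measurable
  have "(f x - g x)\<^sup>2 \<le> 2 * (f x)\<^sup>2 + 2 * (g x)\<^sup>2" for x
    using zero_le_power2[of "f x + g x"] by (simp add: power2_eq_square algebra_simps)
  then show "AE x in M. norm ((f x - g x)\<^sup>2) \<le> norm (2 * (f x)\<^sup>2 + 2 * (g x)\<^sup>2)" by simp
qed

lemma finite_multi_indices: "finite (multi_indices k :: 'a::euclidean_space list set)"
  unfolding multi_indices_def by (rule finite_lists_length_le) simp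

text \<open>Norm convergence only sends integrals of squared errors to 0. Collecting the squared
  errors of all derivatives in one function \<open>T n\<close> yields a single subsequence with
  convergence almost everywhere and a common integrable majorant.\<close>

lemma sobolev_H0_approx:
  fixes \<Omega> :: "'a::euclidean_space set"
  assumes \<Omega>: "open \<Omega>" "bounded \<Omega>" and w: "w \<in> sobolev_H0 2 \<Omega>"
  shows "\<exists>\<zeta> g F. (\<forall>n. \<zeta> n \<in> test_functions \<Omega>)
    \<and> (\<forall>bs\<in>multi_indices 2. g bs \<in> L2 \<Omega> \<and> is_weak_deriv \<Omega> bs w (g bs))
    \<and> integrable (lebesgue_on \<Omega>) F \<and> (\<forall>x. 0 \<le> F x)
    \<and> (AE x in lebesgue_on \<Omega>. \<forall>bs\<in>multi_indices 2. (\<lambda>n. partials bs (\<zeta> n) x) \<longlonglongrightarrow> g bs x)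
    \<and> (AE x in lebesgue_on \<Omega>. \<forall>n. \<forall>bs\<in>multi_indices 2. (g bs x - partials bs (\<zeta> n) x)\<^sup>2 \<le> F x)"
proof -
  have \<Omega>m: "\<Omega> \<in> sets lebesgue" using \<Omega> by auto
  let ?I = "multi_indices 2 :: 'a list set"
  have I: "set bs \<subseteq> Basis" if "bs \<in> ?I" for bs using that by (auto simp: multi_indices_def)
  from w obtain \<zeta> where \<zeta>: "\<And>n. \<zeta> n \<in> test_functions \<Omega>"
    and lim: "(\<lambda>n. sobolev_norm 2 \<Omega> (\<lambda>x. w x - \<zeta> n x)) \<longlonglongrightarrow> 0"
    unfolding sobolev_H0_def by blast
  have "\<forall>bs\<in>?I. \<exists>g. g \<in> L2 \<Omega> \<and> is_weak_deriv \<Omega> bs w g"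
    using w unfolding sobolev_H0_def sobolev_H_def by blast
  from bchoice[OF this] obtain g where gI: "\<forall>bs\<in>?I. g bs \<in> L2 \<Omega> \<and> is_weak_deriv \<Omega> bs w (g bs)"
    by (rule exE)
  have g: "g bs \<in> L2 \<Omega>" "is_weak_deriv \<Omega> bs w (g bs)" if "bs \<in> ?I" for bs
    using gI that by simp_all
  define D where "D n bs x = g bs x - partials bs (\<zeta> n) x" for n bs x
  have D2: "integrable (lebesgue_on \<Omega>) (\<lambda>x. (D n bs x)\<^sup>2)" if "bs \<in> ?I" for n bs
    unfolding D_def using g(1)[OF that] integrable_partials_test[OF \<Omega> \<zeta> I[OF that]]
    by (intro integrable_square_diff) (auto simp: L2_def)
  \<comment> \<open>\<open>sobolev_norm\<close> is built from chosen weak derivatives of the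
    difference; uniqueness identifies them with the explicit \<open>D n\<close>.\<close>
  have D_weak: "AE x in lebesgue_on \<Omega>. weak_deriv \<Omega> bs (\<lambda>x. w x - \<zeta> n x) x = D n bs x" if "bs \<in> ?I" for n bs
  proof (rule AE_weak_deriv[OF \<Omega>(1)])
    have "\<zeta> n \<in> Ck_on 2 \<Omega>" using test_functionsD(3)[OF \<zeta>] by (rule Ck_on_mono) simp
    from is_weak_deriv_diff[OF \<Omega>(1) I[OF that] g(2)[OF that] is_weak_deriv_classical[OF \<Omega>(1) this that]]
    show "is_weak_deriv \<Omega> bs (\<lambda>x. w x - \<zeta> n x) (D n bs)" by (simp add: D_def[abs_def])
  qed
  have D_eq: "(\<integral>x. (weak_deriv \<Omega> bs (\<lambda>x. w x - \<zeta> n x) x)\<^sup>2 \<partial>lebesgue_on \<Omega>) = (\<integral>x. (D n bs x)\<^sup>2 \<partial>lebesgue_on \<Omega>)"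
    if "bs \<in> ?I" for n bs
  proof -
    have "AE x in lebesgue_on \<Omega>. (D n bs x)\<^sup>2 = (weak_deriv \<Omega> bs (\<lambda>x. w x - \<zeta> n x) x)\<^sup>2"
      using D_weak[OF that, of n] by eventually_elim simp
    from integrable_lebesgue_on_AE(2)[OF \<Omega>m D2[OF that] this] show ?thesis by simp
  qed
  define T where "T n x = (\<Sum>bs\<in>?I. (D n bs x)\<^sup>2)" for n x
  have T: "integrable (lebesgue_on \<Omega>) (T n)" for n
    unfolding T_def by (intro Bochner_Integration.integrable_sum D2)
  have T_nn: "0 \<le> T n x" for n x unfolding T_def by (intro sum_nonneg) simp
  have "(\<integral>x. T n x \<partial>lebesgue_on \<Omega>) = (sobolev_norm 2 \<Omega> (\<lambda>x. w x - \<zeta> n x))\<^sup>2" for n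
  proof -
    have "(\<integral>x. T n x \<partial>lebesgue_on \<Omega>) = (\<Sum>bs\<in>?I. \<integral>x. (weak_deriv \<Omega> bs (\<lambda>x. w x - \<zeta> n x) x)\<^sup>2 \<partial>lebesgue_on \<Omega>)"
      unfolding T_def by (subst Bochner_Integration.integral_sum) (simp_all add: D2 D_eq)
    moreover have "0 \<le> (\<Sum>bs\<in>?I. \<integral>x. (weak_deriv \<Omega> bs (\<lambda>x. w x - \<zeta> n x) x)\<^sup>2 \<partial>lebesgue_on \<Omega>)"
      by (intro sum_nonneg integral_nonneg_AE) simp
    ultimately show ?thesis by (simp add: sobolev_norm_def)
  qed
  then have "(\<lambda>n. \<integral>x. T n x \<partial>lebesgue_on \<Omega>) \<longlonglongrightarrow> 0"
    using tendsto_power[OF lim, of 2] by simp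
  from integrable_dominated_subsequence[OF T T_nn this]
  obtain r F where r: "strict_mono r" "integrable (lebesgue_on \<Omega>) F" "\<forall>x. 0 \<le> F x"
     "AE x in lebesgue_on \<Omega>. (\<lambda>n. T (r n) x) \<longlonglongrightarrow> 0" "AE x in lebesgue_on \<Omega>. \<forall>n. T (r n) x \<le> F x"
    by (elim exE conjE)
  have D_le_T: "(D n bs x)\<^sup>2 \<le> T n x" if "bs \<in> ?I" for n bs x
    unfolding T_def by (rule member_le_sum[OF that _ finite_multi_indices]) simp
  show ?thesis
  proof (intro exI[of _ "\<lambda>n. \<zeta> (r n)"] exI[of _ g] exI[of _ F] conjI)
    show "AE x in lebesgue_on \<Omega>. \<forall>bs\<in>?I. (\<lambda>n. partials bs (\<zeta> (r n)) x) \<longlonglongrightarrow> g bs x"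
      using r(4)
    proof eventually_elim
      case (elim x)
      show ?case
      proof
        fix bs assume bs: "bs \<in> ?I"
        have "(\<lambda>n. (D (r n) bs x)\<^sup>2) \<longlonglongrightarrow> 0"
          by (rule tendsto_sandwich[OF _ _ tendsto_const elim]) (auto intro!: always_eventually D_le_T bs)
        then have "(\<lambda>n. sqrt ((D (r n) bs x)\<^sup>2)) \<longlonglongrightarrow> sqrt 0" by (rule tendsto_real_sqrt)
        then have "(\<lambda>n. D (r n) bs x) \<longlonglongrightarrow> 0" by (simp add: tendsto_rabs_zero_iff)
        from tendsto_diff[OF tendsto_const this, of "g bs x"]
        show "(\<lambda>n. partials bs (\<zeta> (r n)) x) \<longlonglongrightarrow> g bs x" by (simp add: D_def)
      qed
    qed
    show "AE x in lebesgue_on \<Omega>. \<forall>n. \<forall>bs\<in>?I. (g bs x - partials bs (\<zeta> (r n)) x)\<^sup>2 \<le> F x"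
      using r(5)
    proof eventually_elim
      case (elim x)
      then show ?case using order_trans[OF D_le_T] unfolding D_def by blast
    qed
    show "\<forall>n. \<zeta> (r n) \<in> test_functions \<Omega>" using \<zeta> by blast
  qed (rule gI r(2) r(3))+
qed

text \<open>Integration by parts passes to the limit, because \<open>V n\<close> is bounded by a
  constant and \<open>d n\<close> by an integrable function. It replaces a chain rule for Sobolev
  functions when \<open>V n\<close> is a component of the normalised gradient.\<close>

lemma is_weak_deriv_limit:
  fixes \<Omega> :: "'a::euclidean_space set"
  assumes \<Omega>: "open \<Omega>" "bounded \<Omega>" and b: "b \<in> Basis"
    and V: "\<And>n x. x \<in> \<Omega> \<Longrightarrow> \<exists>F'. (V n has_derivative F') (at x) \<and> F' b = d n x"
    and d: "\<And>n. continuous_on \<Omega> (d n)"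
    and V0: "V0 \<in> borel_measurable (lebesgue_on \<Omega>)" and d0: "d0 \<in> borel_measurable (lebesgue_on \<Omega>)"
    and limV: "AE x in lebesgue_on \<Omega>. (\<lambda>n. V n x) \<longlonglongrightarrow> V0 x"
    and limd: "AE x in lebesgue_on \<Omega>. (\<lambda>n. d n x) \<longlonglongrightarrow> d0 x"
    and bV: "\<And>n x. x \<in> \<Omega> \<Longrightarrow> \<bar>V n x\<bar> \<le> C"
    and bd: "AE x in lebesgue_on \<Omega>. \<forall>n. \<bar>d n x\<bar> \<le> m x" and m: "integrable (lebesgue_on \<Omega>) m"
  shows "is_weak_deriv \<Omega> [b] V0 d0"
  unfolding is_weak_deriv_def
proof (intro conjI ballI)
  have \<Omega>m: "\<Omega> \<in> sets lebesgue" using \<Omega> by auto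
  have contV: "continuous_on \<Omega> (V n)" for n
    using V by (intro continuous_at_imp_continuous_on ballI) (blast intro: has_derivative_continuous)
  have meas: "f \<in> borel_measurable (lebesgue_on \<Omega>)" if "continuous_on \<Omega> f" for f :: "'a \<Rightarrow> real"
    using that \<Omega>m by (rule continuous_imp_measurable_on_sets_lebesgue)
  have aeV0: "AE x in lebesgue_on \<Omega>. \<bar>V0 x\<bar> \<le> C"
    using limV AE_space
  proof eventually_elim
    case (elim x)
    then show ?case using bV[of x] by (intro tendsto_upperbound[OF tendsto_rabs[OF elim(1)]]) auto
  qed
  have aed0: "AE x in lebesgue_on \<Omega>. \<bar>d0 x\<bar> \<le> m x"
    using limd bd
  proof eventually_elim
    case (elim x)
    then show ?case by (intro tendsto_upperbound[OF tendsto_rabs[OF elim(1)]]) auto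
  qed
  have "finite_measure (lebesgue_on \<Omega>)"
    using \<Omega> by (intro finite_measure_lebesgue_on lmeasurable_open)
  then have "integrable (lebesgue_on \<Omega>) V0"
    using aeV0 V0 by (intro finite_measure.integrable_const_bound[where B=C]) auto
  then show V0_loc: "V0 \<in> L1_loc \<Omega>" by (rule integrable_imp_L1_loc[OF \<Omega>m])
  have "integrable (lebesgue_on \<Omega>) d0"
    by (rule Bochner_Integration.integrable_bound[OF m d0]) (use aed0 in eventually_elim, simp)
  then show d0_loc: "d0 \<in> L1_loc \<Omega>" by (rule integrable_imp_L1_loc[OF \<Omega>m])
  fix \<eta> :: "'a \<Rightarrow> real" assume \<eta>: "\<eta> \<in> test_functions \<Omega>"
  have ibp: "(\<integral>x. V n x * partials [b] \<eta> x \<partial>lebesgue_on \<Omega>) = - (\<integral>x. d n x * \<eta> x \<partial>lebesgue_on \<Omega>)" for n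
  proof -
    have 1: "(V n has_derivative frechet_derivative (V n) (at x)) (at x)" if "x \<in> \<Omega>" for x
      using V[OF that, of n] by (auto simp: frechet_derivative_works[symmetric] differentiable_def)
    have 2: "frechet_derivative (V n) (at x) b = d n x" if "x \<in> \<Omega>" for x
    proof -
      obtain F' where F': "(V n has_derivative F') (at x)" "F' b = d n x" using V[OF \<open>x \<in> \<Omega>\<close>] by blast
      show ?thesis using frechet_derivative_at[OF F'(1)] F'(2) by simp
    qed
    show ?thesis
      using integral_by_parts_partials[OF \<Omega>(1) b _ \<eta> 1 2 d, of "[]"] by simp
  qed
  have e: "integrable (lebesgue_on \<Omega>) (partials [b] \<eta>)"
    by (rule integrable_partials_test[OF \<Omega> \<eta>]) (use b in simp)
  have \<eta>i: "integrable (lebesgue_on \<Omega>) \<eta>"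
    using integrable_partials_test(1)[OF \<Omega> \<eta>, of "[]"] by simp
  obtain B where B: "\<And>x. \<bar>\<eta> x\<bar> \<le> B" using partials_test_bounded[OF \<eta>, of "[]"] by auto
  have "(\<lambda>n. \<integral>x. V n x * partials [b] \<eta> x \<partial>lebesgue_on \<Omega>) \<longlonglongrightarrow> (\<integral>x. V0 x * partials [b] \<eta> x \<partial>lebesgue_on \<Omega>)"
  proof (rule integral_dominated_convergence)
    show "integrable (lebesgue_on \<Omega>) (\<lambda>x. C * \<bar>partials [b] \<eta> x\<bar>)" using e by (intro integrable_mult_right integrable_abs)
    show "(\<lambda>x. V0 x * partials [b] \<eta> x) \<in> borel_measurable (lebesgue_on \<Omega>)"
      using V0 borel_measurable_integrable[OF e] by (rule borel_measurable_times)
    show "(\<lambda>x. V n x * partials [b] \<eta> x) \<in> borel_measurable (lebesgue_on \<Omega>)" for n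
      using meas[OF contV] borel_measurable_integrable[OF e] by (rule borel_measurable_times)
    show "AE x in lebesgue_on \<Omega>. (\<lambda>n. V n x * partials [b] \<eta> x) \<longlonglongrightarrow> V0 x * partials [b] \<eta> x"
      using limV by eventually_elim (intro tendsto_mult tendsto_const)
    show "AE x in lebesgue_on \<Omega>. norm (V n x * partials [b] \<eta> x) \<le> C * \<bar>partials [b] \<eta> x\<bar>" for n
      unfolding real_norm_def abs_mult using bV by (intro AE_I2 mult_right_mono) auto
  qed
  moreover have "(\<lambda>n. \<integral>x. d n x * \<eta> x \<partial>lebesgue_on \<Omega>) \<longlonglongrightarrow> (\<integral>x. d0 x * \<eta> x \<partial>lebesgue_on \<Omega>)"
  proof (rule integral_dominated_convergence)
    show "integrable (lebesgue_on \<Omega>) (\<lambda>x. m x * B)" using m by (rule integrable_mult_left)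
    show "(\<lambda>x. d0 x * \<eta> x) \<in> borel_measurable (lebesgue_on \<Omega>)"
      using d0 borel_measurable_integrable[OF \<eta>i] by (rule borel_measurable_times)
    show "(\<lambda>x. d n x * \<eta> x) \<in> borel_measurable (lebesgue_on \<Omega>)" for n
      using meas[OF d] borel_measurable_integrable[OF \<eta>i] by (rule borel_measurable_times)
    show "AE x in lebesgue_on \<Omega>. (\<lambda>n. d n x * \<eta> x) \<longlonglongrightarrow> d0 x * \<eta> x"
      using limd by eventually_elim (intro tendsto_mult tendsto_const)
    show "AE x in lebesgue_on \<Omega>. norm (d n x * \<eta> x) \<le> m x * B" for n
      using bd
    proof eventually_elim
      case (elim x)
      then have "\<bar>d n x\<bar> \<le> m x" by blast
      then show ?case unfolding real_norm_def abs_mult using B[of x] by (intro mult_mono) auto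
    qed
  qed
  ultimately have "(\<integral>x. V0 x * partials [b] \<eta> x \<partial>lebesgue_on \<Omega>) = - (\<integral>x. d0 x * \<eta> x \<partial>lebesgue_on \<Omega>)"
    unfolding ibp by (intro LIMSEQ_unique[OF _ tendsto_minus])
  then show "(\<integral>x. V0 x * partials [b] \<eta> x \<partial>lebesgue_on \<Omega>) = (-1) ^ length [b] * (\<integral>x. d0 x * \<eta> x \<partial>lebesgue_on \<Omega>)"
    by simp
qed

section \<open>Weak divergence of the normalised gradient\<close>

text \<open>The partial derivative of \<open>a / area_fn a b\<close> when \<open>(r, s)\<close> are the matching derivatives of \<open>a\<close> and \<open>b\<close>.\<close>

definition flux :: "real \<Rightarrow> real \<Rightarrow> real \<Rightarrow> real \<Rightarrow> real" where
  "flux a b r s = r / area_fn a b - a * (a * r + b * s) / (area_fn a b)^3"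

lemma area_fn_commute: "area_fn a b = area_fn b a"
  by (simp add: area_fn_def algebra_simps)

lemma mean_curv_eq_flux: "mean_curv a b r s t = flux a b r s + flux b a t s"
  using area_fn_pos[of a b] unfolding area_fn_commute[of b a] flux_def
  by (simp add: mean_curv_def field_simps power2_eq_square)

lemma flux_le: "\<bar>flux a b r s\<bar> \<le> 2 * \<bar>r\<bar> + 2 * \<bar>s\<bar>"
proof -
  have le: "\<bar>y\<bar> / area_fn a b \<le> \<bar>y\<bar>" for y
    using area_fn_ge_1[of a b] divide_left_mono[of 1 "area_fn a b" "\<bar>y\<bar>"] by simp
  have "flux a b r s = r / area_fn a b - a * a * r / (area_fn a b)^3 - a * b * s / (area_fn a b)^3"
    by (simp add: flux_def distrib_left add_divide_distrib mult.assoc)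
  moreover have "\<bar>r / area_fn a b\<bar> = \<bar>r\<bar> / area_fn a b"
    using area_fn_pos[of a b] by (simp add: abs_divide)
  moreover note hessian_term_le[of a a b a r, OF area_fn_abs_le(1) area_fn_abs_le(1)]
    hessian_term_le[of a a b b s, OF area_fn_abs_le(1) area_fn_abs_le(2)] le[of r] le[of s]
  ultimately show ?thesis by linarith
qed

lemma abs_div_area_fn_le_1: "\<bar>a / area_fn a b\<bar> \<le> 1"
  using area_fn_abs_le[of a b] area_fn_pos[of a b] by (simp add: abs_divide)

context C2_graph
begin

lemma Q_eq_area_fn: "Q x = area_fn (p1 x) (p2 x)" and H_eq_mean_curv: "H x = mean_curv (p1 x) (p2 x) (p11 x) (p12 x) (p22 x)"
  by (simp_all add: Q_def area_fn_def H_def mean_curv_def)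

text \<open>For the constant vertical field, \<open>X3 = 1\<close> and \<open>X1 = X2 = 0\<close>,
  the planar field is the normalised gradient, so both claims are cases of \<open>deriv_V1\<close>
  and \<open>deriv_V2\<close>. The swapped arguments in the second give the two claims the same
  shape.\<close>

lemma deriv_flux:
  assumes x: "x \<in> \<Omega>"
  shows "\<exists>F'. ((\<lambda>x. p1 x / area_fn (p1 x) (p2 x)) has_derivative F') (at x) \<and> F' E1 = flux (p1 x) (p2 x) (p11 x) (p12 x)"
    and "\<exists>F'. ((\<lambda>x. p2 x / area_fn (p2 x) (p1 x)) has_derivative F') (at x) \<and> F' E2 = flux (p2 x) (p1 x) (p22 x) (p12 x)"
proof -
  have c: "((\<lambda>_. c) has_derivative (\<lambda>h. 0 * h$1 + 0 * h$2)) (at x)" for c :: real by simp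
  show "\<exists>F'. ((\<lambda>x. p1 x / area_fn (p1 x) (p2 x)) has_derivative F') (at x) \<and> F' E1 = flux (p1 x) (p2 x) (p11 x) (p12 x)"
    using deriv_V1[of x "\<lambda>_. 0" "\<lambda>_. 0" "\<lambda>_. 0" "\<lambda>_. 0" "\<lambda>_. 0" "\<lambda>_. 0" "\<lambda>_. 1" "\<lambda>_. 0" "\<lambda>_. 0", OF x c c c]
    by (simp add: dV1_def Q_eq_area_fn flux_def)
  show "\<exists>F'. ((\<lambda>x. p2 x / area_fn (p2 x) (p1 x)) has_derivative F') (at x) \<and> F' E2 = flux (p2 x) (p1 x) (p22 x) (p12 x)"
    using deriv_V2[of x "\<lambda>_. 0" "\<lambda>_. 0" "\<lambda>_. 0" "\<lambda>_. 0" "\<lambda>_. 0" "\<lambda>_. 0" "\<lambda>_. 1" "\<lambda>_. 0" "\<lambda>_. 0", OF x c c c]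
    by (simp add: dV2_def Q_eq_area_fn flux_def area_fn_commute[of "p2 _"] add.commute)
qed

lemma cont_flux:
  "continuous_on \<Omega> (\<lambda>x. flux (p1 x) (p2 x) (p11 x) (p12 x))"
  "continuous_on \<Omega> (\<lambda>x. flux (p2 x) (p1 x) (p22 x) (p12 x))"
  unfolding flux_def area_fn_commute[of "p2 _"] Q_eq_area_fn[symmetric]
  by (intro continuous_intros cont_p1 cont_p2 cont_p11 cont_p12 cont_p22 cont_Q; simp add: Q_neq_0)+

end

lemma weak_grad_inner: "b \<in> Basis \<Longrightarrow> weak_grad \<Omega> v x \<bullet> b = weak_deriv \<Omega> [b] v x"
  by (simp add: weak_grad_def)

lemma area_element_eq_area_fn: "area_element \<Omega> v x = area_fn (weak_deriv \<Omega> [E1] v x) (weak_deriv \<Omega> [E2] v x)"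
proof -
  have "weak_grad \<Omega> v x $ 1 = weak_grad \<Omega> v x \<bullet> E1" "weak_grad \<Omega> v x $ 2 = weak_grad \<Omega> v x \<bullet> E2"
    by (simp_all add: inner_axis)
  then have "(norm (weak_grad \<Omega> v x))\<^sup>2 = (weak_deriv \<Omega> [E1] v x)\<^sup>2 + (weak_deriv \<Omega> [E2] v x)\<^sup>2"
    by (simp add: norm_sq_real2 weak_grad_inner Basis_real2)
  then show ?thesis by (simp add: area_element_def area_fn_def)
qed

text \<open>The choices are nested: \<open>willmore\<close> takes weak derivatives of an expression
  that already contains chosen gradients. Uniqueness almost everywhere, applied at both levels,
  replaces all of them by \<open>G\<close>.\<close>

lemma willmore_eq:
  assumes \<Omega>: "open \<Omega>" and G: "\<And>b. b \<in> Basis \<Longrightarrow> is_weak_deriv \<Omega> [b] v (G [b])"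
    and f1: "is_weak_deriv \<Omega> [E1] (\<lambda>x. G [E1] x / area_fn (G [E1] x) (G [E2] x)) (\<lambda>x. flux (G [E1] x) (G [E2] x) (G [E1, E1] x) (G [E1, E2] x))"
    and f2: "is_weak_deriv \<Omega> [E2] (\<lambda>x. G [E2] x / area_fn (G [E2] x) (G [E1] x)) (\<lambda>x. flux (G [E2] x) (G [E1] x) (G [E2, E2] x) (G [E1, E2] x))"
  shows "willmore \<Omega> v = 1 / 4 * (\<integral>\<^sup>+x. ennreal (willmore_density (\<lambda>bs. G bs x)) \<partial>lebesgue_on \<Omega>)"
proof -
  have b12: "E1 \<in> Basis" "E2 \<in> Basis" by (simp_all add: Basis_real2)
  have ae1: "AE x in lebesgue_on \<Omega>. weak_deriv \<Omega> [E1] v x = G [E1] x"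
    and ae2: "AE x in lebesgue_on \<Omega>. weak_deriv \<Omega> [E2] v x = G [E2] x"
    by (rule AE_weak_deriv[OF \<Omega> G[OF b12(1)]], rule AE_weak_deriv[OF \<Omega> G[OF b12(2)]])
  let ?V = "\<lambda>y. weak_grad \<Omega> v y /\<^sub>R area_element \<Omega> v y"
  have aeV1: "AE x in lebesgue_on \<Omega>. G [E1] x / area_fn (G [E1] x) (G [E2] x) = ?V x \<bullet> E1"
    using ae1 ae2 by eventually_elim (simp add: weak_grad_inner b12 area_element_eq_area_fn divide_inverse mult.commute)
  have aeV2: "AE x in lebesgue_on \<Omega>. G [E2] x / area_fn (G [E2] x) (G [E1] x) = ?V x \<bullet> E2"
    using ae1 ae2 by eventually_elim (simp add: weak_grad_inner b12 area_element_eq_area_fn area_fn_commute[of "G [E2] _"] divide_inverse mult.commute)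
  have d1: "AE x in lebesgue_on \<Omega>. weak_deriv \<Omega> [E1] (\<lambda>y. ?V y \<bullet> E1) x = flux (G [E1] x) (G [E2] x) (G [E1, E1] x) (G [E1, E2] x)"
    by (rule AE_weak_deriv[OF \<Omega> is_weak_deriv_cong_AE[OF \<Omega> _ f1 aeV1]]) (simp add: b12)
  have d2: "AE x in lebesgue_on \<Omega>. weak_deriv \<Omega> [E2] (\<lambda>y. ?V y \<bullet> E2) x = flux (G [E2] x) (G [E1] x) (G [E2, E2] x) (G [E1, E2] x)"
    by (rule AE_weak_deriv[OF \<Omega> is_weak_deriv_cong_AE[OF \<Omega> _ f2 aeV2]]) (simp add: b12)
  have div: "weak_div \<Omega> ?V x = weak_deriv \<Omega> [E1] (\<lambda>y. ?V y \<bullet> E1) x + weak_deriv \<Omega> [E2] (\<lambda>y. ?V y \<bullet> E2) x" for x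
    unfolding weak_div_def Basis_real2 using E1_neq_E2 by simp
  have "AE x in lebesgue_on \<Omega>. ennreal ((weak_div \<Omega> ?V x)\<^sup>2 * area_element \<Omega> v x) = ennreal (willmore_density (\<lambda>bs. G bs x))"
    using ae1 ae2 d1 d2
  proof eventually_elim
    case (elim x)
    have "weak_div \<Omega> ?V x = flux (G [E1] x) (G [E2] x) (G [E1, E1] x) (G [E1, E2] x)
        + flux (G [E2] x) (G [E1] x) (G [E2, E2] x) (G [E1, E2] x)"
      unfolding div elim(3,4) ..
    moreover have "area_element \<Omega> v x = area_fn (G [E1] x) (G [E2] x)"
      unfolding area_element_eq_area_fn elim(1,2) ..
    ultimately show ?case by (simp only: willmore_density_def mean_curv_eq_flux)
  qed
  then show ?thesis unfolding willmore_def by (simp add: nn_integral_cong_AE)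
qed

text \<open>The densities converge almost everywhere and have a majorant from the Hessian, so the
  energy converges and one index serves both estimates. The factor 4 undoes the 1 / 4 in
  \<open>willmore\<close>.\<close>

lemma dirichlet_class_approx:
  assumes \<Omega>: "open \<Omega>" "bounded \<Omega>" and \<phi>: "\<phi> \<in> Ck_closure 2 \<Omega>" and v: "v \<in> dirichlet_class \<Omega> \<phi>" and \<epsilon>: "\<epsilon> > 0"
  shows "\<exists>\<zeta>\<in>test_functions \<Omega>. (\<integral>\<^sup>+x. ennreal \<bar>\<phi> x + \<zeta> x - v x\<bar> \<partial>lebesgue_on \<Omega>) \<le> ennreal \<epsilon>
    \<and> ennreal (\<integral>x. willmore_density (grad_data \<phi> \<zeta> x) \<partial>lebesgue_on \<Omega>) \<le> 4 * willmore \<Omega> v + ennreal \<epsilon>"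
proof -
  let ?I = "multi_indices 2 :: (real^2) list set"
  have \<Omega>m: "\<Omega> \<in> sets lebesgue" using \<Omega> by auto
  interpret fm: finite_measure "lebesgue_on \<Omega>"
    using \<Omega> by (intro finite_measure_lebesgue_on lmeasurable_open)
  have \<phi>2: "\<phi> \<in> Ck_on 2 \<Omega>" using \<phi> by (simp add: Ck_closure_def)
  have I: "set bs \<subseteq> Basis" "length bs \<le> 2" if "bs \<in> ?I" for bs using that by (auto simp: multi_indices_def)
  have "\<exists>B. \<forall>bs\<in>?I. \<forall>x\<in>\<Omega>. \<bar>partials bs \<phi> x\<bar> \<le> B"
    by (rule partials_bounded[OF \<Omega>(2) \<phi>]) blast
  then obtain B where B: "\<forall>bs\<in>?I. \<forall>x\<in>\<Omega>. \<bar>partials bs \<phi> x\<bar> \<le> B" by (rule exE)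
  have contphi: "continuous_on \<Omega> (partials bs \<phi>)" if "bs \<in> ?I" for bs
    by (rule Ck_on_continuous[OF \<phi>2 I[OF that]])
  have measphi: "partials bs \<phi> \<in> borel_measurable (lebesgue_on \<Omega>)" if "bs \<in> ?I" for bs
    using contphi[OF that] \<Omega>m by (rule continuous_imp_measurable_on_sets_lebesgue)
  define w where "w x = v x - \<phi> x" for x
  have w: "w \<in> sobolev_H0 2 \<Omega>" using v by (simp add: dirichlet_class_def w_def[abs_def])
  from sobolev_H0_approx[OF \<Omega> w] obtain \<zeta> g F where
    \<zeta>: "\<forall>n. \<zeta> n \<in> test_functions \<Omega>" and g: "\<forall>bs\<in>?I. g bs \<in> L2 \<Omega> \<and> is_weak_deriv \<Omega> bs w (g bs)"
    and F: "integrable (lebesgue_on \<Omega>) F" "\<forall>x. 0 \<le> F x"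
    and lim: "AE x in lebesgue_on \<Omega>. \<forall>bs\<in>?I. (\<lambda>n. partials bs (\<zeta> n) x) \<longlonglongrightarrow> g bs x"
    and dom: "AE x in lebesgue_on \<Omega>. \<forall>n. \<forall>bs\<in>?I. (g bs x - partials bs (\<zeta> n) x)\<^sup>2 \<le> F x"
    by (elim exE conjE)
  define G where "G bs x = partials bs \<phi> x + g bs x" for bs x
  \<comment> \<open>Majorant for the derivative \<open>bs\<close> along the whole sequence, as
    \<open>F\<close> bounds the squared distance to \<open>G\<close>. It is square integrable, hence
    integrable since the measure is finite.\<close>
  define M where "M bs x = \<bar>G bs x\<bar> + sqrt (F x)" for bs x
  have meas_g: "g bs \<in> borel_measurable (lebesgue_on \<Omega>)" "integrable (lebesgue_on \<Omega>) (\<lambda>x. (g bs x)\<^sup>2)" if "bs \<in> ?I" for bs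
    using g that by (auto simp: L2_def)
  have meas_G: "G bs \<in> borel_measurable (lebesgue_on \<Omega>)" if "bs \<in> ?I" for bs
    unfolding G_def[abs_def] using measphi[OF that] meas_g(1)[OF that] by (rule borel_measurable_add)
  have sqrtF: "(\<lambda>x. sqrt (F x)) \<in> borel_measurable (lebesgue_on \<Omega>)"
    using borel_measurable_integrable[OF F(1)] by measurable
  have meas_M: "M bs \<in> borel_measurable (lebesgue_on \<Omega>)" if "bs \<in> ?I" for bs
    unfolding M_def[abs_def] using meas_G[OF that] sqrtF by measurable
  have M2: "integrable (lebesgue_on \<Omega>) (\<lambda>x. (M bs x)\<^sup>2)" if bs: "bs \<in> ?I" for bs
  proof (rule Bochner_Integration.integrable_bound)
    have "\<bar>(- partials bs \<phi> x)\<^sup>2\<bar> \<le> B\<^sup>2" if "x \<in> \<Omega>" for x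
      using power_mono[of "\<bar>partials bs \<phi> x\<bar>" B 2] B bs that by simp
    then have "integrable (lebesgue_on \<Omega>) (\<lambda>x. (- partials bs \<phi> x)\<^sup>2)"
      by (intro integrable_continuous_bounded[OF \<Omega>] continuous_intros contphi bs)
    from integrable_square_diff[OF meas_g[OF bs] borel_measurable_uminus[OF measphi[OF bs]] this]
    have "integrable (lebesgue_on \<Omega>) (\<lambda>x. (G bs x)\<^sup>2)" by (simp add: G_def add.commute)
    then show "integrable (lebesgue_on \<Omega>) (\<lambda>x. 2 * (G bs x)\<^sup>2 + 2 * F x)" using F(1) by simp
    show "(\<lambda>x. (M bs x)\<^sup>2) \<in> borel_measurable (lebesgue_on \<Omega>)" using meas_M[OF bs] by measurable
    have "(M bs x)\<^sup>2 \<le> 2 * (G bs x)\<^sup>2 + 2 * F x" for x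
    proof -
      have "(a + b)\<^sup>2 \<le> 2 * a\<^sup>2 + 2 * b\<^sup>2" for a b :: real
        using zero_le_power2[of "a - b"] by (simp add: power2_eq_square algebra_simps)
      from this[of "\<bar>G bs x\<bar>" "sqrt (F x)"] show ?thesis using F(2) by (simp add: M_def)
    qed
    then show "AE x in lebesgue_on \<Omega>. norm ((M bs x)\<^sup>2) \<le> norm (2 * (G bs x)\<^sup>2 + 2 * F x)"
      using F(2) by (intro AE_I2) simp
  qed
  have le_1_sq: "\<bar>y\<bar> \<le> 1 + y\<^sup>2" for y :: real
    using zero_le_power2[of "\<bar>y\<bar> - 1"] zero_le_power2[of y] by (simp add: power2_diff)
  have M1: "integrable (lebesgue_on \<Omega>) (M bs)" if bs: "bs \<in> ?I" for bs
  proof (rule Bochner_Integration.integrable_bound)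
    show "integrable (lebesgue_on \<Omega>) (\<lambda>x. 1 + (M bs x)\<^sup>2)" using M2[OF bs] by simp
    show "AE x in lebesgue_on \<Omega>. norm (M bs x) \<le> norm (1 + (M bs x)\<^sup>2)"
      using le_1_sq by (intro AE_I2) (simp add: add_nonneg_nonneg)
  qed (rule meas_M[OF bs])
  have limZ: "AE x in lebesgue_on \<Omega>. \<forall>bs\<in>?I. (\<lambda>n. grad_data \<phi> (\<zeta> n) x bs) \<longlonglongrightarrow> G bs x"
    using lim unfolding G_def by eventually_elim (intro ballI tendsto_add tendsto_const, blast)
  have domZ0: "AE x in lebesgue_on \<Omega>. \<forall>n. \<forall>bs\<in>?I. \<bar>grad_data \<phi> (\<zeta> n) x bs - G bs x\<bar> \<le> sqrt (F x)"
    using dom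
  proof eventually_elim
    case (elim x)
    show ?case
    proof (intro allI ballI)
      fix n bs assume "bs \<in> ?I"
      then have "(g bs x - partials bs (\<zeta> n) x)\<^sup>2 \<le> F x" using elim by blast
      then have "\<bar>g bs x - partials bs (\<zeta> n) x\<bar> \<le> sqrt (F x)" by (metis real_sqrt_le_mono real_sqrt_abs)
      then show "\<bar>grad_data \<phi> (\<zeta> n) x bs - G bs x\<bar> \<le> sqrt (F x)" by (simp add: G_def abs_minus_commute)
    qed
  qed
  then have domZ: "AE x in lebesgue_on \<Omega>. \<forall>n. \<forall>bs\<in>?I. \<bar>grad_data \<phi> (\<zeta> n) x bs\<bar> \<le> M bs x"
  proof eventually_elim
    case (elim x)
    show ?case
    proof (intro allI ballI)
      fix n bs assume "bs \<in> ?I"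
      then have "\<bar>grad_data \<phi> (\<zeta> n) x bs - G bs x\<bar> \<le> sqrt (F x)" using elim by blast
      then show "\<bar>grad_data \<phi> (\<zeta> n) x bs\<bar> \<le> M bs x" unfolding M_def by linarith
    qed
  qed
  have weakv: "is_weak_deriv \<Omega> bs v (G bs)" if bs: "bs \<in> ?I" for bs
  proof -
    have "is_weak_deriv \<Omega> bs w (g bs)" using g bs by blast
    from is_weak_deriv_add[OF \<Omega>(1) I(1)[OF bs] is_weak_deriv_classical[OF \<Omega>(1) \<phi>2 bs] this]
    show ?thesis by (simp add: w_def G_def[abs_def])
  qed
  note gr = C2_graph_pair.axioms(1)[OF C2_graph_pair_test[OF \<Omega> \<phi>2 spec[OF \<zeta>] B[rule_format]]]
  note cf = multi_indices_2_real2
  have area_fn_ne: "area_fn a b \<noteq> 0" for a b using area_fn_pos[of a b] by simp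
  have lim_area_fn: "(\<lambda>n. area_fn (a n) (b n)) \<longlonglongrightarrow> area_fn a0 b0" if "a \<longlonglongrightarrow> a0" "b \<longlonglongrightarrow> b0" for a b a0 b0
    unfolding area_fn_def using that by (intro tendsto_intros)
  \<comment> \<open>Stated for a pair of directions \<open>i\<close>, \<open>j\<close> so that one
    proof serves both coordinates; the mixed derivative is written \<open>[E1, E2]\<close> in either
    case.\<close>
  have flux: "is_weak_deriv \<Omega> [i] (\<lambda>x. G [i] x / area_fn (G [i] x) (G [j] x)) (\<lambda>x. flux (G [i] x) (G [j] x) (G [i, i] x) (G [E1, E2] x))"
    if ij: "[i] \<in> ?I" "[j] \<in> ?I" "[i, i] \<in> ?I"
      and D: "\<And>n x. x \<in> \<Omega> \<Longrightarrow> \<exists>F'. ((\<lambda>x. grad_data \<phi> (\<zeta> n) x [i] / area_fn (grad_data \<phi> (\<zeta> n) x [i]) (grad_data \<phi> (\<zeta> n) x [j])) has_derivative F') (at x)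
        \<and> F' i = flux (grad_data \<phi> (\<zeta> n) x [i]) (grad_data \<phi> (\<zeta> n) x [j]) (grad_data \<phi> (\<zeta> n) x [i, i]) (grad_data \<phi> (\<zeta> n) x [E1, E2])"
      and c: "\<And>n. continuous_on \<Omega> (\<lambda>x. flux (grad_data \<phi> (\<zeta> n) x [i]) (grad_data \<phi> (\<zeta> n) x [j]) (grad_data \<phi> (\<zeta> n) x [i, i]) (grad_data \<phi> (\<zeta> n) x [E1, E2]))"
    for i j
  proof (rule is_weak_deriv_limit[OF \<Omega> _ D c])
    show "i \<in> Basis" using I(1)[OF ij(1)] by simp
    have [measurable]: "(\<lambda>x. area_fn (G [i] x) (G [j] x)) \<in> borel_measurable (lebesgue_on \<Omega>)"
      unfolding area_fn_def using meas_G[OF ij(1)] meas_G[OF ij(2)] by measurable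
    show "(\<lambda>x. G [i] x / area_fn (G [i] x) (G [j] x)) \<in> borel_measurable (lebesgue_on \<Omega>)"
      using meas_G[OF ij(1)] by measurable
    show "(\<lambda>x. flux (G [i] x) (G [j] x) (G [i, i] x) (G [E1, E2] x)) \<in> borel_measurable (lebesgue_on \<Omega>)"
      unfolding flux_def using meas_G[OF ij(1)] meas_G[OF ij(2)] meas_G[OF ij(3)] meas_G[OF cf(5)] by measurable
    show "AE x in lebesgue_on \<Omega>. (\<lambda>n. grad_data \<phi> (\<zeta> n) x [i] / area_fn (grad_data \<phi> (\<zeta> n) x [i]) (grad_data \<phi> (\<zeta> n) x [j]))
        \<longlonglongrightarrow> G [i] x / area_fn (G [i] x) (G [j] x)"
      using limZ by eventually_elim (use ij area_fn_ne in \<open>intro tendsto_divide lim_area_fn; blast\<close>)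
    show "AE x in lebesgue_on \<Omega>. (\<lambda>n. flux (grad_data \<phi> (\<zeta> n) x [i]) (grad_data \<phi> (\<zeta> n) x [j]) (grad_data \<phi> (\<zeta> n) x [i, i]) (grad_data \<phi> (\<zeta> n) x [E1, E2]))
        \<longlonglongrightarrow> flux (G [i] x) (G [j] x) (G [i, i] x) (G [E1, E2] x)"
      using limZ unfolding flux_def
      by eventually_elim (use ij cf area_fn_ne in \<open>intro tendsto_divide tendsto_diff tendsto_mult tendsto_add tendsto_power lim_area_fn power_not_zero; blast\<close>)
    show "\<bar>grad_data \<phi> (\<zeta> n) x [i] / area_fn (grad_data \<phi> (\<zeta> n) x [i]) (grad_data \<phi> (\<zeta> n) x [j])\<bar> \<le> 1" for n x
      by (rule abs_div_area_fn_le_1)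
    show "integrable (lebesgue_on \<Omega>) (\<lambda>x. 2 * M [i, i] x + 2 * M [E1, E2] x)"
      using M1[OF ij(3)] M1[OF cf(5)] by simp
    show "AE x in lebesgue_on \<Omega>. \<forall>n. \<bar>flux (grad_data \<phi> (\<zeta> n) x [i]) (grad_data \<phi> (\<zeta> n) x [j]) (grad_data \<phi> (\<zeta> n) x [i, i]) (grad_data \<phi> (\<zeta> n) x [E1, E2])\<bar>
        \<le> 2 * M [i, i] x + 2 * M [E1, E2] x"
      using domZ
    proof eventually_elim
      case (elim x)
      show ?case
      proof
        fix n
        have "\<bar>grad_data \<phi> (\<zeta> n) x [i, i]\<bar> \<le> M [i, i] x" "\<bar>grad_data \<phi> (\<zeta> n) x [E1, E2]\<bar> \<le> M [E1, E2] x"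
          using elim ij cf by blast+
        then show "\<bar>flux (grad_data \<phi> (\<zeta> n) x [i]) (grad_data \<phi> (\<zeta> n) x [j]) (grad_data \<phi> (\<zeta> n) x [i, i]) (grad_data \<phi> (\<zeta> n) x [E1, E2])\<bar>
          \<le> 2 * M [i, i] x + 2 * M [E1, E2] x"
          by (intro order_trans[OF flux_le] add_mono mult_left_mono) auto
      qed
    qed
  qed
  note f1 = flux[OF cf(2,3,4) C2_graph.deriv_flux(1)[OF gr] C2_graph.cont_flux(1)[OF gr]]
  note f2 = flux[OF cf(3,2,6) C2_graph.deriv_flux(2)[OF gr] C2_graph.cont_flux(2)[OF gr]]
  have W_eq: "willmore \<Omega> v = 1 / 4 * (\<integral>\<^sup>+x. ennreal (willmore_density (\<lambda>bs. G bs x)) \<partial>lebesgue_on \<Omega>)"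
    by (rule willmore_eq[OF \<Omega>(1) weakv f1 f2]) (simp add: multi_indices_def)
  let ?m = "\<lambda>x. 12 * ((M [E1, E1] x)\<^sup>2 + (M [E1, E2] x)\<^sup>2 + (M [E2, E2] x)\<^sup>2)"
  have int_m: "integrable (lebesgue_on \<Omega>) ?m"
    using M2[OF cf(4)] M2[OF cf(5)] M2[OF cf(6)] by simp
  have measD: "(\<lambda>x. willmore_density (\<lambda>bs. D bs x)) \<in> borel_measurable (lebesgue_on \<Omega>)"
    if "\<And>bs. bs \<in> ?I \<Longrightarrow> D bs \<in> borel_measurable (lebesgue_on \<Omega>)" for D
    unfolding willmore_density_def mean_curv_def area_fn_def
    using that[OF cf(2)] that[OF cf(3)] that[OF cf(4)] that[OF cf(5)] that[OF cf(6)] by measurable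
  have meas_Z: "(\<lambda>x. grad_data \<phi> (\<zeta> n) x bs) \<in> borel_measurable (lebesgue_on \<Omega>)" if "bs \<in> ?I" for n bs
  proof (rule borel_measurable_add[OF measphi[OF that]])
    show "partials bs (\<zeta> n) \<in> borel_measurable (lebesgue_on \<Omega>)"
      using integrable_partials_test(1)[OF \<Omega> spec[OF \<zeta>] I(1)[OF that]] by (rule borel_measurable_integrable)
  qed
  have limD: "AE x in lebesgue_on \<Omega>. (\<lambda>n. willmore_density (grad_data \<phi> (\<zeta> n) x)) \<longlonglongrightarrow> willmore_density (\<lambda>bs. G bs x)"
    using limZ by eventually_elim (intro tendsto_willmore_density, blast)
  have domD: "AE x in lebesgue_on \<Omega>. norm (willmore_density (grad_data \<phi> (\<zeta> n) x)) \<le> ?m x" for n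
    using domZ
  proof eventually_elim
    case (elim x)
    have "willmore_density (grad_data \<phi> (\<zeta> n) x) \<le> ?m x"
      by (rule willmore_density_le; use elim cf in blast)
    then show ?case using willmore_density_nonneg[of "grad_data \<phi> (\<zeta> n) x"] by simp
  qed
  note dct = measD[OF meas_G] measD[OF meas_Z] int_m limD domD
  have int_D: "integrable (lebesgue_on \<Omega>) (\<lambda>x. willmore_density (\<lambda>bs. G bs x))"
    by (rule integrable_dominated_convergence[OF dct])
  have conv_D: "(\<lambda>n. \<integral>x. willmore_density (grad_data \<phi> (\<zeta> n) x) \<partial>lebesgue_on \<Omega>)
      \<longlonglongrightarrow> (\<integral>x. willmore_density (\<lambda>bs. G bs x) \<partial>lebesgue_on \<Omega>)"
    by (rule integral_dominated_convergence[OF dct])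
  have int_sqrtF: "integrable (lebesgue_on \<Omega>) (\<lambda>x. sqrt (F x))"
  proof (rule Bochner_Integration.integrable_bound[OF _ sqrtF])
    show "integrable (lebesgue_on \<Omega>) (\<lambda>x. 1 + F x)" using F(1) by simp
    show "AE x in lebesgue_on \<Omega>. norm (sqrt (F x)) \<le> norm (1 + F x)"
      using le_1_sq[of "sqrt (F _)"] F(2) by (intro AE_I2) (simp add: add_nonneg_nonneg)
  qed
  have meas_diff: "(\<lambda>x. \<bar>grad_data \<phi> (\<zeta> n) x [] - G [] x\<bar>) \<in> borel_measurable (lebesgue_on \<Omega>)" for n
    using meas_Z[OF cf(1), of n] meas_G[OF cf(1)] by measurable
  have dom_diff: "AE x in lebesgue_on \<Omega>. norm \<bar>grad_data \<phi> (\<zeta> n) x [] - G [] x\<bar> \<le> sqrt (F x)" for n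
    using domZ0
  proof eventually_elim
    case (elim x)
    from elim[rule_format, OF cf(1), of n] show ?case by simp
  qed
  have lim_diff: "AE x in lebesgue_on \<Omega>. (\<lambda>n. \<bar>grad_data \<phi> (\<zeta> n) x [] - G [] x\<bar>) \<longlonglongrightarrow> 0"
    using limZ
  proof eventually_elim
    case (elim x)
    then have "(\<lambda>n. grad_data \<phi> (\<zeta> n) x []) \<longlonglongrightarrow> G [] x" using cf(1) by blast
    from tendsto_diff[OF this tendsto_const[of "G [] x"]] show ?case by (intro tendsto_rabs_zero) simp
  qed
  have conv_diff: "(\<lambda>n. \<integral>x. \<bar>grad_data \<phi> (\<zeta> n) x [] - G [] x\<bar> \<partial>lebesgue_on \<Omega>) \<longlonglongrightarrow> (\<integral>x. 0 \<partial>lebesgue_on \<Omega>)"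
    by (rule integral_dominated_convergence[OF _ meas_diff int_sqrtF lim_diff dom_diff]) simp
  then have "\<forall>\<^sub>F n in sequentially. (\<integral>x. \<bar>grad_data \<phi> (\<zeta> n) x [] - G [] x\<bar> \<partial>lebesgue_on \<Omega>) < \<epsilon>"
    by (rule order_tendstoD) (use \<epsilon> in simp)
  moreover have "\<forall>\<^sub>F n in sequentially. (\<integral>x. willmore_density (grad_data \<phi> (\<zeta> n) x) \<partial>lebesgue_on \<Omega>)
      < (\<integral>x. willmore_density (\<lambda>bs. G bs x) \<partial>lebesgue_on \<Omega>) + \<epsilon>"
    by (rule order_tendstoD(2)[OF conv_D]) (use \<epsilon> in simp)
  ultimately have "\<forall>\<^sub>F n in sequentially. (\<integral>x. \<bar>grad_data \<phi> (\<zeta> n) x [] - G [] x\<bar> \<partial>lebesgue_on \<Omega>) < \<epsilon>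
      \<and> (\<integral>x. willmore_density (grad_data \<phi> (\<zeta> n) x) \<partial>lebesgue_on \<Omega>)
      < (\<integral>x. willmore_density (\<lambda>bs. G bs x) \<partial>lebesgue_on \<Omega>) + \<epsilon>" by (rule eventually_conj)
  then obtain n where n: "(\<integral>x. \<bar>grad_data \<phi> (\<zeta> n) x [] - G [] x\<bar> \<partial>lebesgue_on \<Omega>) < \<epsilon>"
    "(\<integral>x. willmore_density (grad_data \<phi> (\<zeta> n) x) \<partial>lebesgue_on \<Omega>)
      < (\<integral>x. willmore_density (\<lambda>bs. G bs x) \<partial>lebesgue_on \<Omega>) + \<epsilon>"
    by (auto simp: eventually_sequentially)
  show ?thesis
  proof (intro bexI[of _ "\<zeta> n"] conjI)
    show "\<zeta> n \<in> test_functions \<Omega>" using \<zeta> by blast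
    \<comment> \<open>For the empty list a weak derivative is the function itself up to null sets,
      so \<open>v\<close> and \<open>G []\<close> agree almost everywhere.\<close>
    have "is_weak_deriv \<Omega> [] v v"
      using weakv[OF cf(1)] by (simp add: is_weak_deriv_def)
    from is_weak_deriv_unique[OF \<Omega>(1) weakv[OF cf(1)] this]
    have "AE x in lebesgue_on \<Omega>. ennreal \<bar>\<phi> x + \<zeta> n x - v x\<bar> = ennreal \<bar>grad_data \<phi> (\<zeta> n) x [] - G [] x\<bar>"
      by eventually_elim simp
    then have "(\<integral>\<^sup>+x. ennreal \<bar>\<phi> x + \<zeta> n x - v x\<bar> \<partial>lebesgue_on \<Omega>)
        = (\<integral>\<^sup>+x. ennreal \<bar>grad_data \<phi> (\<zeta> n) x [] - G [] x\<bar> \<partial>lebesgue_on \<Omega>)"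
      by (rule nn_integral_cong_AE)
    also have "\<dots> = ennreal (\<integral>x. \<bar>grad_data \<phi> (\<zeta> n) x [] - G [] x\<bar> \<partial>lebesgue_on \<Omega>)"
    proof (rule nn_integral_eq_integral)
      show "integrable (lebesgue_on \<Omega>) (\<lambda>x. \<bar>grad_data \<phi> (\<zeta> n) x [] - G [] x\<bar>)"
        by (rule Bochner_Integration.integrable_bound[OF int_sqrtF meas_diff])
           (use dom_diff[of n] in eventually_elim, simp)
    qed simp
    also have "\<dots> \<le> ennreal \<epsilon>" using n(1) by (intro ennreal_leI) simp
    finally show "(\<integral>\<^sup>+x. ennreal \<bar>\<phi> x + \<zeta> n x - v x\<bar> \<partial>lebesgue_on \<Omega>) \<le> ennreal \<epsilon>" .
    have "(4::ennreal) * (1 / 4) = 1"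
      by (simp add: ennreal_times_divide ennreal_divide_self)
    then have "4 * willmore \<Omega> v = (\<integral>\<^sup>+x. ennreal (willmore_density (\<lambda>bs. G bs x)) \<partial>lebesgue_on \<Omega>)"
      unfolding W_eq by (simp only: mult.assoc[symmetric] mult_1_left)
    also have "\<dots> = ennreal (\<integral>x. willmore_density (\<lambda>bs. G bs x) \<partial>lebesgue_on \<Omega>)"
      by (rule nn_integral_eq_integral[OF int_D]) (simp add: willmore_density_nonneg)
    finally have "4 * willmore \<Omega> v + ennreal \<epsilon> = ennreal ((\<integral>x. willmore_density (\<lambda>bs. G bs x) \<partial>lebesgue_on \<Omega>) + \<epsilon>)"
      using \<epsilon> willmore_density_nonneg by (simp add: ennreal_plus integral_nonneg_AE)
    then show "ennreal (\<integral>x. willmore_density (grad_data \<phi> (\<zeta> n) x) \<partial>lebesgue_on \<Omega>) \<le> 4 * willmore \<Omega> v + ennreal \<epsilon>"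
      using n(2) by (simp only:) (intro ennreal_leI less_imp_le)
  qed
qed

subsection \<open>Compactness in \<open>L\<^sup>1\<close>\<close>

definition hat :: "real \<Rightarrow> 'a::euclidean_space \<Rightarrow> real" where
  "hat \<delta> h = max 0 (\<delta> - norm h)"

lemma hat_props:
  fixes h h' :: "'a::euclidean_space"
  shows "0 \<le> hat \<delta> h" "norm h \<ge> \<delta> \<Longrightarrow> hat \<delta> h = 0" "\<bar>hat \<delta> h - hat \<delta> h'\<bar> \<le> norm (h - h')"
    "continuous_on UNIV (hat \<delta> :: 'a \<Rightarrow> real)"
proof -
  show "\<bar>hat \<delta> h - hat \<delta> h'\<bar> \<le> norm (h - h')"
    using norm_triangle_ineq3[of h h'] by (auto simp: hat_def max_def)
  show "continuous_on UNIV (hat \<delta> :: 'a \<Rightarrow> real)"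
    unfolding hat_def by (intro continuous_intros)
qed (auto simp: hat_def)

lemma integrable_hat: "integrable lborel (hat \<delta> :: 'a::euclidean_space \<Rightarrow> real)"
  by (rule integrable_continuous_compact_support[OF hat_props(4) compact_cball[of 0 \<delta>]])
     (auto intro: hat_props(2))

lemma integral_hat_pos:
  assumes "\<delta> > 0"
  shows "0 < (\<integral>h. hat \<delta> (h :: 'a::euclidean_space) \<partial>lborel)"
proof -
  let ?b = "ball 0 (\<delta> / 2) :: 'a set"
  have fin: "emeasure lborel ?b < \<infinity>" by (rule emeasure_bounded_finite) simp
  have int: "integrable lborel (\<lambda>h. \<delta> / 2 * indicator ?b h)"
    using fin by (intro integrable_mult_right integrable_real_indicator) auto
  have "0 < \<delta> / 2 * measure lborel ?b"
    using assms content_ball_pos[of "\<delta> / 2" "0 :: 'a"] by simp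
  also have "\<dots> = (\<integral>h. \<delta> / 2 * indicator ?b h \<partial>lborel)" by simp
  also have "\<dots> \<le> (\<integral>h. hat \<delta> (h :: 'a) \<partial>lborel)"
    by (intro integral_mono[OF int integrable_hat]) (auto simp: hat_def indicator_def max_def)
  finally show ?thesis .
qed

text \<open>The kernel is only Lipschitz, which suffices for equicontinuity.\<close>

definition mollify :: "real \<Rightarrow> ('a::euclidean_space \<Rightarrow> real) \<Rightarrow> 'a \<Rightarrow> real" where
  "mollify \<delta> f x = (\<integral>h. hat \<delta> h * f (x + h) \<partial>lborel) / (\<integral>h. hat \<delta> (h :: 'a) \<partial>lborel)"

text \<open>Averaging against a probability density keeps bounds, has a Lipschitz constant that
  involves \<open>f\<close> only through its \<open>L1\<close> norm, and by Tonelli has an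
  \<open>L1\<close> error that averages the translation errors over shifts of length at most
  \<open>\<delta>\<close>.\<close>

lemma mollify_facts:
  fixes f :: "'a::euclidean_space \<Rightarrow> real"
  assumes \<delta>: "\<delta> > 0" and f: "continuous_on UNIV f" and K: "compact K" "\<And>x. x \<notin> K \<Longrightarrow> f x = 0"
    and C: "\<And>x. \<bar>f x\<bar> \<le> C"
  shows "\<bar>mollify \<delta> f x\<bar> \<le> C"
    and "\<bar>mollify \<delta> f x - mollify \<delta> f y\<bar> \<le> norm (x - y) * (\<integral>x. \<bar>f x\<bar> \<partial>lborel) / (\<integral>h. hat \<delta> (h :: 'a) \<partial>lborel)"
    and "(\<And>h. norm h \<le> \<delta> \<Longrightarrow> (\<integral>x. \<bar>f (h + x) - f x\<bar> \<partial>lborel) \<le> A) \<Longrightarrow> (\<integral>\<^sup>+x. ennreal \<bar>mollify \<delta> f x - f x\<bar> \<partial>lborel) \<le> ennreal A"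
proof -
  define c where "c = (\<integral>h. hat \<delta> (h :: 'a) \<partial>lborel)"
  have c: "c > 0" unfolding c_def by (rule integral_hat_pos[OF \<delta>])
  have [measurable]: "f \<in> borel_measurable borel" "hat \<delta> \<in> borel_measurable (borel :: 'a measure)"
    using f hat_props(4) by (auto intro: borel_measurable_continuous_onI)
  have intf: "integrable lborel f" by (rule integrable_continuous_compact_support[OF f K])
  have contfs: "continuous_on UNIV (\<lambda>h. f (x + h))" for x
    by (rule continuous_on_compose2[OF f]) (auto intro!: continuous_intros)
  have int: "integrable lborel (\<lambda>h. hat \<delta> h * f (x + h))" for x
    by (rule integrable_continuous_compact_support[OF _ compact_cball[of 0 \<delta>]])
       (auto intro!: continuous_intros hat_props contfs)
  show "\<bar>mollify \<delta> f x\<bar> \<le> C"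
  proof -
    have "\<bar>\<integral>h. hat \<delta> h * f (x + h) \<partial>lborel\<bar> \<le> (\<integral>h. \<bar>hat \<delta> h * f (x + h)\<bar> \<partial>lborel)"
      by (rule integral_abs_bound)
    also have "\<dots> \<le> (\<integral>h. hat \<delta> (h :: 'a) * C \<partial>lborel)"
    proof (rule integral_mono)
      show "\<bar>hat \<delta> h * f (x + h)\<bar> \<le> hat \<delta> h * C" for h
        unfolding abs_mult using hat_props(1)[of \<delta> h] C by (intro mult_mono) auto
    qed (intro integrable_abs int integrable_mult_left integrable_hat)+
    also have "\<dots> = c * C" by (simp add: c_def)
    finally show ?thesis
      unfolding mollify_def c_def[symmetric] using c by (simp add: abs_divide field_simps)
  qed
  show "\<bar>mollify \<delta> f x - mollify \<delta> f y\<bar> \<le> norm (x - y) * (\<integral>x. \<bar>f x\<bar> \<partial>lborel) / (\<integral>h. hat \<delta> (h :: 'a) \<partial>lborel)"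
  proof -
    \<comment> \<open>After the substitution only the weight depends on \<open>x\<close>, so the
      Lipschitz bound of \<open>hat\<close> carries over.\<close>
    have shift: "(\<integral>h. hat \<delta> h * f (x + h) \<partial>lborel) = (\<integral>y. hat \<delta> (y - x) * f y \<partial>lborel)" for x
      using integral_lborel_shift[of "\<lambda>h. hat \<delta> h * f (x + h)" "- x"] by simp
    have int': "integrable lborel (\<lambda>y. hat \<delta> (y - x) * f y)" for x
      using integrable_lborel_shift[OF int[of x], of "- x"] by simp
    have "\<bar>(\<integral>h. hat \<delta> h * f (x + h) \<partial>lborel) - (\<integral>h. hat \<delta> h * f (y + h) \<partial>lborel)\<bar>
        = \<bar>\<integral>u. hat \<delta> (u - x) * f u - hat \<delta> (u - y) * f u \<partial>lborel\<bar>"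
      unfolding shift by (simp add: int')
    also have "\<dots> \<le> (\<integral>u. \<bar>hat \<delta> (u - x) * f u - hat \<delta> (u - y) * f u\<bar> \<partial>lborel)"
      by (rule integral_abs_bound)
    also have "\<dots> \<le> (\<integral>u. norm (x - y) * \<bar>f u\<bar> \<partial>lborel)"
    proof (rule integral_mono)
      show "\<bar>hat \<delta> (u - x) * f u - hat \<delta> (u - y) * f u\<bar> \<le> norm (x - y) * \<bar>f u\<bar>" for u
        unfolding left_diff_distrib[symmetric] abs_mult
        using hat_props(3)[of \<delta> "u - x" "u - y"] by (intro mult_right_mono) (auto simp: norm_minus_commute)
    qed (intro integrable_abs Bochner_Integration.integrable_diff int' integrable_mult_right intf)+
    also have "\<dots> = norm (x - y) * (\<integral>x. \<bar>f x\<bar> \<partial>lborel)" by simp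
    finally show ?thesis
      unfolding mollify_def c_def[symmetric] diff_divide_distrib[symmetric] abs_divide
      using c by (simp add: divide_right_mono)
  qed
  assume A: "\<And>h. norm h \<le> \<delta> \<Longrightarrow> (\<integral>x. \<bar>f (h + x) - f x\<bar> \<partial>lborel) \<le> A"
  have pt: "ennreal \<bar>mollify \<delta> f x - f x\<bar> \<le> (\<integral>\<^sup>+h. ennreal (hat \<delta> h / c * \<bar>f (h + x) - f x\<bar>) \<partial>lborel)" for x
  proof -
    have i1: "integrable lborel (\<lambda>h. hat \<delta> h * f (x + h) - hat \<delta> h * f x)"
      by (intro Bochner_Integration.integrable_diff int integrable_mult_left integrable_hat)
    have eq: "mollify \<delta> f x - f x = (\<integral>h. hat \<delta> h * f (x + h) - hat \<delta> h * f x \<partial>lborel) / c"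
      using c int[of x] integrable_hat[of \<delta>, where 'a='a]
      by (simp add: mollify_def c_def[symmetric] diff_divide_distrib)
    have "\<bar>mollify \<delta> f x - f x\<bar> \<le> (\<integral>h. \<bar>hat \<delta> h * f (x + h) - hat \<delta> h * f x\<bar> \<partial>lborel) / c"
      unfolding eq abs_divide using c by (simp add: divide_right_mono)
    also have "\<dots> = (\<integral>h. hat \<delta> h / c * \<bar>f (h + x) - f x\<bar> \<partial>lborel)"
      unfolding right_diff_distrib[symmetric] abs_mult
      by (simp add: abs_of_nonneg[OF hat_props(1)] add.commute)
    finally have "ennreal \<bar>mollify \<delta> f x - f x\<bar> \<le> ennreal (\<integral>h. hat \<delta> h / c * \<bar>f (h + x) - f x\<bar> \<partial>lborel)"
      by (rule ennreal_leI)
    also have "\<dots> = (\<integral>\<^sup>+h. ennreal (hat \<delta> h / c * \<bar>f (h + x) - f x\<bar>) \<partial>lborel)"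
    proof (rule nn_integral_eq_integral[symmetric])
      have "integrable lborel (\<lambda>h. \<bar>hat \<delta> h * f (x + h) - hat \<delta> h * f x\<bar> / c)"
        using i1 by simp
      then show "integrable lborel (\<lambda>h. hat \<delta> h / c * \<bar>f (h + x) - f x\<bar>)"
        unfolding right_diff_distrib[symmetric] abs_mult by (simp add: abs_of_nonneg[OF hat_props(1)] add.commute)
      show "AE h in lborel. 0 \<le> hat \<delta> h / c * \<bar>f (h + x) - f x\<bar>"
        using c by (intro AE_I2 mult_nonneg_nonneg divide_nonneg_pos hat_props abs_ge_zero)
    qed
    finally show ?thesis .
  qed
  have m2: "(\<lambda>(x, h). ennreal (hat \<delta> h / c * \<bar>f (h + x) - f x\<bar>)) \<in> borel_measurable (lborel \<Otimes>\<^sub>M lborel)"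
    by measurable
  have "(\<integral>\<^sup>+x. ennreal \<bar>mollify \<delta> f x - f x\<bar> \<partial>lborel)
      \<le> (\<integral>\<^sup>+x. (\<integral>\<^sup>+h. ennreal (hat \<delta> h / c * \<bar>f (h + x) - f x\<bar>) \<partial>lborel) \<partial>lborel)"
    by (intro nn_integral_mono pt)
  also have "\<dots> = (\<integral>\<^sup>+h. (\<integral>\<^sup>+x. ennreal (hat \<delta> h / c * \<bar>f (h + x) - f x\<bar>) \<partial>lborel) \<partial>lborel)"
    by (rule lborel_pair.Fubini'[OF m2, symmetric])
  also have "\<dots> \<le> (\<integral>\<^sup>+h. ennreal (hat \<delta> (h :: 'a) / c) * ennreal A \<partial>lborel)"
  proof (rule nn_integral_mono)
    fix h :: 'a
    have "(\<integral>\<^sup>+x. ennreal (hat \<delta> h / c * \<bar>f (h + x) - f x\<bar>) \<partial>lborel)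
        = ennreal (hat \<delta> h / c) * (\<integral>\<^sup>+x. ennreal \<bar>f (h + x) - f x\<bar> \<partial>lborel)"
    proof -
      have "ennreal (hat \<delta> h / c * y) = ennreal (hat \<delta> h / c) * ennreal y" if "y \<ge> 0" for y
        using hat_props(1)[of \<delta> h] c that by (intro ennreal_mult) auto
      then have "(\<lambda>x. ennreal (hat \<delta> h / c * \<bar>f (h + x) - f x\<bar>)) = (\<lambda>x. ennreal (hat \<delta> h / c) * ennreal \<bar>f (h + x) - f x\<bar>)"
        by (intro ext) simp
      then show ?thesis by (simp only:) (rule nn_integral_cmult, measurable)
    qed
    also have "(\<integral>\<^sup>+x. ennreal \<bar>f (h + x) - f x\<bar> \<partial>lborel) = ennreal (\<integral>x. \<bar>f (h + x) - f x\<bar> \<partial>lborel)"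
      by (intro nn_integral_eq_integral integrable_abs Bochner_Integration.integrable_diff integrable_lborel_shift intf) auto
    also have "ennreal (hat \<delta> h / c) * ennreal (\<integral>x. \<bar>f (h + x) - f x\<bar> \<partial>lborel) \<le> ennreal (hat \<delta> h / c) * ennreal A"
    \<comment> \<open>Longer shifts carry weight 0, so the bound \<open>A\<close> is used only where
      it is assumed.\<close>
    proof (cases "norm h \<le> \<delta>")
      case True
      then show ?thesis by (intro mult_left_mono ennreal_leI A) auto
    next
      case False
      then have "hat \<delta> h = 0" by (intro hat_props(2)) auto
      then show ?thesis by simp
    qed
    finally show "(\<integral>\<^sup>+x. ennreal (hat \<delta> h / c * \<bar>f (h + x) - f x\<bar>) \<partial>lborel) \<le> ennreal (hat \<delta> h / c) * ennreal A" .
  qed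
  also have "\<dots> = (\<integral>\<^sup>+h. ennreal (hat \<delta> (h :: 'a) / c) \<partial>lborel) * ennreal A"
    by (rule nn_integral_multc) measurable
  also have "(\<integral>\<^sup>+h. ennreal (hat \<delta> (h :: 'a) / c) \<partial>lborel) = ennreal (\<integral>h. hat \<delta> (h :: 'a) / c \<partial>lborel)"
    using c by (intro nn_integral_eq_integral AE_I2 divide_nonneg_pos hat_props(1)) (simp_all add: integrable_hat)
  also have "(\<integral>h. hat \<delta> (h :: 'a) / c \<partial>lborel) = 1"
    using c by (simp add: c_def)
  finally show "(\<integral>\<^sup>+x. ennreal \<bar>mollify \<delta> f x - f x\<bar> \<partial>lborel) \<le> ennreal A" by simp
qed

lemma mollify_eq_0:
  fixes f :: "'a::euclidean_space \<Rightarrow> real"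
  assumes "\<And>h. norm h < \<delta> \<Longrightarrow> f (x + h) = 0"
  shows "mollify \<delta> f x = 0"
proof -
  have "hat \<delta> h * f (x + h) = 0" for h
    using assms[of h] hat_props(2)[of \<delta> h] by (cases "norm h < \<delta>") auto
  then have "(\<lambda>h. hat \<delta> h * f (x + h)) = (\<lambda>_. 0)" by (rule ext)
  then show ?thesis unfolding mollify_def by (simp only: Bochner_Integration.integral_zero div_0)
qed

text \<open>The argument of Kolmogorov and Riesz. At each scale the mollified functions are bounded
  and equi-Lipschitz, so a subsequence converges pointwise; the mollification error is at most
  \<open>A * \<delta> m\<close> uniformly in \<open>k\<close>, which makes the subsequence Cauchy in
  \<open>L1\<close>.\<close>

lemma L1_compactness:
  fixes f :: "nat \<Rightarrow> 'a::euclidean_space \<Rightarrow> real"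
  assumes cont: "\<And>k. continuous_on UNIV (f k)" and K: "compact K" "\<And>k x. x \<notin> K \<Longrightarrow> f k x = 0"
    and C: "\<And>k x. \<bar>f k x\<bar> \<le> C" and A: "A \<ge> 0" "\<And>k h. (\<integral>x. \<bar>f k (h + x) - f k x\<bar> \<partial>lborel) \<le> A * norm h"
  shows "\<exists>r u. strict_mono (r :: nat \<Rightarrow> nat) \<and> u \<in> borel_measurable borel \<and> (\<forall>x. \<bar>u x\<bar> \<le> C)
    \<and> (\<lambda>k. \<integral>\<^sup>+x. ennreal \<bar>f (r k) x - u x\<bar> \<partial>lborel) \<longlonglongrightarrow> 0"
proof -
  have C0: "C \<ge> 0" using C[of 0 0] by linarith
  have intf: "integrable lborel (f k)" for k
    by (rule integrable_continuous_compact_support[OF cont K])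
  have Kfin: "emeasure lborel K < \<infinity>" and Ks: "K \<in> sets borel"
    using emeasure_bounded_finite[OF compact_imp_bounded[OF K(1)]] K(1) by (auto simp: compact_imp_closed)
  have intC: "integrable lborel (\<lambda>x. c * indicator K x)" for c :: real
    using Kfin Ks by (intro integrable_mult_right integrable_real_indicator) auto
  define L where "L = (\<integral>x. C * indicator K x \<partial>lborel)"
  have L: "(\<integral>x. \<bar>f k x\<bar> \<partial>lborel) \<le> L" for k
    unfolding L_def
  proof (rule integral_mono)
    show "\<bar>f k x\<bar> \<le> C * indicator K x" for x
      using C[of k x] K(2)[of x k] by (cases "x \<in> K") auto
  qed (intro integrable_abs intf intC)+
  have L0: "L \<ge> 0" unfolding L_def using C0 by (intro integral_nonneg_AE) auto
  define \<delta> where "\<delta> m = 1 / real (Suc m)" for m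
  have \<delta>: "\<delta> m > 0" "\<delta> m \<le> 1" for m by (auto simp: \<delta>_def)
  define g where "g m k = mollify (\<delta> m) (f k)" for m k
  have gC: "\<bar>g m k x\<bar> \<le> C" for m k x
    unfolding g_def by (rule mollify_facts(1)[OF \<delta>(1) cont K C])
  define \<Lambda> where "\<Lambda> m = L / (\<integral>h. hat (\<delta> m) (h :: 'a) \<partial>lborel)" for m
  have \<Lambda>0: "\<Lambda> m \<ge> 0" for m
    unfolding \<Lambda>_def using L0 integral_hat_pos[OF \<delta>(1), where 'a='a] by (simp add: less_imp_le)
  have lip: "\<bar>g m k x - g m k y\<bar> \<le> \<Lambda> m * norm (x - y)" for m k x y
  proof -
    have "\<bar>g m k x - g m k y\<bar> \<le> norm (x - y) * (\<integral>x. \<bar>f k x\<bar> \<partial>lborel) / (\<integral>h. hat (\<delta> m) (h :: 'a) \<partial>lborel)"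
      unfolding g_def by (rule mollify_facts(2)[OF \<delta>(1) cont K C])
    also have "\<dots> \<le> norm (x - y) * L / (\<integral>h. hat (\<delta> m) (h :: 'a) \<partial>lborel)"
      using integral_hat_pos[OF \<delta>(1), where 'a='a, of m] by (intro divide_right_mono mult_left_mono L) auto
    finally show ?thesis by (simp add: \<Lambda>_def mult.commute)
  qed
  obtain R where R: "\<And>x. x \<in> K \<Longrightarrow> norm x \<le> R"
    using compact_imp_bounded[OF K(1)] by (auto simp: bounded_iff)
  have g0: "g m k x = 0" if "x \<notin> cball 0 (R + 1)" for m k x
    unfolding g_def
  proof (rule mollify_eq_0)
    fix h :: 'a assume h: "norm h < \<delta> m"
    have "norm x \<le> norm (x + h) + norm h" by (metis add_diff_cancel_right' norm_triangle_ineq4)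
    then have "norm (x + h) > R" using that h \<delta>(2)[of m] by simp
    then show "f k (x + h) = 0" using R[of "x + h"] K(2)[of "x + h" k] by fastforce
  qed
  have contg: "continuous_on UNIV (g m k)" for m k
  proof (rule lipschitz_on_continuous_on)
    show "(\<Lambda> m)-lipschitz_on UNIV (g m k)"
      using lip \<Lambda>0 by (auto simp: lipschitz_on_def dist_real_def dist_norm)
  qed
  have intg: "integrable lborel (g m k)" for m k
    by (rule integrable_continuous_compact_support[OF contg compact_cball g0])
  have [measurable]: "g m k \<in> borel_measurable borel" "f k \<in> borel_measurable borel" for m k
    using contg cont by (auto intro: borel_measurable_continuous_onI)
  have fg: "(\<integral>x. \<bar>g m k x - f k x\<bar> \<partial>lborel) \<le> A * \<delta> m" for m k
  proof -
    have "ennreal (\<integral>x. \<bar>g m k x - f k x\<bar> \<partial>lborel) = (\<integral>\<^sup>+x. ennreal \<bar>g m k x - f k x\<bar> \<partial>lborel)"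
      by (intro nn_integral_eq_integral[symmetric] integrable_abs Bochner_Integration.integrable_diff intg intf) auto
    also have "\<dots> \<le> ennreal (A * \<delta> m)"
      unfolding g_def
    proof (rule mollify_facts(3)[OF \<delta>(1) cont K C])
      show "(\<integral>x. \<bar>f k (h + x) - f k x\<bar> \<partial>lborel) \<le> A * \<delta> m" if "norm h \<le> \<delta> m" for h
        using A(2)[of k h] mult_left_mono[OF that A(1)] by linarith
    qed
    finally show ?thesis using A(1) \<delta>(1)[of m] by (subst (asm) ennreal_le_iff) auto
  qed
  obtain D :: "'a set" where D: "countable D" "\<And>X. open X \<Longrightarrow> X \<noteq> {} \<Longrightarrow> \<exists>d\<in>D. d \<in> X"
    using countable_dense_exists[where 'a='a] by blast
  \<comment> \<open>Indexing by pairs of a scale and a dense point makes one diagonal choice work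
    for all scales at once.\<close>
  have "\<exists>r. strict_mono (r :: nat \<Rightarrow> nat) \<and> (\<forall>mx\<in>UNIV \<times> D. \<exists>l. (\<lambda>n. g (fst mx) (r n) (snd mx)) \<longlonglongrightarrow> l)"
  proof (rule function_convergent_subsequence[of "UNIV \<times> D" "\<lambda>k mx. g (fst mx) k (snd mx)" C])
    show "countable ((UNIV :: nat set) \<times> D)" using D(1) by simp
    show "norm (g (fst mx) k (snd mx)) \<le> C" for k mx using gC by simp
    fix r :: "nat \<Rightarrow> nat"
    assume "strict_mono r" "\<And>mx. mx \<in> UNIV \<times> D \<Longrightarrow> \<exists>l. (\<lambda>n. g (fst mx) (r n) (snd mx)) \<longlonglongrightarrow> l"
    then show ?thesis by (intro exI[of _ r] conjI ballI)
  qed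
  then obtain r where r: "strict_mono r" "\<forall>mx\<in>UNIV \<times> D. \<exists>l. (\<lambda>n. g (fst mx) (r n) (snd mx)) \<longlonglongrightarrow> l"
    by blast
  have Cau: "Cauchy (\<lambda>n. g m (r n) x)" for m x
  proof (rule metric_CauchyI)
    fix e :: real assume e: "e > 0"
    \<comment> \<open>Within distance \<open>\<rho>\<close> the values move by at most e / 3; the
      added 1 covers a vanishing Lipschitz constant.\<close>
    define \<rho> where "\<rho> = e / (3 * (\<Lambda> m + 1))"
    have \<rho>: "\<rho> > 0" using e \<Lambda>0[of m] by (simp add: \<rho>_def)
    then obtain d where d: "d \<in> D" "d \<in> ball x \<rho>" using D(2)[of "ball x \<rho>"] by auto
    have "\<Lambda> m * norm (x - d) \<le> \<Lambda> m * \<rho>"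
      using d(2) \<Lambda>0[of m] by (intro mult_left_mono) (auto simp: dist_norm)
    also have "\<dots> \<le> (\<Lambda> m + 1) * \<rho>" using \<rho> by (simp add: distrib_right)
    also have "\<dots> = e / 3"
    proof -
      have "l * (e / (3 * l)) = e / 3" if "l > 0" for l using that by simp
      from this[of "\<Lambda> m + 1"] \<Lambda>0[of m] show ?thesis unfolding \<rho>_def by linarith
    qed
    finally have close: "\<bar>g m k x - g m k d\<bar> \<le> e / 3" for k using lip[of m k x d] by linarith
    have "\<exists>l. (\<lambda>n. g m (r n) d) \<longlonglongrightarrow> l" using bspec[OF r(2), of "(m, d)"] d(1) by simp
    then have "Cauchy (\<lambda>n. g m (r n) d)" by (auto intro: LIMSEQ_imp_Cauchy)
    from metric_CauchyD[OF this, of "e / 3"] e obtain N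
      where N: "\<forall>i\<ge>N. \<forall>j\<ge>N. dist (g m (r i) d) (g m (r j) d) < e / 3" by auto
    show "\<exists>N. \<forall>i\<ge>N. \<forall>j\<ge>N. dist (g m (r i) x) (g m (r j) x) < e"
    proof (intro exI[of _ N] allI impI)
      fix i j assume "i \<ge> N" "j \<ge> N"
      then have "\<bar>g m (r i) d - g m (r j) d\<bar> < e / 3" using N by (simp add: dist_real_def)
      then show "dist (g m (r i) x) (g m (r j) x) < e"
        using close[of "r i"] close[of "r j"] unfolding dist_real_def by linarith
    qed
  qed
  define \<gamma> where "\<gamma> m x = lim (\<lambda>n. g m (r n) x)" for m x
  have \<gamma>: "(\<lambda>n. g m (r n) x) \<longlonglongrightarrow> \<gamma> m x" for m x
    unfolding \<gamma>_def using Cauchy_convergent[OF Cau] by (simp add: convergent_LIMSEQ_iff)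
  have [measurable]: "\<gamma> m \<in> borel_measurable borel" for m
    by (rule borel_measurable_LIMSEQ_metric[OF _ \<gamma>]) measurable
  have g\<gamma>: "(\<lambda>n. \<integral>x. \<bar>g m (r n) x - \<gamma> m x\<bar> \<partial>lborel) \<longlonglongrightarrow> (integral\<^sup>L lborel (\<lambda>x::'a. 0))"
    and int\<gamma>: "integrable lborel (\<lambda>x. \<bar>g m (r n) x - \<gamma> m x\<bar>)" for m n
  proof -
    let ?w = "\<lambda>x::'a. indicator (cball 0 (R + 1)) x *\<^sub>R (2 * C)"
    have w: "integrable lborel ?w" by (intro borel_integrable_compact) auto
    have b: "norm \<bar>g m (r n) x - \<gamma> m x\<bar> \<le> ?w x" for n x
    proof (cases "x \<in> cball 0 (R + 1)")
      case False
      then have "(\<lambda>n. g m (r n) x) = (\<lambda>n. 0)" using g0 by (simp add: fun_eq_iff)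
      then have "\<gamma> m x = 0" using \<gamma>[of m x] by (simp add: LIMSEQ_const_iff)
      then show ?thesis using g0[OF False] False by simp
    next
      case True
      have "\<bar>\<gamma> m x\<bar> \<le> C" by (rule tendsto_upperbound[OF tendsto_rabs[OF \<gamma>]]) (auto simp: gC)
      then show ?thesis using True gC[of m "r n" x] by simp
    qed
    show "(\<lambda>n. \<integral>x. \<bar>g m (r n) x - \<gamma> m x\<bar> \<partial>lborel) \<longlonglongrightarrow> (integral\<^sup>L lborel (\<lambda>x::'a. 0))"
    proof (rule integral_dominated_convergence[where w = ?w])
      show "integrable lborel ?w" by (rule w)
      show "AE x in lborel. (\<lambda>n. \<bar>g m (r n) x - \<gamma> m x\<bar>) \<longlonglongrightarrow> 0"
        by (intro AE_I2 tendsto_rabs_zero LIM_zero \<gamma>)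
      show "AE x in lborel. norm \<bar>g m (r n) x - \<gamma> m x\<bar> \<le> ?w x" for n using b by (intro AE_I2)
    qed measurable
    show "integrable lborel (\<lambda>x. \<bar>g m (r n) x - \<gamma> m x\<bar>)"
    proof (rule Bochner_Integration.integrable_bound[OF w])
      show "AE x in lborel. norm \<bar>g m (r n) x - \<gamma> m x\<bar> \<le> norm (?w x)"
        unfolding real_norm_def using b by (intro AE_I2 order_trans[OF _ abs_ge_self]) simp
    qed measurable
  qed
  have L1_Cauchy: "\<exists>N. \<forall>i\<ge>N. \<forall>j\<ge>N. (\<integral>x. norm (f (r i) x - f (r j) x) \<partial>lborel) < e" if e: "e > 0" for e
  proof -
    \<comment> \<open>The scale is fixed first: two mollification errors and two distances to
      \<open>\<gamma> m\<close> make up the four quarters of \<open>e\<close>.\<close>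
    obtain m where m: "A * \<delta> m < e / 4"
    proof -
      obtain m :: nat where "4 * A / e < real m" using reals_Archimedean2 by blast
      then have "4 * A < e * real (Suc m)" using e by (simp add: field_simps)
      then have "A * \<delta> m < e / 4" by (simp add: \<delta>_def field_simps)
      then show ?thesis by (rule that)
    qed
    have "\<forall>\<^sub>F n in sequentially. (\<integral>x. \<bar>g m (r n) x - \<gamma> m x\<bar> \<partial>lborel) < e / 4"
      by (rule order_tendstoD(2)[OF g\<gamma>]) (use e in simp)
    then obtain N where N: "\<And>n. n \<ge> N \<Longrightarrow> (\<integral>x. \<bar>g m (r n) x - \<gamma> m x\<bar> \<partial>lborel) < e / 4"
      unfolding eventually_sequentially by blast
    show ?thesis
    proof (intro exI[of _ N] allI impI)
      fix i j assume ij: "i \<ge> N" "j \<ge> N"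
      let ?a = "\<lambda>i x. \<bar>g m (r i) x - f (r i) x\<bar>" and ?b = "\<lambda>i x. \<bar>g m (r i) x - \<gamma> m x\<bar>"
      have inta: "integrable lborel (?a i)" for i
        by (intro integrable_abs Bochner_Integration.integrable_diff intg intf)
      have "(\<integral>x. norm (f (r i) x - f (r j) x) \<partial>lborel) \<le> (\<integral>x. (?a i x + ?b i x) + (?a j x + ?b j x) \<partial>lborel)"
      proof (rule integral_mono)
        show "norm (f (r i) x - f (r j) x) \<le> (?a i x + ?b i x) + (?a j x + ?b j x)" for x
          unfolding real_norm_def by linarith
      qed (intro integrable_norm Bochner_Integration.integrable_diff Bochner_Integration.integrable_add inta int\<gamma> intf)+
      also have "\<dots> = (integral\<^sup>L lborel (?a i) + integral\<^sup>L lborel (?b i)) + (integral\<^sup>L lborel (?a j) + integral\<^sup>L lborel (?b j))"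
        by (simp add: inta int\<gamma> del: abs_diff_le_iff)
      also have "\<dots> < e"
        using fg[of m "r i"] fg[of m "r j"] N[OF ij(1)] N[OF ij(2)] m by linarith
      finally show "(\<integral>x. norm (f (r i) x - f (r j) x) \<partial>lborel) < e" .
    qed
  qed
  \<comment> \<open>A further subsequence turns the Cauchy property in \<open>L1\<close> into
    pointwise convergence almost everywhere.\<close>
  have "\<exists>s. strict_mono (s :: nat \<Rightarrow> nat) \<and> (AE x in lborel. Cauchy (\<lambda>i. f (r (s i)) x))"
  proof (rule cauchy_L1_AE_cauchy_subseq[of lborel "\<lambda>i. f (r i)"])
    fix s :: "nat \<Rightarrow> nat" assume "strict_mono s" "AE x in lborel. Cauchy (\<lambda>i. f (r (s i)) x)"
    then show ?thesis by (intro exI[of _ s] conjI)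
  qed (use intf L1_Cauchy in auto)
  then obtain s where s: "strict_mono s" "AE x in lborel. Cauchy (\<lambda>i. f (r (s i)) x)" by blast
  \<comment> \<open>Clamping to the interval from \<open>- C\<close> to \<open>C\<close> changes
    nothing where the limit exists and makes the bound hold at every point.\<close>
  define u where "u x = max (- C) (min C (lim (\<lambda>i. f (r (s i)) x)))" for x
  have u_meas[measurable]: "u \<in> borel_measurable borel"
    unfolding u_def[abs_def] by (intro borel_measurable_max borel_measurable_min borel_measurable_lim_metric) auto
  have uC: "\<bar>u x\<bar> \<le> C" for x using C0 by (auto simp: u_def max_def min_def)
  have lim_u: "AE x in lborel. (\<lambda>i. f (r (s i)) x) \<longlonglongrightarrow> u x"
    using s(2)
  proof eventually_elim
    case (elim x)
    then have l: "(\<lambda>i. f (r (s i)) x) \<longlonglongrightarrow> lim (\<lambda>i. f (r (s i)) x)"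
      by (simp add: Cauchy_convergent_iff convergent_LIMSEQ_iff)
    have "\<bar>lim (\<lambda>i. f (r (s i)) x)\<bar> \<le> C"
      by (rule tendsto_upperbound[OF tendsto_rabs[OF l]]) (auto simp: C)
    then have "u x = lim (\<lambda>i. f (r (s i)) x)" by (simp add: u_def abs_le_iff)
    then show ?case using l by simp
  qed
  have b: "AE x in lborel. norm \<bar>f (r (s i)) x - u x\<bar> \<le> (2 * C) * indicator K x" for i
    using lim_u
  proof eventually_elim
    case (elim x)
    show ?case
    proof (cases "x \<in> K")
      case False
      then have "u x = 0" using elim K(2) by (simp add: LIMSEQ_const_iff)
      then show ?thesis using False K(2) by simp
    next
      case True
      then show ?thesis using C[of "r (s i)" x] uC[of x] by simp
    qed
  qed
  have "(\<lambda>i. \<integral>x. \<bar>f (r (s i)) x - u x\<bar> \<partial>lborel) \<longlonglongrightarrow> (integral\<^sup>L lborel (\<lambda>x::'a. 0))"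
  proof (rule integral_dominated_convergence)
    show "integrable lborel (\<lambda>x. (2 * C) * indicator K x)" by (rule intC)
    show "AE x in lborel. norm \<bar>f (r (s i)) x - u x\<bar> \<le> (2 * C) * indicator K x" for i by (rule b)
    show "AE x in lborel. (\<lambda>i. \<bar>f (r (s i)) x - u x\<bar>) \<longlonglongrightarrow> 0"
      using lim_u
    proof eventually_elim
      case (elim x)
      then show ?case by (intro tendsto_rabs_zero LIM_zero)
    qed
  qed measurable
  then have "(\<lambda>i. ennreal (\<integral>x. \<bar>f (r (s i)) x - u x\<bar> \<partial>lborel)) \<longlonglongrightarrow> ennreal 0"
    by (intro tendsto_ennrealI) simp
  moreover have "(\<integral>\<^sup>+x. ennreal \<bar>f (r (s i)) x - u x\<bar> \<partial>lborel) = ennreal (\<integral>x. \<bar>f (r (s i)) x - u x\<bar> \<partial>lborel)" for i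
  proof (rule nn_integral_eq_integral)
    show "integrable lborel (\<lambda>x. \<bar>f (r (s i)) x - u x\<bar>)"
    proof (rule Bochner_Integration.integrable_bound[OF intC[of "2 * C"]])
      show "AE x in lborel. norm \<bar>f (r (s i)) x - u x\<bar> \<le> norm (2 * C * indicator K x)"
        using b[of i] by eventually_elim (use C0 in simp)
    qed measurable
  qed simp
  ultimately have "(\<lambda>i. \<integral>\<^sup>+x. ennreal \<bar>f ((r \<circ> s) i) x - u x\<bar> \<partial>lborel) \<longlonglongrightarrow> 0" by simp
  with strict_mono_o[OF r(1) s(1)] u_meas uC show ?thesis
    by (intro exI[of _ "r \<circ> s"] exI[of _ u] conjI allI)
qed

subsection \<open>Existence of a minimiser\<close>

text \<open>The order of quantifiers matters: one constant serves all test functions at energy level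
  \<open>E0\<close>. Here \<open>E0\<close> bounds the integral of the density, without the factor 1
  / 4.\<close>

lemma area_integrable_and_bounds:
  assumes \<Omega>: "open \<Omega>" "bounded \<Omega>" "connected \<Omega>" and \<phi>: "\<phi> \<in> Ck_closure 2 \<Omega>"
  shows "\<exists>C. \<forall>\<zeta>\<in>test_functions \<Omega>. (\<integral>x. willmore_density (grad_data \<phi> \<zeta> x) \<partial>lebesgue_on \<Omega>) \<le> E0 \<longrightarrow>
    integrable (lebesgue_on \<Omega>) (\<lambda>x. area_fn (grad_data \<phi> \<zeta> x [E1]) (grad_data \<phi> \<zeta> x [E2]))
    \<and> (\<integral>x. area_fn (grad_data \<phi> \<zeta> x [E1]) (grad_data \<phi> \<zeta> x [E2]) \<partial>lebesgue_on \<Omega>) \<le> C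
    \<and> (\<forall>x\<in>\<Omega>. \<bar>\<phi> x + \<zeta> x\<bar> \<le> C)"
proof -
  have \<phi>2: "\<phi> \<in> Ck_on 2 \<Omega>" using \<phi> by (simp add: Ck_closure_def)
  have "\<exists>B. \<forall>bs\<in>multi_indices 2. \<forall>x\<in>\<Omega>. \<bar>partials bs \<phi> x\<bar> \<le> B"
    by (rule partials_bounded[OF \<Omega>(2) \<phi>]) blast
  then obtain B where B: "\<forall>bs\<in>multi_indices 2. \<forall>x\<in>\<Omega>. \<bar>partials bs \<phi> x\<bar> \<le> B" by (rule exE)
  obtain R where R: "\<forall>x\<in>\<Omega>. norm x \<le> R" using \<Omega>(2) unfolding bounded_iff by blast
  interpret b: C2_graph \<Omega> \<phi> "partials [E1] \<phi>" "partials [E2] \<phi>" "partials [E1, E1] \<phi>" "partials [E1, E2] \<phi>" "partials [E2, E2] \<phi>"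
    by (rule C2_graph_Ck[OF \<Omega>(1) \<phi>2])
  define c where "c = (\<integral>x. b.Q x + 1 / b.Q x - (x$1 * partials [E1] \<phi> x + x$2 * partials [E2] \<phi> x) * b.H x \<partial>lebesgue_on \<Omega>)"
  \<comment> \<open>\<open>A\<close> is the right side of \<open>area_bound\<close> at energy
    \<open>E0\<close>; \<open>C\<close> inserts \<open>A\<close> and \<open>E0\<close> into the
    integral of \<open>mass\<close> and then into \<open>sup_bound\<close>.\<close>
  define A where "A = R\<^sup>2 * E0 + 2 * c"
  define C where "C = B + 4 + 48 * (4 * A + E0 / 8)"
  show ?thesis
  proof (intro exI[of _ "max A C"] ballI impI)
    fix \<zeta> assume \<zeta>: "\<zeta> \<in> test_functions \<Omega>"
    assume E: "(\<integral>x. willmore_density (grad_data \<phi> \<zeta> x) \<partial>lebesgue_on \<Omega>) \<le> E0"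
    interpret P: C2_graph_pair \<Omega> "\<lambda>x. \<phi> x + \<zeta> x"
      "\<lambda>x. partials [E1] \<phi> x + partials [E1] \<zeta> x" "\<lambda>x. partials [E2] \<phi> x + partials [E2] \<zeta> x"
      "\<lambda>x. partials [E1, E1] \<phi> x + partials [E1, E1] \<zeta> x" "\<lambda>x. partials [E1, E2] \<phi> x + partials [E1, E2] \<zeta> x"
      "\<lambda>x. partials [E2, E2] \<phi> x + partials [E2, E2] \<zeta> x"
      \<phi> "partials [E1] \<phi>" "partials [E2] \<phi>" "partials [E1, E1] \<phi>" "partials [E1, E2] \<phi>" "partials [E2, E2] \<phi>"
      "tsupp \<zeta>" B
      by (rule C2_graph_pair_test[OF \<Omega>(1,2) \<phi>2 \<zeta> B[rule_format]])
    have dens: "(P.H x)\<^sup>2 * P.Q x = willmore_density (grad_data \<phi> \<zeta> x)" for x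
      unfolding willmore_density_def P.H_eq_mean_curv P.Q_eq_area_fn ..
    have Q: "P.Q x = area_fn (grad_data \<phi> \<zeta> x [E1]) (grad_data \<phi> \<zeta> x [E2])" for x
      by (rule P.Q_eq_area_fn)
    have "R\<^sup>2 * (\<integral>x. (P.H x)\<^sup>2 * P.Q x \<partial>lebesgue_on \<Omega>) \<le> R\<^sup>2 * E0"
      unfolding dens using E by (intro mult_left_mono) auto
    then have area: "(\<integral>x. P.Q x \<partial>lebesgue_on \<Omega>) \<le> A"
      using P.area_bound[of R] R unfolding A_def c_def by auto
    have mass: "(\<integral>x. P.mass x \<partial>lebesgue_on \<Omega>) \<le> 4 * A + E0 / 8"
    proof -
      have "(\<integral>x. P.mass x \<partial>lebesgue_on \<Omega>)
          = 4 * (\<integral>x. P.Q x \<partial>lebesgue_on \<Omega>) + (\<integral>x. (P.H x)\<^sup>2 * P.Q x \<partial>lebesgue_on \<Omega>) / 8"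
        unfolding P.mass_def using P.integrable_Q P.integrable_H2Q by simp
      then show ?thesis using area E unfolding dens by linarith
    qed
    have "48 * (\<integral>x. P.mass x \<partial>lebesgue_on \<Omega>) \<le> 48 * (4 * A + E0 / 8)"
      by (rule mult_left_mono[OF mass]) simp
    then have "\<bar>\<phi> x + \<zeta> x\<bar> \<le> C" if "x \<in> \<Omega>" for x
      unfolding C_def by (intro order_trans[OF P.sup_bound[OF \<Omega>(3) that]] add_mono order_refl)
    then show "integrable (lebesgue_on \<Omega>) (\<lambda>x. area_fn (grad_data \<phi> \<zeta> x [E1]) (grad_data \<phi> \<zeta> x [E2]))
        \<and> (\<integral>x. area_fn (grad_data \<phi> \<zeta> x [E1]) (grad_data \<phi> \<zeta> x [E2]) \<partial>lebesgue_on \<Omega>) \<le> max A C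
        \<and> (\<forall>x\<in>\<Omega>. \<bar>\<phi> x + \<zeta> x\<bar> \<le> max A C)"
      using P.integrable_Q area unfolding Q by (auto intro: max.coboundedI1 max.coboundedI2)
  qed
qed

section \<open>Total variation and translations of classical graphs\<close>

lemma Ck_on_1_derivative:
  fixes X :: "'a::euclidean_space \<Rightarrow> 'a"
  assumes X: "X \<in> Ck_on 1 UNIV" "X \<in> compactly_supported_in \<Omega>" and b: "b \<in> Basis"
  shows "((\<lambda>x. X x \<bullet> b) has_derivative (\<lambda>h. frechet_derivative X (at x) h \<bullet> b)) (at x)"
    and "continuous_on UNIV (\<lambda>x. partials [b] X x \<bullet> b)"
    and "x \<notin> closure {x. X x \<noteq> 0} \<Longrightarrow> X x \<bullet> b = 0"
    and "x \<notin> closure {x. X x \<noteq> 0} \<Longrightarrow> partials [b] X x \<bullet> b = 0"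
proof -
  have "[] \<in> multi_indices 1" "[b] \<in> multi_indices 1" using b by (auto simp: multi_indices_def)
  note mi = this
  have d: "X differentiable (at x)" for x
    using X(1) mi(1) unfolding Ck_on_def by fastforce
  have c: "continuous_on UNIV (partials [b] X)"
    using X(1) mi(2) unfolding Ck_on_def by blast
  show "((\<lambda>x. X x \<bullet> b) has_derivative (\<lambda>h. frechet_derivative X (at x) h \<bullet> b)) (at x)"
    using d[of x] by (auto intro!: derivative_eq_intros simp: frechet_derivative_works)
  show "continuous_on UNIV (\<lambda>x. partials [b] X x \<bullet> b)" using c by (intro continuous_intros)
  have X0: "X y = 0" if "y \<notin> closure {x. X x \<noteq> 0}" for y
    using that closure_subset[of "{x. X x \<noteq> 0}"] by blast
  assume x: "x \<notin> closure {x. X x \<noteq> 0}"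
  show "X x \<bullet> b = 0" unfolding X0[OF x] by simp
  have "(X has_derivative (\<lambda>_. 0)) (at x)"
  proof (rule has_derivative_transform_within_open[OF has_derivative_const[of 0]])
    show "open (- closure {x. X x \<noteq> 0})" by (intro open_Compl closed_closure)
    show "x \<in> - closure {x. X x \<noteq> 0}" using x unfolding Compl_iff .
    show "0 = X y" if "y \<in> - closure {x. X x \<noteq> 0}" for y
      by (rule X0[symmetric, OF that[unfolded Compl_iff]])
  qed
  from frechet_derivative_at[OF this] show "partials [b] X x \<bullet> b = 0" by (simp add: fun_eq_iff)
qed

text \<open>Integration by parts moves the divergence to the gradient of the graph function. As the
  field has norm at most 1, Cauchy-Schwarz bounds the integrand by the length of the gradient and
  hence by the area element.\<close>

lemma integral_divergence_le:
  assumes \<Omega>: "open \<Omega>" "bounded \<Omega>" and \<phi>: "\<phi> \<in> Ck_on 2 \<Omega>" and \<zeta>: "\<zeta> \<in> test_functions \<Omega>"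
    and int: "integrable (lebesgue_on \<Omega>) (\<lambda>x. area_fn (grad_data \<phi> \<zeta> x [E1]) (grad_data \<phi> \<zeta> x [E2]))"
    and X: "X \<in> Ck_on 1 UNIV" "X \<in> compactly_supported_in \<Omega>" "\<And>x. norm (X x) \<le> 1"
  shows "(\<integral>x. (\<phi> x + \<zeta> x) * (\<Sum>b\<in>Basis. partials [b] X x \<bullet> b) \<partial>lebesgue_on \<Omega>)
    \<le> (\<integral>x. area_fn (grad_data \<phi> \<zeta> x [E1]) (grad_data \<phi> \<zeta> x [E2]) \<partial>lebesgue_on \<Omega>)"
proof -
  define S where "S = closure {x. X x \<noteq> 0}"
  have S: "compact S" "S \<subseteq> \<Omega>" using X(2) by (auto simp: compactly_supported_in_def S_def)
  have \<zeta>2: "\<zeta> \<in> Ck_on 2 \<Omega>" using test_functionsD(3)[OF \<zeta>] by (rule Ck_on_mono) simp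
  interpret z: C2_graph \<Omega> "\<lambda>x. \<phi> x + \<zeta> x"
    "\<lambda>x. grad_data \<phi> \<zeta> x [E1]" "\<lambda>x. grad_data \<phi> \<zeta> x [E2]" "\<lambda>x. grad_data \<phi> \<zeta> x [E1, E1]"
    "\<lambda>x. grad_data \<phi> \<zeta> x [E1, E2]" "\<lambda>x. grad_data \<phi> \<zeta> x [E2, E2]"
    by (rule C2_graph_add[OF C2_graph_Ck[OF \<Omega>(1) \<phi>] C2_graph_Ck[OF \<Omega>(1) \<zeta>2]])
  have b12: "E1 \<in> Basis" "E2 \<in> Basis" by (simp_all add: Basis_real2)
  have contX: "continuous_on UNIV (\<lambda>x. X x \<bullet> b)" if "b \<in> Basis" for b
    by (intro continuous_at_imp_continuous_on ballI has_derivative_continuous[OF Ck_on_1_derivative(1)[OF X(1,2) that]])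
  have ibp: "(\<integral>x. (\<phi> x + \<zeta> x) * (partials [b] X x \<bullet> b) \<partial>lebesgue_on \<Omega>) = - (\<integral>x. p x * (X x \<bullet> b) \<partial>lebesgue_on \<Omega>)"
    and int_ibp: "integrable (lebesgue_on \<Omega>) (\<lambda>x. (\<phi> x + \<zeta> x) * (partials [b] X x \<bullet> b))"
      "integrable (lebesgue_on \<Omega>) (\<lambda>x. p x * (X x \<bullet> b))"
    if b: "b \<in> Basis" and p: "continuous_on \<Omega> p"
      "\<And>x. x \<in> \<Omega> \<Longrightarrow> grad_data \<phi> \<zeta> x [E1] * b$1 + grad_data \<phi> \<zeta> x [E2] * b$2 = p x" for b p
  proof -
    note D = Ck_on_1_derivative[OF X(1,2) b, folded S_def]
    show "(\<integral>x. (\<phi> x + \<zeta> x) * (partials [b] X x \<bullet> b) \<partial>lebesgue_on \<Omega>) = - (\<integral>x. p x * (X x \<bullet> b) \<partial>lebesgue_on \<Omega>)"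
      by (rule integral_by_parts_test[OF \<Omega>(1) z.deriv_z p(2) p(1) D(1) _ D(2) S D(3,4)]) simp_all
    show "integrable (lebesgue_on \<Omega>) (\<lambda>x. (\<phi> x + \<zeta> x) * (partials [b] X x \<bullet> b))"
      by (rule integrable_L1_loc_mult[OF \<Omega>(1) L1_loc_continuous[OF z.cont_z] S D(2) D(4)])
    show "integrable (lebesgue_on \<Omega>) (\<lambda>x. p x * (X x \<bullet> b))"
      by (rule integrable_L1_loc_mult[OF \<Omega>(1) L1_loc_continuous[OF p(1)] S contX[OF b] D(3)])
  qed
  have e1: "E1$1 = 1" "E1$2 = 0" "E2$1 = 0" "E2$2 = 1" by (simp_all add: axis_def)
  have h1: "grad_data \<phi> \<zeta> x [E1] * E1$1 + grad_data \<phi> \<zeta> x [E2] * E1$2 = grad_data \<phi> \<zeta> x [E1]"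
    and h2: "grad_data \<phi> \<zeta> x [E1] * E2$1 + grad_data \<phi> \<zeta> x [E2] * E2$2 = grad_data \<phi> \<zeta> x [E2]" for x
    by (simp_all add: e1)
  note i1 = ibp[OF b12(1) z.cont_p1 h1] int_ibp[OF b12(1) z.cont_p1 h1]
  note i2 = ibp[OF b12(2) z.cont_p2 h2] int_ibp[OF b12(2) z.cont_p2 h2]
  have "(\<integral>x. (\<phi> x + \<zeta> x) * (\<Sum>b\<in>Basis. partials [b] X x \<bullet> b) \<partial>lebesgue_on \<Omega>)
      = (\<integral>x. (\<phi> x + \<zeta> x) * (partials [E1] X x \<bullet> E1) + (\<phi> x + \<zeta> x) * (partials [E2] X x \<bullet> E2) \<partial>lebesgue_on \<Omega>)"
    unfolding Basis_real2 using E1_neq_E2 by (simp add: distrib_left)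
  also have "\<dots> = - (\<integral>x. grad_data \<phi> \<zeta> x [E1] * (X x \<bullet> E1) \<partial>lebesgue_on \<Omega>)
      + - (\<integral>x. grad_data \<phi> \<zeta> x [E2] * (X x \<bullet> E2) \<partial>lebesgue_on \<Omega>)"
    unfolding i1(1)[symmetric] i2(1)[symmetric] by (rule Bochner_Integration.integral_add[OF i1(2) i2(2)])
  also have "\<dots> = (\<integral>x. - (grad_data \<phi> \<zeta> x [E1] * (X x \<bullet> E1) + grad_data \<phi> \<zeta> x [E2] * (X x \<bullet> E2)) \<partial>lebesgue_on \<Omega>)"
    unfolding Bochner_Integration.integral_minus Bochner_Integration.integral_add[OF i1(3) i2(3)] by simp
  also have "\<dots> \<le> (\<integral>x. area_fn (grad_data \<phi> \<zeta> x [E1]) (grad_data \<phi> \<zeta> x [E2]) \<partial>lebesgue_on \<Omega>)"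
  proof (rule integral_mono[OF _ int])
    show "integrable (lebesgue_on \<Omega>) (\<lambda>x. - (grad_data \<phi> \<zeta> x [E1] * (X x \<bullet> E1) + grad_data \<phi> \<zeta> x [E2] * (X x \<bullet> E2)))"
      by (intro Bochner_Integration.integrable_minus Bochner_Integration.integrable_add i1(3) i2(3))
    fix x
    have "\<bar>a * y + b * w\<bar> \<le> area_fn a b" if "y\<^sup>2 + w\<^sup>2 \<le> 1" for a b y w
    proof -
      have "(a * y + b * w)\<^sup>2 \<le> (a\<^sup>2 + b\<^sup>2) * (y\<^sup>2 + w\<^sup>2)"
        using zero_le_power2[of "a * w - b * y"] by (simp add: power2_eq_square algebra_simps)
      also have "\<dots> \<le> (area_fn a b)\<^sup>2 * 1" unfolding area_fn_sq using that by (intro mult_mono) auto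
      finally show ?thesis using area_fn_pos[of a b] by (simp add: abs_le_square_iff[symmetric])
    qed
    moreover have "(X x \<bullet> E1)\<^sup>2 + (X x \<bullet> E2)\<^sup>2 \<le> 1"
      using power_mono[OF X(3)[of x] norm_ge_zero, of 2] by (simp add: norm_sq_real2 inner_axis)
    ultimately have "\<bar>grad_data \<phi> \<zeta> x [E1] * (X x \<bullet> E1) + grad_data \<phi> \<zeta> x [E2] * (X x \<bullet> E2)\<bar>
        \<le> area_fn (grad_data \<phi> \<zeta> x [E1]) (grad_data \<phi> \<zeta> x [E2])" by blast
    then show "- (grad_data \<phi> \<zeta> x [E1] * (X x \<bullet> E1) + grad_data \<phi> \<zeta> x [E2] * (X x \<bullet> E2))
        \<le> area_fn (grad_data \<phi> \<zeta> x [E1]) (grad_data \<phi> \<zeta> x [E2])" by linarith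
  qed
  finally show ?thesis .
qed

text \<open>Stated for the test function, which vanishes outside \<open>\<Omega>\<close>; the graph
  function \<open>\<phi> + \<zeta>\<close> would in general jump at the boundary when extended by 0.
  The 2 counts the two partial derivatives bounded by \<open>G\<close>.\<close>

lemma test_function_translation_le:
  assumes \<Omega>: "open \<Omega>" and \<zeta>: "\<zeta> \<in> test_functions \<Omega>"
    and G: "\<And>x. x \<in> \<Omega> \<Longrightarrow> \<bar>partials [E1] \<zeta> x\<bar> \<le> G x \<and> \<bar>partials [E2] \<zeta> x\<bar> \<le> G x" "integrable (lebesgue_on \<Omega>) G"
  shows "(\<integral>x. \<bar>\<zeta> (h + x) - \<zeta> x\<bar> \<partial>lborel) \<le> 2 * (\<integral>x. G x \<partial>lebesgue_on \<Omega>) * norm h"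
proof -
  have \<Omega>m: "\<Omega> \<in> sets lebesgue" using \<Omega> by auto
  define d where "d x = partials [E1] \<zeta> x * h$1 + partials [E2] \<zeta> x * h$2" for x
  interpret C2_graph UNIV \<zeta> "partials [E1] \<zeta>" "partials [E2] \<zeta>" "partials [E1, E1] \<zeta>" "partials [E1, E2] \<zeta>" "partials [E2, E2] \<zeta>"
    by (rule C2_graph_Ck[OF open_UNIV test_functionsD(3)[OF \<zeta>]])
  have contd: "continuous_on UNIV d" unfolding d_def[abs_def] by (intro continuous_intros cont_p1 cont_p2)
  have d0: "d x = 0" if "x \<notin> tsupp \<zeta>" for x
    unfolding d_def partials_eq_0_off_tsupp[OF that] by simp
  have \<zeta>0: "\<zeta> x = 0" if "x \<notin> tsupp \<zeta>" for x using partials_eq_0_off_tsupp[OF that, of "[]"] by simp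
  note * = integral_directional_derivative_UNIV[OF test_functionsD(1)[OF \<zeta>] \<zeta>0 d0 deriv_z[OF UNIV_I] d_def[symmetric] contd]
  have eq: "(\<lambda>x. if x \<in> \<Omega> then \<bar>d x\<bar> else 0) = (\<lambda>x. \<bar>d x\<bar>)"
    using d0 test_functionsD(2)[OF \<zeta>] by (auto simp: fun_eq_iff)
  have intd: "integrable lborel (\<lambda>x. \<bar>d x\<bar>)" using *(1) by (rule integrable_abs)
  have intd': "integrable (lebesgue_on \<Omega>) (\<lambda>x. \<bar>d x\<bar>)"
    using intd unfolding Lebesgue_Measure.integrable_restrict_UNIV[OF \<Omega>m, symmetric] eq
    by (subst integrable_completion) auto
  have "(\<integral>x. \<bar>d x\<bar> \<partial>lborel) = (\<integral>x. \<bar>d x\<bar> \<partial>lebesgue)"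
    using intd by (intro integral_completion[symmetric]) auto
  also have "\<dots> = (\<integral>x. \<bar>d x\<bar> \<partial>lebesgue_on \<Omega>)"
    unfolding Lebesgue_Measure.integral_restrict_UNIV[OF \<Omega>m, symmetric] eq ..
  also have "\<dots> \<le> (\<integral>x. G x * (2 * norm h) \<partial>lebesgue_on \<Omega>)"
  proof (rule integral_mono[OF intd'])
    show "integrable (lebesgue_on \<Omega>) (\<lambda>x. G x * (2 * norm h))" using G(2) by simp
    fix x assume "x \<in> space (lebesgue_on \<Omega>)"
    then have x: "x \<in> \<Omega>" by simp
    have "\<bar>partials [E1] \<zeta> x * h$1\<bar> \<le> G x * norm h" "\<bar>partials [E2] \<zeta> x * h$2\<bar> \<le> G x * norm h"
      unfolding abs_mult using G(1)[OF x] component_le_norm_cart[of h]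
      by (auto intro!: mult_mono order_trans[OF abs_ge_zero])
    then show "\<bar>d x\<bar> \<le> G x * (2 * norm h)" unfolding d_def by linarith
  qed
  also have "\<dots> = 2 * (\<integral>x. G x \<partial>lebesgue_on \<Omega>) * norm h" by simp
  finally show ?thesis using *(3) by linarith
qed

section \<open>Passage to the relaxed energy\<close>

lemma Inf_willmore_le_relaxed:
  "Inf (willmore \<Omega> ` dirichlet_class \<Omega> \<phi>) \<le> relaxed_willmore \<Omega> \<phi> v"
  unfolding relaxed_willmore_def
proof (rule Inf_greatest, elim CollectE exE conjE)
  fix x w assume x: "x = liminf (\<lambda>k. willmore \<Omega> (w k))" and w: "\<forall>k. w k \<in> dirichlet_class \<Omega> \<phi>"
  show "Inf (willmore \<Omega> ` dirichlet_class \<Omega> \<phi>) \<le> x"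
    unfolding x using w by (intro Liminf_bounded always_eventually allI INF_lower) blast
qed

lemma total_variation_zero: "total_variation \<Omega> (\<lambda>_. 0) < \<infinity>"
proof -
  have "total_variation \<Omega> (\<lambda>_. 0) \<le> 0"
    unfolding total_variation_def by (intro SUP_least) simp
  then show ?thesis by (rule order.strict_trans1) simp
qed

text \<open>Compactness is applied to the \<open>\<zeta> k\<close>, whose partial derivatives are at
  most the area element plus the bound \<open>B\<close> of the datum; \<open>\<phi>\<close> is added
  back afterwards.\<close>

lemma minimizing_sequence_limit:
  fixes \<Omega> :: "(real^2) set"
  assumes \<Omega>: "open \<Omega>" "bounded \<Omega>" "connected \<Omega>" and \<phi>: "\<phi> \<in> Ck_closure 2 \<Omega>"
    and \<zeta>: "\<And>k. \<zeta> k \<in> test_functions \<Omega>"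
    and E0: "\<And>k. (\<integral>x. willmore_density (grad_data \<phi> (\<zeta> k) x) \<partial>lebesgue_on \<Omega>) \<le> E0"
  shows "\<exists>r u. strict_mono (r :: nat \<Rightarrow> nat) \<and> u \<in> BV \<Omega> \<inter> Linfty \<Omega>
    \<and> (\<lambda>k. \<integral>\<^sup>+x. ennreal \<bar>\<phi> x + \<zeta> (r k) x - u x\<bar> \<partial>lebesgue_on \<Omega>) \<longlonglongrightarrow> 0"
proof -
  have \<Omega>m: "\<Omega> \<in> sets lebesgue" using \<Omega> by auto
  interpret fm: finite_measure "lebesgue_on \<Omega>"
    using \<Omega> by (intro finite_measure_lebesgue_on lmeasurable_open)
  have \<phi>2: "\<phi> \<in> Ck_on 2 \<Omega>" using \<phi> by (simp add: Ck_closure_def)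
  have "\<exists>B. \<forall>bs\<in>multi_indices 2. \<forall>x\<in>\<Omega>. \<bar>partials bs \<phi> x\<bar> \<le> B"
    by (rule partials_bounded[OF \<Omega>(2) \<phi>]) blast
  then obtain B where B: "\<forall>bs\<in>multi_indices 2. \<forall>x\<in>\<Omega>. \<bar>partials bs \<phi> x\<bar> \<le> B" by (rule exE)
  define q where "q k x = area_fn (grad_data \<phi> (\<zeta> k) x [E1]) (grad_data \<phi> (\<zeta> k) x [E2])" for k x
  from area_integrable_and_bounds[OF \<Omega> \<phi>, of E0] obtain C where C:
    "\<forall>\<zeta>\<in>test_functions \<Omega>. (\<integral>x. willmore_density (grad_data \<phi> \<zeta> x) \<partial>lebesgue_on \<Omega>) \<le> E0 \<longrightarrow>
      integrable (lebesgue_on \<Omega>) (\<lambda>x. area_fn (grad_data \<phi> \<zeta> x [E1]) (grad_data \<phi> \<zeta> x [E2]))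
      \<and> (\<integral>x. area_fn (grad_data \<phi> \<zeta> x [E1]) (grad_data \<phi> \<zeta> x [E2]) \<partial>lebesgue_on \<Omega>) \<le> C
      \<and> (\<forall>x\<in>\<Omega>. \<bar>\<phi> x + \<zeta> x\<bar> \<le> C)" by (rule exE)
  have q: "integrable (lebesgue_on \<Omega>) (q k)" "(\<integral>x. q k x \<partial>lebesgue_on \<Omega>) \<le> C"
    and zC: "x \<in> \<Omega> \<Longrightarrow> \<bar>\<phi> x + \<zeta> k x\<bar> \<le> C" for k x
    using bspec[OF C \<zeta>[of k]] E0[of k] unfolding q_def by blast+
  have C0: "C \<ge> 0"
  proof -
    have "0 \<le> (\<integral>x. q 0 x \<partial>lebesgue_on \<Omega>)"
      unfolding q_def by (intro integral_nonneg_AE AE_I2 less_imp_le area_fn_pos)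
    then show ?thesis using q(2)[of 0] by linarith
  qed
  have phiB: "\<bar>\<phi> x\<bar> \<le> B" if "x \<in> \<Omega>" for x
    using bspec[OF bspec[OF B multi_indices_2_real2(1)] that] by simp
  have cont\<zeta>: "continuous_on UNIV (\<zeta> k)" for k
    using continuous_partials_test[OF \<zeta>, of "[]"] by simp
  have \<zeta>0: "\<zeta> k x = 0" if "x \<notin> \<Omega>" for k x
    using partials_eq_0_off_tsupp[of x "\<zeta> k" "[]"] test_functionsD(2)[OF \<zeta>[of k]] that by auto
  define C' where "C' = C + \<bar>B\<bar>"
  have \<zeta>C: "\<bar>\<zeta> k x\<bar> \<le> C'" for k x
  proof (cases "x \<in> \<Omega>")
    case True
    then show ?thesis using zC[OF True, of k] phiB[OF True] unfolding C'_def by linarith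
  next
    case False
    then show ?thesis using \<zeta>0[OF False] C0 by (simp add: C'_def)
  qed
  \<comment> \<open>Bounds twice the integral of the gradient majorant \<open>q k x + B\<close>, as
    \<open>test_function_translation_le\<close> requires.\<close>
  define A where "A = 2 * (C + B * measure (lebesgue_on \<Omega>) \<Omega>)"
  have tr: "(\<integral>x. \<bar>\<zeta> k (h + x) - \<zeta> k x\<bar> \<partial>lborel) \<le> \<bar>A\<bar> * norm h" for k h
  proof -
    have intG: "integrable (lebesgue_on \<Omega>) (\<lambda>x. q k x + B)" using q(1) by simp
    have "(\<integral>x. \<bar>\<zeta> k (h + x) - \<zeta> k x\<bar> \<partial>lborel) \<le> 2 * (\<integral>x. q k x + B \<partial>lebesgue_on \<Omega>) * norm h"
    proof (rule test_function_translation_le[OF \<Omega>(1) \<zeta> _ intG])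
      fix x assume x: "x \<in> \<Omega>"
      have "\<bar>partials [E1] \<phi> x\<bar> \<le> B" "\<bar>partials [E2] \<phi> x\<bar> \<le> B"
        using B x multi_indices_2_real2(2,3) by blast+
      moreover have "\<bar>grad_data \<phi> (\<zeta> k) x [E1]\<bar> \<le> q k x" "\<bar>grad_data \<phi> (\<zeta> k) x [E2]\<bar> \<le> q k x"
        unfolding q_def by (rule area_fn_abs_le)+
      ultimately show "\<bar>partials [E1] (\<zeta> k) x\<bar> \<le> q k x + B \<and> \<bar>partials [E2] (\<zeta> k) x\<bar> \<le> q k x + B"
        by linarith
    qed
    also have "(\<integral>x. q k x + B \<partial>lebesgue_on \<Omega>) = (\<integral>x. q k x \<partial>lebesgue_on \<Omega>) + B * measure (lebesgue_on \<Omega>) \<Omega>"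
      using q(1) by simp
    also have "2 * ((\<integral>x. q k x \<partial>lebesgue_on \<Omega>) + B * measure (lebesgue_on \<Omega>) \<Omega>) * norm h \<le> A * norm h"
      unfolding A_def using q(2)[of k] by (intro mult_right_mono mult_left_mono add_mono) auto
    also have "\<dots> \<le> \<bar>A\<bar> * norm h" by (intro mult_right_mono) auto
    finally show ?thesis .
  qed
  have "compact (closure \<Omega>)" using \<Omega>(2) by simp
  note compact = this
  have \<zeta>K: "\<zeta> k x = 0" if "x \<notin> closure \<Omega>" for k x
    by (rule \<zeta>0) (use that closure_subset in blast)
  have "\<exists>r u. strict_mono (r :: nat \<Rightarrow> nat) \<and> u \<in> borel_measurable borel \<and> (\<forall>x. \<bar>u x\<bar> \<le> C')
    \<and> (\<lambda>k. \<integral>\<^sup>+x. ennreal \<bar>\<zeta> (r k) x - u x\<bar> \<partial>lborel) \<longlonglongrightarrow> 0"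
    by (rule L1_compactness[OF cont\<zeta> compact \<zeta>K \<zeta>C abs_ge_zero tr])
  then obtain r u0 where r: "strict_mono r" and u0: "u0 \<in> borel_measurable borel" "\<forall>x. \<bar>u0 x\<bar> \<le> C'"
    and conv: "(\<lambda>k. \<integral>\<^sup>+x. ennreal \<bar>\<zeta> (r k) x - u0 x\<bar> \<partial>lborel) \<longlonglongrightarrow> 0" by (elim exE conjE)
  define u where "u x = \<phi> x + u0 x" for x
  have u0m: "u0 \<in> borel_measurable (lebesgue_on \<Omega>)"
    using u0(1) by (intro measurable_restrict_space1 measurable_completion) simp
  have phim: "\<phi> \<in> borel_measurable (lebesgue_on \<Omega>)"
    using Ck_on_continuous[OF \<phi>2, of "[]"] \<Omega>m by (intro continuous_imp_measurable_on_sets_lebesgue) simp_all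
  have um: "u \<in> borel_measurable (lebesgue_on \<Omega>)"
    unfolding u_def[abs_def] using phim u0m by (rule borel_measurable_add)
  have ub: "\<bar>u x\<bar> \<le> B + C'" if "x \<in> \<Omega>" for x
    using phiB[OF that] spec[OF u0(2), of x] unfolding u_def by linarith
  have ae_ub: "AE x in lebesgue_on \<Omega>. \<bar>u x\<bar> \<le> B + C'" using ub by (intro AE_I2) simp
  have intu: "integrable (lebesgue_on \<Omega>) u"
    by (rule fm.integrable_const_bound[where B = "B + C'"]) (use ae_ub um in simp_all)
  have \<zeta>m: "\<zeta> k \<in> borel_measurable (lebesgue_on \<Omega>)" for k
    using integrable_partials_test(1)[OF \<Omega>(1,2) \<zeta>, of "[]" k] by auto
  have conv': "(\<lambda>k. \<integral>\<^sup>+x. ennreal \<bar>\<phi> x + \<zeta> (r k) x - u x\<bar> \<partial>lebesgue_on \<Omega>) \<longlonglongrightarrow> 0"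
  proof (rule tendsto_sandwich[OF _ _ tendsto_const conv]; intro always_eventually allI)
    fix k
    have "(\<integral>\<^sup>+x. ennreal \<bar>\<phi> x + \<zeta> (r k) x - u x\<bar> \<partial>lebesgue_on \<Omega>) = (\<integral>\<^sup>+x. ennreal \<bar>\<zeta> (r k) x - u0 x\<bar> * indicator \<Omega> x \<partial>lebesgue)"
      using \<Omega>m by (subst nn_integral_restrict_space) (auto simp: u_def)
    also have "\<dots> \<le> (\<integral>\<^sup>+x. ennreal \<bar>\<zeta> (r k) x - u0 x\<bar> \<partial>lebesgue)"
      by (intro nn_integral_mono) (auto simp: indicator_def)
    finally show "(\<integral>\<^sup>+x. ennreal \<bar>\<phi> x + \<zeta> (r k) x - u x\<bar> \<partial>lebesgue_on \<Omega>) \<le> (\<integral>\<^sup>+x. ennreal \<bar>\<zeta> (r k) x - u0 x\<bar> \<partial>lborel)"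
      by (simp add: nn_integral_completion)
  qed simp
  define D where "D k x = \<phi> x + \<zeta> (r k) x - u x" for k x
  have zm: "(\<lambda>x. \<phi> x + \<zeta> (r k) x) \<in> borel_measurable (lebesgue_on \<Omega>)" for k
    using phim \<zeta>m by (rule borel_measurable_add)
  have intz: "integrable (lebesgue_on \<Omega>) (\<lambda>x. \<phi> x + \<zeta> (r k) x)" for k
  proof (rule fm.integrable_const_bound[where B = C])
    show "AE x in lebesgue_on \<Omega>. norm (\<phi> x + \<zeta> (r k) x) \<le> C" using zC by (intro AE_I2) simp
  qed (rule zm)
  have intD: "integrable (lebesgue_on \<Omega>) (D k)" for k
    unfolding D_def by (rule Bochner_Integration.integrable_diff[OF intz intu])
  have "(\<lambda>k. ennreal (\<integral>x. \<bar>D k x\<bar> \<partial>lebesgue_on \<Omega>)) \<longlonglongrightarrow> 0"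
  proof -
    have "(\<integral>\<^sup>+x. ennreal \<bar>\<phi> x + \<zeta> (r k) x - u x\<bar> \<partial>lebesgue_on \<Omega>) = ennreal (\<integral>x. \<bar>D k x\<bar> \<partial>lebesgue_on \<Omega>)" for k
      unfolding D_def[symmetric] by (rule nn_integral_eq_integral[OF integrable_abs[OF intD]]) simp
    then show ?thesis using conv' by simp
  qed
  then have convD: "(\<lambda>k. \<integral>x. \<bar>D k x\<bar> \<partial>lebesgue_on \<Omega>) \<longlonglongrightarrow> 0"
    by (subst (asm) ennreal_tendsto_0_iff) (auto intro: integral_nonneg_AE)
  \<comment> \<open>Lower semicontinuity of the total variation, field by field: for fixed
    \<open>X\<close> the pairing with the error \<open>D k\<close> tends to 0, while the pairing
    with each graph function is at most \<open>C\<close>.\<close>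
  have "total_variation \<Omega> u \<le> ereal C"
    unfolding total_variation_def
  proof (rule SUP_least, elim CollectE conjE IntE)
    fix X :: "real^2 \<Rightarrow> real^2"
    assume X: "X \<in> Ck_on 1 UNIV" "X \<in> compactly_supported_in \<Omega>" and X1: "\<forall>x. norm (X x) \<le> 1"
    define dv where "dv x = (\<Sum>b\<in>Basis. partials [b] X x \<bullet> b)" for x
    have contdv: "continuous_on UNIV dv"
      unfolding dv_def[abs_def] by (intro continuous_on_sum Ck_on_1_derivative(2)[OF X])
    define S where "S = closure {x. X x \<noteq> 0}"
    have S: "compact S" using X(2) by (simp add: compactly_supported_in_def S_def)
    have dv0: "dv x = 0" if "x \<notin> S" for x
      unfolding dv_def using Ck_on_1_derivative(4)[OF X] that unfolding S_def by (intro sum.neutral ballI) blast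
    from compact_imp_bounded[OF compact_continuous_image[OF continuous_on_subset[OF contdv subset_UNIV] S]]
    obtain M where M: "\<forall>y\<in>dv ` S. norm y \<le> M" unfolding bounded_iff by blast
    have dvM: "\<bar>dv x\<bar> \<le> \<bar>M\<bar>" for x
      using M dv0[of x] by (cases "x \<in> S") force+
    have dvm: "dv \<in> borel_measurable (lebesgue_on \<Omega>)"
      using continuous_on_subset[OF contdv subset_UNIV] \<Omega>m by (rule continuous_imp_measurable_on_sets_lebesgue)
    have int_dv: "integrable (lebesgue_on \<Omega>) (\<lambda>x. g x * dv x)" if g: "integrable (lebesgue_on \<Omega>) g" for g
    proof (rule Bochner_Integration.integrable_bound[OF integrable_mult_left[OF g, of "\<bar>M\<bar>"]])
      show "(\<lambda>x. g x * dv x) \<in> borel_measurable (lebesgue_on \<Omega>)"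
        using borel_measurable_integrable[OF g] dvm by (rule borel_measurable_times)
      show "AE x in lebesgue_on \<Omega>. norm (g x * dv x) \<le> norm (g x * \<bar>M\<bar>)"
        unfolding real_norm_def abs_mult using dvM by (intro AE_I2 mult_left_mono) auto
    qed
    have "(\<lambda>k. \<integral>x. D k x * dv x \<partial>lebesgue_on \<Omega>) \<longlonglongrightarrow> 0"
    proof (rule Lim_null_comparison)
      show "\<forall>\<^sub>F k in sequentially. norm (\<integral>x. D k x * dv x \<partial>lebesgue_on \<Omega>) \<le> (\<integral>x. \<bar>D k x\<bar> \<partial>lebesgue_on \<Omega>) * \<bar>M\<bar>"
      proof (intro always_eventually allI)
        fix k
        have "norm (\<integral>x. D k x * dv x \<partial>lebesgue_on \<Omega>) \<le> (\<integral>x. norm (D k x * dv x) \<partial>lebesgue_on \<Omega>)"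
          by (rule integral_norm_bound)
        also have "\<dots> \<le> (\<integral>x. \<bar>D k x\<bar> * \<bar>M\<bar> \<partial>lebesgue_on \<Omega>)"
        proof (rule integral_mono)
          show "integrable (lebesgue_on \<Omega>) (\<lambda>x. norm (D k x * dv x))" by (rule integrable_norm[OF int_dv[OF intD]])
          show "integrable (lebesgue_on \<Omega>) (\<lambda>x. \<bar>D k x\<bar> * \<bar>M\<bar>)" by (rule integrable_mult_left[OF integrable_abs[OF intD]])
          show "norm (D k x * dv x) \<le> \<bar>D k x\<bar> * \<bar>M\<bar>" for x
            unfolding real_norm_def abs_mult by (rule mult_left_mono[OF dvM abs_ge_zero])
        qed
        also have "\<dots> = (\<integral>x. \<bar>D k x\<bar> \<partial>lebesgue_on \<Omega>) * \<bar>M\<bar>" by simp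
        finally show "norm (\<integral>x. D k x * dv x \<partial>lebesgue_on \<Omega>) \<le> (\<integral>x. \<bar>D k x\<bar> \<partial>lebesgue_on \<Omega>) * \<bar>M\<bar>" .
      qed
      show "(\<lambda>k. (\<integral>x. \<bar>D k x\<bar> \<partial>lebesgue_on \<Omega>) * \<bar>M\<bar>) \<longlonglongrightarrow> 0"
        by (rule tendsto_mult_left_zero[OF convD])
    qed
    moreover have "(\<integral>x. u x * dv x \<partial>lebesgue_on \<Omega>) + (\<integral>x. D k x * dv x \<partial>lebesgue_on \<Omega>) \<le> C" for k
    proof -
      have "(\<integral>x. u x * dv x \<partial>lebesgue_on \<Omega>) + (\<integral>x. D k x * dv x \<partial>lebesgue_on \<Omega>)
          = (\<integral>x. u x * dv x + D k x * dv x \<partial>lebesgue_on \<Omega>)"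
        by (rule Bochner_Integration.integral_add[symmetric, OF int_dv[OF intu] int_dv[OF intD]])
      also have "\<dots> = (\<integral>x. (\<phi> x + \<zeta> (r k) x) * dv x \<partial>lebesgue_on \<Omega>)"
        by (simp add: D_def distrib_right[symmetric])
      also have "\<dots> \<le> (\<integral>x. q (r k) x \<partial>lebesgue_on \<Omega>)"
        unfolding dv_def q_def
        by (rule integral_divergence_le[OF \<Omega>(1,2) \<phi>2 \<zeta> q(1)[unfolded q_def] X]) (use X1 in blast)
      finally show ?thesis using q(2)[of "r k"] by linarith
    qed
    ultimately have "(\<integral>x. u x * dv x \<partial>lebesgue_on \<Omega>) + 0 \<le> C"
      by (intro LIMSEQ_le_const2[OF tendsto_add[OF tendsto_const]]) auto
    then show "ereal (\<integral>x. u x * (\<Sum>b\<in>Basis. partials [b] X x \<bullet> b) \<partial>lebesgue_on \<Omega>) \<le> ereal C"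
      unfolding dv_def by simp
  qed
  then have "total_variation \<Omega> u < \<infinity>" by (rule order.strict_trans1) simp
  then have "u \<in> BV \<Omega>" using intu by (simp add: BV_def L1_def)
  moreover have "u \<in> Linfty \<Omega>" using um ae_ub by (auto simp: Linfty_def)
  ultimately show ?thesis using r conv' by (intro exI[of _ r] exI[of _ u] conjI IntI)
qed

theorem theorem5:
  fixes \<Omega> :: "(real^2) set" and \<phi> :: "real^2 \<Rightarrow> real"
  assumes "open \<Omega>" and "connected \<Omega>" and "\<Omega> \<noteq> {}" and "bounded \<Omega>"
    and "Ck_boundary 2 \<Omega>"
    and "\<phi> \<in> Ck_closure 2 \<Omega>"
  shows "\<exists>u \<in> BV \<Omega> \<inter> Linfty \<Omega>. \<forall>v \<in> L1 \<Omega>.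
           relaxed_willmore \<Omega> \<phi> u \<le> relaxed_willmore \<Omega> \<phi> v"
proof -
  note \<Omega> = assms(1,4,2) and \<phi> = assms(6)
  define m where "m = Inf (willmore \<Omega> ` dirichlet_class \<Omega> \<phi>)"
  have lower: "m \<le> relaxed_willmore \<Omega> \<phi> v" for v
    unfolding m_def by (rule Inf_willmore_le_relaxed)
  have "\<exists>u \<in> BV \<Omega> \<inter> Linfty \<Omega>. relaxed_willmore \<Omega> \<phi> u \<le> m"
  proof (cases "m = top")
    \<comment> \<open>No admissible function has finite energy. By \<open>lower\<close> the
      relaxation is constantly infinite, and any element of the space will do.\<close>
    case True
    have "(\<lambda>_. 0) \<in> BV \<Omega> \<inter> Linfty \<Omega>"
      using total_variation_zero by (auto simp: BV_def L1_def Linfty_def)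
    then show ?thesis unfolding True using top_greatest by blast
  next
    case False
    define \<epsilon> where "\<epsilon> k = 1 / real (Suc k)" for k
    have \<epsilon>: "\<epsilon> k > 0" "\<epsilon> k \<le> 1" for k by (auto simp: \<epsilon>_def)
    have "\<exists>v. v \<in> dirichlet_class \<Omega> \<phi> \<and> willmore \<Omega> v \<le> m + ennreal (\<epsilon> k)" for k
    proof -
      \<comment> \<open>The inequality is strict because \<open>m\<close> is finite here.\<close>
      have "m < m + ennreal (\<epsilon> k)" using False \<epsilon>(1)[of k] by (simp add: ennreal_add_left_cancel_less top.not_eq_extremum)
      then obtain v where "v \<in> dirichlet_class \<Omega> \<phi>" "willmore \<Omega> v < m + ennreal (\<epsilon> k)"
        unfolding m_def INF_less_iff by blast
      then show ?thesis by (auto intro: less_imp_le)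
    qed
    from choice[OF allI[OF this]] obtain v where
      v: "\<forall>k. v k \<in> dirichlet_class \<Omega> \<phi> \<and> willmore \<Omega> (v k) \<le> m + ennreal (\<epsilon> k)" by (rule exE)
    have "\<exists>\<zeta>. \<zeta> \<in> test_functions \<Omega> \<and> (\<integral>\<^sup>+x. ennreal \<bar>\<phi> x + \<zeta> x - v k x\<bar> \<partial>lebesgue_on \<Omega>) \<le> ennreal (\<epsilon> k)
      \<and> ennreal (\<integral>x. willmore_density (grad_data \<phi> \<zeta> x) \<partial>lebesgue_on \<Omega>) \<le> 4 * willmore \<Omega> (v k) + ennreal (\<epsilon> k)" for k
      using dirichlet_class_approx[OF \<Omega>(1,2) \<phi> _ \<epsilon>(1)[of k]] v by blast
    from choice[OF allI[OF this]] obtain \<zeta> where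
      \<zeta>: "\<forall>k. \<zeta> k \<in> test_functions \<Omega> \<and> (\<integral>\<^sup>+x. ennreal \<bar>\<phi> x + \<zeta> k x - v k x\<bar> \<partial>lebesgue_on \<Omega>) \<le> ennreal (\<epsilon> k)
        \<and> ennreal (\<integral>x. willmore_density (grad_data \<phi> (\<zeta> k) x) \<partial>lebesgue_on \<Omega>) \<le> 4 * willmore \<Omega> (v k) + ennreal (\<epsilon> k)"
      by (rule exE)
    \<comment> \<open>The energies of the \<open>v k\<close> are at most \<open>m + 1\<close>
      because \<open>\<epsilon> k\<close> is at most 1; the 4 and the last 1 come from
      \<open>dirichlet_class_approx\<close>.\<close>
    define T where "T = 4 * (m + 1) + 1"
    have Tfin: "T \<noteq> top" using False by (simp add: T_def ennreal_mult_eq_top_iff)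
    have \<epsilon>1: "ennreal (\<epsilon> k) \<le> 1" for k using \<epsilon>(2)[of k] by (simp add: ennreal_le_1)
    have E0: "(\<integral>x. willmore_density (grad_data \<phi> (\<zeta> k) x) \<partial>lebesgue_on \<Omega>) \<le> enn2real T" for k
    proof -
      have "willmore \<Omega> (v k) \<le> m + 1" using v \<epsilon>1[of k] by (meson add_left_mono order_trans)
      then have "4 * willmore \<Omega> (v k) + ennreal (\<epsilon> k) \<le> T"
        unfolding T_def using \<epsilon>1[of k] by (intro add_mono mult_left_mono) auto
      then have "ennreal (\<integral>x. willmore_density (grad_data \<phi> (\<zeta> k) x) \<partial>lebesgue_on \<Omega>) \<le> T"
        using \<zeta> order_trans by blast
      also have "T = ennreal (enn2real T)" using Tfin by (simp add: ennreal_enn2real less_top)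
      finally show ?thesis by (simp add: ennreal_le_iff)
    qed
    have \<zeta>t: "\<zeta> k \<in> test_functions \<Omega>" for k using \<zeta> by blast
    from minimizing_sequence_limit[of \<Omega> \<phi> \<zeta>, OF \<Omega> \<phi> \<zeta>t E0] obtain r u where
      r: "strict_mono r" and u: "u \<in> BV \<Omega> \<inter> Linfty \<Omega>"
      and conv: "(\<lambda>k. \<integral>\<^sup>+x. ennreal \<bar>\<phi> x + \<zeta> (r k) x - u x\<bar> \<partial>lebesgue_on \<Omega>) \<longlonglongrightarrow> 0"
      by (elim exE conjE)
    have "(\<lambda>k. \<epsilon> k) \<longlonglongrightarrow> 0" unfolding \<epsilon>_def using LIMSEQ_Suc[OF lim_1_over_n] by simp
    then have "(\<lambda>k. ennreal (\<epsilon> k)) \<longlonglongrightarrow> 0"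
      using \<epsilon>(1) by (subst ennreal_tendsto_0_iff) (auto intro: less_imp_le)
    from LIMSEQ_subseq_LIMSEQ[OF this r] have \<epsilon>0: "(\<lambda>k. ennreal (\<epsilon> (r k))) \<longlonglongrightarrow> 0" by (simp add: o_def)
    \<comment> \<open>The recovery sequence is \<open>v\<close> along \<open>r\<close>: its members
      already lie in the class, with energy at most \<open>m + \<epsilon> (r k)\<close>. The
      classical graphs were used to find \<open>u\<close>, and they lie within
      \<open>\<epsilon>\<close> of \<open>v\<close> in \<open>L1\<close>.\<close>
    have "L1_tendsto \<Omega> (\<lambda>k. v (r k)) u"
      unfolding L1_tendsto_def
    proof (rule tendsto_sandwich[OF _ _ tendsto_const]; (intro always_eventually allI)?)
      have meas: "\<phi> \<in> borel_measurable (lebesgue_on \<Omega>)" "\<zeta> k \<in> borel_measurable (lebesgue_on \<Omega>)"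
          "v k \<in> borel_measurable (lebesgue_on \<Omega>)" "u \<in> borel_measurable (lebesgue_on \<Omega>)" for k
      proof -
        show "\<phi> \<in> borel_measurable (lebesgue_on \<Omega>)"
          using Ck_on_continuous[of \<phi> 2 \<Omega> "[]"] \<phi> \<Omega>(1)
          by (intro continuous_imp_measurable_on_sets_lebesgue) (auto simp: Ck_closure_def)
        show "\<zeta> k \<in> borel_measurable (lebesgue_on \<Omega>)"
          using integrable_partials_test(1)[OF \<Omega>(1,2) \<zeta>t, of "[]" k] by auto
        have "v k \<in> sobolev_H 2 \<Omega>" using v by (auto simp: dirichlet_class_def)
        then show "v k \<in> borel_measurable (lebesgue_on \<Omega>)" by (auto simp: sobolev_H_def L2_def)
        show "u \<in> borel_measurable (lebesgue_on \<Omega>)" using u by (auto simp: Linfty_def)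
      qed
      fix k
      have "(\<integral>\<^sup>+x. ennreal \<bar>v (r k) x - u x\<bar> \<partial>lebesgue_on \<Omega>)
          \<le> (\<integral>\<^sup>+x. ennreal \<bar>\<phi> x + \<zeta> (r k) x - v (r k) x\<bar> + ennreal \<bar>\<phi> x + \<zeta> (r k) x - u x\<bar> \<partial>lebesgue_on \<Omega>)"
        by (intro nn_integral_mono) (simp add: ennreal_plus[symmetric] ennreal_leI del: ennreal_plus)
      also have "\<dots> = (\<integral>\<^sup>+x. ennreal \<bar>\<phi> x + \<zeta> (r k) x - v (r k) x\<bar> \<partial>lebesgue_on \<Omega>)
          + (\<integral>\<^sup>+x. ennreal \<bar>\<phi> x + \<zeta> (r k) x - u x\<bar> \<partial>lebesgue_on \<Omega>)"
      proof -
        note [measurable] = meas(1) meas(2)[of "r k"] meas(3)[of "r k"] meas(4)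
        show ?thesis by (intro nn_integral_add; measurable)
      qed
      also have "\<dots> \<le> ennreal (\<epsilon> (r k)) + (\<integral>\<^sup>+x. ennreal \<bar>\<phi> x + \<zeta> (r k) x - u x\<bar> \<partial>lebesgue_on \<Omega>)"
        using \<zeta> by (intro add_right_mono) blast
      finally show "(\<integral>\<^sup>+x. ennreal \<bar>v (r k) x - u x\<bar> \<partial>lebesgue_on \<Omega>)
          \<le> ennreal (\<epsilon> (r k)) + (\<integral>\<^sup>+x. ennreal \<bar>\<phi> x + \<zeta> (r k) x - u x\<bar> \<partial>lebesgue_on \<Omega>)" .
    next
      show "(\<lambda>k. ennreal (\<epsilon> (r k)) + (\<integral>\<^sup>+x. ennreal \<bar>\<phi> x + \<zeta> (r k) x - u x\<bar> \<partial>lebesgue_on \<Omega>)) \<longlonglongrightarrow> 0"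
        using tendsto_add[OF \<epsilon>0 conv] by simp
    qed simp
    then have "relaxed_willmore \<Omega> \<phi> u \<le> liminf (\<lambda>k. willmore \<Omega> (v (r k)))"
      unfolding relaxed_willmore_def using v by (intro Inf_lower CollectI exI[of _ "\<lambda>k. v (r k)"]) blast
    also have "\<dots> \<le> liminf (\<lambda>k. m + ennreal (\<epsilon> (r k)))"
      using v by (intro Liminf_mono always_eventually allI) blast
    also have "\<dots> = m"
      using tendsto_add[OF tendsto_const[of m] \<epsilon>0] by (intro lim_imp_Liminf) simp_all
    finally show ?thesis using u by blast
  qed
  then show ?thesis using lower order_trans by blast
qed

end
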